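(* Let $r,s\ge1$, let $m_1,\dots,m_r,n_1,\dots,n_s\in\mathbb Z$, and let $\pi_{i,j}=\lambda_{i,j}\cdot[D_{i,j},E_{i,j}]\in\mathcal P^\times_{x_i,y_j}$ for $1\le i\le r$, $1\le j\le s$, where $x_i,y_j\in J(K)$, $\lambda_{i,j}\in K^\times$, and $D_{i,j},E_{i,j}$ are effective divisors of degree $\delta$ on $C$. Suppose that effective divisors $D'_i,E'_i,E'',D''$ of degree $\delta$ and scalars $\mu_{i,j},\nu_i,\rho_i,\sigma\in K^\times$ satisfy, for all $i,j$, (a) $D'_i\sim D_{i,j}$ and $[D_{i,j},E_{i,j}]=\mu_{i,j}\cdot[D'_i,E_{i,j}]$; (b) $\bigotimes^{2}_{1\le j\le s}[D'_i,E_{i,j}]^{\overset{2}{\otimes}n_j}=\nu_i\cdot[D'_i,E'_i]$; (c) $E''\sim E'_i$ and $[D'_i,E'_i]=\rho_i\cdot[D'_i,E'']$; (d) $\bigotimes^{1}_{1\le i\le r}[D'_i,E'']^{\overset{1}{\otimes}m_i}=\sigma\cdot[D'',E'']$; where all the divisors denoted by a letter $D$ (including $D_0$) are disjoint from all those denoted by a letter $E$ (including $E_0$). Put $\tilde\nu_i=\nu_i\prod_{1\le j\le s}(\lambda_{i,j}\mu_{i,j})^{n_j}$. Then the bilinear combination of the $\pi_{i,j}$ with coefficients $(m_i)$ and $(n_j)$ is $$\bigotimes^{1}_{1\le i\le r}\left(\bigotimes^{2}_{1\le j\le s}\pi_{i,j}^{\overset{2}{\otimes}n_j}\right)^{\overset{1}{\otimes}m_i}=\left(\sigma\prod_{1\le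 i\le r}(\tilde\nu_i\rho_i)^{m_i}\right)\cdot[D'',E'']\in\mathcal P^\times_{\sum_i m_ix_i,\ \sum_j n_jy_j}.$$
   Context: $K$ is a field, $C$ is a nonsingular, complete, geometrically integral curve over $K$ of genus $g$ with $C(K)\neq\emptyset$, and $J$ is its Jacobian, so $J(K)=\operatorname{Pic}^0(C)$. For a nonzero rational function $f$, $(f)$ is its divisor; if $F=\sum_P n_P P$ is a divisor with support disjoint from that of $(f)$, then $f(F)=\prod_P N_{\kappa(P)/K}(f(P))^{n_P}\in K^\times$. Norms: for a divisor $F=\sum_P n_PP$ and a line bundle $\mathcal M$ on $C$, $\mathcal N_F(\mathcal M)$ is the one-dimensional $K$-vector space $\bigotimes_P \mathrm{Norm}_{\kappa(P)/K}(\mathcal M|_P)^{\otimes n_P}$. It is additive in $F$ and functorial and multiplicative in $\mathcal M$. A meromorphic section $s$ of $\mathcal M$ which is regular and non-vanishing around $\operatorname{Supp}F$ has a nonzero norm $\mathcal N_F(s\in\mathcal M)$. Poincaré torsor: $\mathcal P$ is the Poincaré (Mumford) bundle on $J\times J$ (identifying $J$ with its dual). For $x=[D]$, $y=[E]\in J(K)$ with $D,E\in\operatorname{Div}^0(C)$, its fibre at $(x,y)$ is $\mathcal P_{x,y}=\mathcal N_D(\mathcal O_C(E))$, where the spaces obtained from different choices of $D,E$ are identified as follows: (i) $\mathcal N_D(\mathcal O_C(E+(f)))\simeq\mathcal N_D(\mathcal O_C(E))$ is induced by the isomorphism $\mathcal O_C(E+(f))\to\mathcal O_C(E)$, $h\mapsto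 fh$; (ii) $\mathcal N_{D+(f)}(\mathcal O_C(E))\simeq\mathcal N_D(\mathcal O_C(E))$ identifies $\mathcal N_{D+(f)}(s)$ with $f((s)_E)\cdot\mathcal N_D(s)$, for any meromorphic section $s$ of $\mathcal O_C(E)$ whose divisor $(s)_E$ as a section of $\mathcal O_C(E)$ is disjoint from $D$ and from $(f)$. $\mathcal P^\times$ is $\mathcal P$ with its zero section removed; its fibres are $K^\times$-torsors, the action being written $\lambda\cdot\pi$. For $D,E\in\operatorname{Div}^0(C)$ with disjoint supports, $(D,E)$ denotes the point $\mathcal N_D(1\in\mathcal O_C(E))\in\mathcal P^\times_{[D],[E]}$. The left and right partial group laws $\overset{1}{\otimes}:\mathcal P^\times_{x,y}\times\mathcal P^\times_{x',y}\to\mathcal P^\times_{x+x',y}$ and $\overset{2}{\otimes}:\mathcal P^\times_{x,y}\times\mathcal P^\times_{x,y'}\to\mathcal P^\times_{x,y+y'}$ are induced by the canonical isomorphisms $\mathcal N_D(\mathcal O_C(E))\otimes\mathcal N_{D'}(\mathcal O_C(E))\simeq\mathcal N_{D+D'}(\mathcal O_C(E))$ and $\mathcal N_D(\mathcal O_C(E))\otimes\mathcal N_D(\mathcal O_C(E'))\simeq\mathcal N_D(\mathcal O_C(E+E'))$. For fixed $y$ (resp. fixed $x$) $\overset{1}{\otimes}$ (resp. $\overset{2}{\otimes}$) is a commutative group law on $\bigsqcup_x\mathcal P^\times_{x,y}$ (resp. $\bigsqcup_y\mathcal P^\times_{x,y}$), whose identity is $1\in K^\times$ under the canonical trivialisation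 of $\mathcal P^\times_{0,y}$ (resp. $\mathcal P^\times_{x,0}$). Powers are denoted $\pi^{\overset{1}{\otimes}n}$, $\pi^{\overset{2}{\otimes}n}$ ($n\in\mathbb Z$) and iterated products $\bigotimes^{1}$, $\bigotimes^{2}$; they satisfy $(\lambda\cdot\pi)^{\overset{k}{\otimes}n}=\lambda^n\cdot\pi^{\overset{k}{\otimes}n}$ for $k=1,2$. Fix a line bundle $\mathcal L$ on $C$ of degree $\delta\ge 2g+1$ and nonzero $d_0,e_0\in H^0(C,\mathcal L)$ whose divisors $D_0$ and $E_0$ are disjoint. For effective divisors $D,E$ of degree $\delta$ such that $D$ and $D_0$ are disjoint from $E$ and $E_0$, put $[D,E]:=(D-D_0,\,E-E_0)$, a point of $\mathcal P^\times_{[D-D_0],[E-E_0]}$. "Disjoint" means having disjoint supports. *)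

theory Defs
  imports
    "HOL-Algebra.Algebraic_Closure_Type"
    "HOL-Algebra.Coset"
    "HOL-Library.Function_Algebras"
    "Jordan_Normal_Form.Determinant"
begin

section \<open>Curves\<close>

text \<open>
  A nonsingular complete curve over a field \<open>K\<close> is represented by its function field \<open>F\<close>, given
  as a field embedding \<open>\<iota> : K \<rightarrow> F\<close>. Its closed points are the discrete valuation rings of \<open>F\<close>
  that contain \<open>K\<close>: a point \<open>P\<close> is its own local ring, a subset of \<open>F\<close>. By the valuative
  criterion, taking all these valuation rings amounts to completeness. The curve is not assumed
  to be smooth over \<open>K\<close>, only regular.
\<close>

definition rational_subfield :: "('k::field \<Rightarrow> 'f::field) \<Rightarrow> 'f \<Rightarrow> 'f set" where
  "rational_subfield \<iota> x = {poly (map_poly \<iota> p) x / poly (map_poly \<iota> q) x | p q. True}"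

definition function_field :: "('k::field \<Rightarrow> 'f::field) \<Rightarrow> bool" where
  "function_field \<iota> \<longleftrightarrow> field_hom \<iota> \<and>
     (\<exists>x. (\<forall>p. p \<noteq> 0 \<longrightarrow> poly (map_poly \<iota> p) x \<noteq> 0) \<and>
          (\<exists>bs. \<forall>h. \<exists>a. (\<forall>i<length bs. a i \<in> rational_subfield \<iota> x) \<and>
                        h = (\<Sum>i<length bs. a i * bs ! i)))"

text \<open>
  Geometric integrality: \<open>F \<otimes>\<^sub>K L\<close> is an integral domain for the algebraic closure \<open>L\<close> of \<open>K\<close>.
  A list of pairs \<open>(a, b)\<close> stands for the tensor \<open>\<Sum> a \<otimes> b\<close>. The dual space of \<open>F \<otimes>\<^sub>K L\<close> is the
  space of \<open>K\<close>-bilinear forms on \<open>F \<times> L\<close>, so a tensor is zero iff all these forms kill it.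
\<close>

definition tensor_zero :: "('k::field \<Rightarrow> 'f::field) \<Rightarrow> ('f \<times> 'k alg_closure) list \<Rightarrow> bool" where
  "tensor_zero \<iota> ts \<longleftrightarrow>
     (\<forall>\<beta> :: 'f \<Rightarrow> 'k alg_closure \<Rightarrow> 'k.
        (\<forall>b. Vector_Spaces.linear (\<lambda>c a. \<iota> c * a) (*) (\<lambda>a. \<beta> a b)) \<and>
        (\<forall>a. Vector_Spaces.linear (\<lambda>c b. to_ac c * b) (*) (\<beta> a))
        \<longrightarrow> (\<Sum>(a, b)\<leftarrow>ts. \<beta> a b) = 0)"

definition geometrically_integral :: "('k::field \<Rightarrow> 'f::field) \<Rightarrow> bool" where
  "geometrically_integral \<iota> \<longleftrightarrow>
     (\<forall>ts us. tensor_zero \<iota> [(a * a', b * b'). (a, b) \<leftarrow> ts, (a', b') \<leftarrow> us]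
        \<longrightarrow> tensor_zero \<iota> ts \<or> tensor_zero \<iota> us)"

definition curve :: "('k::field \<Rightarrow> 'f::field) \<Rightarrow> bool" where
  "curve \<iota> \<longleftrightarrow> function_field \<iota> \<and> geometrically_integral \<iota>"

definition local_units :: "'f::field set \<Rightarrow> 'f set" where
  "local_units P = {u \<in> P. u \<noteq> 0 \<and> inverse u \<in> P}"

definition max_ideal :: "'f::field set \<Rightarrow> 'f set" where
  "max_ideal P = P - local_units P"

definition uniformizer :: "'f::field set \<Rightarrow> 'f \<Rightarrow> bool" where
  "uniformizer P t \<longleftrightarrow> t \<in> max_ideal P \<and> t \<noteq> 0 \<and>
     (\<forall>f. f \<noteq> 0 \<longrightarrow> (\<exists>n::int. \<exists>u\<in>local_units P. f = t powi n * u))"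

definition closed_point :: "('k::field \<Rightarrow> 'f::field) \<Rightarrow> 'f set \<Rightarrow> bool" where
  "closed_point \<iota> P \<longleftrightarrow> range \<iota> \<subseteq> P \<and>
     (\<forall>a\<in>P. \<forall>b\<in>P. a + b \<in> P \<and> a - b \<in> P \<and> a * b \<in> P) \<and> (\<exists>t. uniformizer P t)"

definition ord_at :: "'f::field set \<Rightarrow> 'f \<Rightarrow> int" where
  "ord_at P f = (THE n. \<exists>t u. uniformizer P t \<and> u \<in> local_units P \<and> f = t powi n * u)"

definition has_rational_point :: "('k::field \<Rightarrow> 'f::field) \<Rightarrow> bool" where
  "has_rational_point \<iota> \<longleftrightarrow> (\<exists>P. closed_point \<iota> P \<and> (\<forall>h\<in>P. \<exists>c. h - \<iota> c \<in> max_ideal P))"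

text \<open>
  The genus \<open>dim H\<^sup>1(C, O)\<close>. By the flasque resolution of the structure sheaf, \<open>H\<^sup>1(C, O)\<close> is
  the space of repartitions modulo those that become everywhere regular after subtracting a
  constant family \<open>h \<in> F\<close>; its dimension is the least size of a generating family.
\<close>

definition repartitions :: "('k::field \<Rightarrow> 'f::field) \<Rightarrow> ('f set \<Rightarrow> 'f) set" where
  "repartitions \<iota> = {\<rho>. finite {P. closed_point \<iota> P \<and> \<rho> P \<notin> P}}"

definition genus :: "('k::field \<Rightarrow> 'f::field) \<Rightarrow> nat" where
  "genus \<iota> = (LEAST g. \<exists>b :: nat \<Rightarrow> 'f set \<Rightarrow> 'f. (\<forall>i<g. b i \<in> repartitions \<iota>) \<and>
     (\<forall>\<rho>\<in>repartitions \<iota>. \<exists>c h. \<forall>P. closed_point \<iota> P \<longrightarrow>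
        \<rho> P - (\<Sum>i<g. \<iota> (c i) * b i P) - h \<in> P))"


section \<open>Residue fields and their norms\<close>

text \<open>
  Elements of the residue field \<open>\<kappa>(P) = P / max_ideal P\<close> are represented by lifts to \<open>P\<close>.
  The norm is the determinant of multiplication in some \<open>K\<close>-basis.
\<close>

definition residue_basis :: "('k::field \<Rightarrow> 'f::field) \<Rightarrow> 'f set \<Rightarrow> 'f list \<Rightarrow> bool" where
  "residue_basis \<iota> P bs \<longleftrightarrow> set bs \<subseteq> P \<and>
     (\<forall>h\<in>P. \<exists>!c. c \<in> carrier_vec (length bs) \<and>
        h - (\<Sum>i<length bs. \<iota> (c $ i) * bs ! i) \<in> max_ideal P)"

definition some_residue_basis :: "('k::field \<Rightarrow> 'f::field) \<Rightarrow> 'f set \<Rightarrow> 'f list" where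
  "some_residue_basis \<iota> P = (SOME bs. residue_basis \<iota> P bs)"

definition point_degree :: "('k::field \<Rightarrow> 'f::field) \<Rightarrow> 'f set \<Rightarrow> nat" where
  "point_degree \<iota> P = length (some_residue_basis \<iota> P)"

definition residue_coords :: "('k::field \<Rightarrow> 'f::field) \<Rightarrow> 'f set \<Rightarrow> 'f \<Rightarrow> 'k vec" where
  "residue_coords \<iota> P h = (THE c. c \<in> carrier_vec (point_degree \<iota> P) \<and>
     h - (\<Sum>i<point_degree \<iota> P. \<iota> (c $ i) * some_residue_basis \<iota> P ! i) \<in> max_ideal P)"

definition residue_norm :: "('k::field \<Rightarrow> 'f::field) \<Rightarrow> 'f set \<Rightarrow> 'f \<Rightarrow> 'k" where
  "residue_norm \<iota> P h = det (mat_of_cols (point_degree \<iota> P)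
     (map (\<lambda>b. residue_coords \<iota> P (h * b)) (some_residue_basis \<iota> P)))"


section \<open>Divisors and the Picard group\<close>

type_synonym 'f divisor = "'f set \<Rightarrow> int"

definition Supp :: "'f divisor \<Rightarrow> 'f set set" where
  "Supp A = {P. A P \<noteq> 0}"

definition Div :: "('k::field \<Rightarrow> 'f::field) \<Rightarrow> 'f divisor set" where
  "Div \<iota> = {A. finite (Supp A) \<and> (\<forall>P\<in>Supp A. closed_point \<iota> P)}"

definition degree_div :: "('k::field \<Rightarrow> 'f::field) \<Rightarrow> 'f divisor \<Rightarrow> int" where
  "degree_div \<iota> A = (\<Sum>P\<in>Supp A. A P * int (point_degree \<iota> P))"

definition Div0 :: "('k::field \<Rightarrow> 'f::field) \<Rightarrow> 'f divisor set" where
  "Div0 \<iota> = {A \<in> Div \<iota>. degree_div \<iota> A = 0}"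

definition effective_of_degree :: "('k::field \<Rightarrow> 'f::field) \<Rightarrow> nat \<Rightarrow> 'f divisor \<Rightarrow> bool" where
  "effective_of_degree \<iota> d A \<longleftrightarrow> A \<in> Div \<iota> \<and> (\<forall>P. A P \<ge> 0) \<and> degree_div \<iota> A = int d"

definition disjoint_div :: "'f divisor \<Rightarrow> 'f divisor \<Rightarrow> bool" where
  "disjoint_div A B \<longleftrightarrow> disjnt (Supp A) (Supp B)"

definition principal :: "('k::field \<Rightarrow> 'f::field) \<Rightarrow> 'f \<Rightarrow> 'f divisor" where
  "principal \<iota> f = (\<lambda>P. if closed_point \<iota> P then ord_at P f else 0)"

definition lin_equiv :: "('k::field \<Rightarrow> 'f::field) \<Rightarrow> 'f divisor \<Rightarrow> 'f divisor \<Rightarrow> bool" where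
  "lin_equiv \<iota> A B \<longleftrightarrow> (\<exists>f. f \<noteq> 0 \<and> A = B + principal \<iota> f)"

text \<open>The value \<open>f(A)\<close>, meaningful if the divisor of \<open>f\<close> is disjoint from \<open>A\<close>.\<close>

definition eval_div :: "('k::field \<Rightarrow> 'f::field) \<Rightarrow> 'f \<Rightarrow> 'f divisor \<Rightarrow> 'k" where
  "eval_div \<iota> f A = (\<Prod>P\<in>Supp A. residue_norm \<iota> P f powi A P)"

definition div_group :: "('k::field \<Rightarrow> 'f::field) \<Rightarrow> 'f divisor monoid" where
  "div_group \<iota> = \<lparr>carrier = Div \<iota>, monoid.mult = (+), one = 0\<rparr>"

definition principal_divs :: "('k::field \<Rightarrow> 'f::field) \<Rightarrow> 'f divisor set" where
  "principal_divs \<iota> = principal \<iota> ` (UNIV - {0})"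

definition div_class :: "('k::field \<Rightarrow> 'f::field) \<Rightarrow> 'f divisor \<Rightarrow> 'f divisor set" where
  "div_class \<iota> A = principal_divs \<iota> #>\<^bsub>div_group \<iota>\<^esub> A"

text \<open>\<open>J(K) = Pic\<^sup>0(C)\<close>, in multiplicative notation.\<close>

definition Jac :: "('k::field \<Rightarrow> 'f::field) \<Rightarrow> 'f divisor set monoid" where
  "Jac \<iota> = (div_group \<iota> Mod principal_divs \<iota>)\<lparr>carrier := div_class \<iota> ` Div0 \<iota>\<rparr>"


section \<open>Line bundles\<close>

text \<open>
  A line bundle is given by its generic fibre, a one-dimensional \<open>F\<close>-vector space \<open>'v\<close> with
  scalar multiplication \<open>smul\<close>, and its stalks, free of rank one over the local rings and
  generated by a common vector at almost all points. The sections over an open set are the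
  elements of the intersection of the stalks; nonzero elements of \<open>'v\<close> are the nonzero
  meromorphic sections.
\<close>

record ('f, 'v) line_bundle =
  smul :: "'f \<Rightarrow> 'v \<Rightarrow> 'v"
  stalk :: "'f set \<Rightarrow> 'v set"

definition generator :: "('f::field, 'v::ab_group_add) line_bundle \<Rightarrow> 'f set \<Rightarrow> 'v \<Rightarrow> bool" where
  "generator M P g \<longleftrightarrow> g \<noteq> 0 \<and> stalk M P = {smul M c g | c. c \<in> P}"

definition is_line_bundle ::
    "('k::field \<Rightarrow> 'f::field) \<Rightarrow> ('f, 'v::ab_group_add) line_bundle \<Rightarrow> bool" where
  "is_line_bundle \<iota> M \<longleftrightarrow> vector_space (smul M) \<and>
     (\<exists>b. b \<noteq> 0 \<and> (\<forall>w. \<exists>c. w = smul M c b) \<and> finite {P. closed_point \<iota> P \<and> \<not> generator M P b}) \<and>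
     (\<forall>P. closed_point \<iota> P \<longrightarrow> (\<exists>g. generator M P g))"

text \<open>\<open>ratio M w v\<close> is the rational function \<open>w / v\<close>, for \<open>v \<noteq> 0\<close>.\<close>

definition ratio :: "('f, 'v) line_bundle \<Rightarrow> 'v \<Rightarrow> 'v \<Rightarrow> 'f" where
  "ratio M w v = (THE c. w = smul M c v)"

definition global_sections ::
    "('k::field \<Rightarrow> 'f::field) \<Rightarrow> ('f, 'v::ab_group_add) line_bundle \<Rightarrow> 'v set" where
  "global_sections \<iota> M = {s. \<forall>P. closed_point \<iota> P \<longrightarrow> s \<in> stalk M P}"

definition section_div ::
    "('k::field \<Rightarrow> 'f::field) \<Rightarrow> ('f, 'v::ab_group_add) line_bundle \<Rightarrow> 'v \<Rightarrow> 'f divisor" where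
  "section_div \<iota> M s =
     (\<lambda>P. if closed_point \<iota> P then ord_at P (ratio M s (SOME g. generator M P g)) else 0)"

text \<open>The degree of \<open>M\<close> is the common degree of the divisors of its meromorphic sections.\<close>

definition has_degree ::
    "('k::field \<Rightarrow> 'f::field) \<Rightarrow> ('f, 'v::ab_group_add) line_bundle \<Rightarrow> int \<Rightarrow> bool" where
  "has_degree \<iota> M d \<longleftrightarrow> (\<forall>s. s \<noteq> 0 \<longrightarrow> degree_div \<iota> (section_div \<iota> M s) = d)"

definition \<O> :: "'f::field divisor \<Rightarrow> ('f, 'f) line_bundle" where
  "\<O> E = \<lparr>smul = (*), stalk = (\<lambda>P. {h. h = 0 \<or> ord_at P h \<ge> - E P})\<rparr>"


section \<open>Norms of line bundles\<close>

text \<open>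
  A frame is a choice of a generator \<open>v P\<close> of the stalk of \<open>M\<close> at each closed point \<open>P\<close>; it
  gives a basis vector \<open>\<Otimes>\<^sub>P N(v P)\<^bsup>\<otimes>F P\<^esup>\<close> of the line
  \<open>\<Otimes>\<^sub>P Norm\<^bsub>\<kappa>(P)/K\<^esub>(M|P)\<^bsup>\<otimes>F P\<^esup>\<close>. An element of this line is represented by the function \<open>\<phi>\<close>
  sending each frame to the coordinate of the element in that basis. Since
  \<open>N(c v) = N\<^bsub>\<kappa>(P)/K\<^esub>(c) N(v)\<close>, these are the functions obeying the transformation law below
  (extended by \<open>0\<close> off frames). Tensor products of lines become products of coordinates.
\<close>

definition frames ::
    "('k::field \<Rightarrow> 'f::field) \<Rightarrow> ('f, 'v::ab_group_add) line_bundle \<Rightarrow> ('f set \<Rightarrow> 'v) set" where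
  "frames \<iota> M = {v. \<forall>P. closed_point \<iota> P \<longrightarrow> generator M P (v P)}"

definition norm_line ::
    "('k::field \<Rightarrow> 'f::field) \<Rightarrow> 'f divisor \<Rightarrow> ('f, 'v::ab_group_add) line_bundle
      \<Rightarrow> (('f set \<Rightarrow> 'v) \<Rightarrow> 'k) set" where
  "norm_line \<iota> F M = {\<phi>. (\<forall>v. v \<notin> frames \<iota> M \<longrightarrow> \<phi> v = 0) \<and>
     (\<forall>v\<in>frames \<iota> M. \<forall>w\<in>frames \<iota> M.
        \<phi> v = \<phi> w * (\<Prod>P\<in>Supp F. residue_norm \<iota> P (ratio M (w P) (v P)) powi F P))}"

text \<open>\<open>N\<^sub>F(s)\<close> for a meromorphic section \<open>s\<close> whose divisor is disjoint from \<open>F\<close>.\<close>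

definition norm_section ::
    "('k::field \<Rightarrow> 'f::field) \<Rightarrow> 'f divisor \<Rightarrow> ('f, 'v::ab_group_add) line_bundle \<Rightarrow> 'v
      \<Rightarrow> ('f set \<Rightarrow> 'v) \<Rightarrow> 'k" where
  "norm_section \<iota> F M s = (\<lambda>v. if v \<in> frames \<iota> M
     then \<Prod>P\<in>Supp F. residue_norm \<iota> P (ratio M s (v P)) powi F P else 0)"

text \<open>The map on norms induced by an isomorphism \<open>\<alpha>\<close> of line bundles.\<close>

definition norm_map :: "('v \<Rightarrow> 'w) \<Rightarrow> (('f set \<Rightarrow> 'v) \<Rightarrow> 'k) \<Rightarrow> (('f set \<Rightarrow> 'w) \<Rightarrow> 'k)" where
  "norm_map \<alpha> \<phi> = (\<lambda>w. \<phi> (inv_into UNIV \<alpha> \<circ> w))"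

text \<open>\<open>N\<^sub>D(M) \<otimes> N\<^sub>D\<^sub>'(M) \<simeq> N\<^sub>D\<^sub>+\<^sub>D\<^sub>'(M)\<close> and
  \<open>N\<^sub>D(\<O>(E)) \<otimes> N\<^sub>D(\<O>(E')) \<simeq> N\<^sub>D(\<O>(E + E'))\<close>.\<close>

definition norm_tensor1 ::
    "(('f set \<Rightarrow> 'v) \<Rightarrow> 'k::field) \<Rightarrow> (('f set \<Rightarrow> 'v) \<Rightarrow> 'k) \<Rightarrow> (('f set \<Rightarrow> 'v) \<Rightarrow> 'k)" where
  "norm_tensor1 \<phi> \<phi>' = (\<lambda>v. \<phi> v * \<phi>' v)"

definition norm_tensor2 ::
    "('k::field \<Rightarrow> 'f::field) \<Rightarrow> 'f divisor \<Rightarrow> 'f divisor \<Rightarrow> 'f divisor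
      \<Rightarrow> (('f set \<Rightarrow> 'f) \<Rightarrow> 'k) \<Rightarrow> (('f set \<Rightarrow> 'f) \<Rightarrow> 'k) \<Rightarrow> (('f set \<Rightarrow> 'f) \<Rightarrow> 'k)" where
  "norm_tensor2 \<iota> D E E' \<phi> \<phi>' = (THE \<psi>. \<psi> \<in> norm_line \<iota> D (\<O> (E + E')) \<and>
     (\<forall>v\<in>frames \<iota> (\<O> E). \<forall>v'\<in>frames \<iota> (\<O> E'). \<psi> (\<lambda>P. v P * v' P) = \<phi> v * \<phi>' v'))"


section \<open>The Poincare torsor\<close>

text \<open>
  A triple \<open>(D, E, \<phi>)\<close> stands for the nonzero element \<open>\<phi>\<close> of \<open>N\<^sub>D(\<O>(E))\<close>. Points of the
  Poincare torsor are classes of triples under the equivalence relation generated by the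
  identifications between different choices of \<open>D\<close> and \<open>E\<close> in their linear equivalence classes.
\<close>

type_synonym ('k, 'f) triple = "'f divisor \<times> 'f divisor \<times> (('f set \<Rightarrow> 'f) \<Rightarrow> 'k)"

definition triples :: "('k::field \<Rightarrow> 'f::field) \<Rightarrow> ('k, 'f) triple set" where
  "triples \<iota> = {(D, E, \<phi>). D \<in> Div0 \<iota> \<and> E \<in> Div0 \<iota> \<and>
     \<phi> \<in> norm_line \<iota> D (\<O> E) \<and> \<phi> \<noteq> (\<lambda>_. 0)}"

inductive ident :: "('k::field \<Rightarrow> 'f::field) \<Rightarrow> ('k, 'f) triple \<Rightarrow> ('k, 'f) triple \<Rightarrow> bool"
  for \<iota> where
  change_E: "ident \<iota> (D, E + principal \<iota> f, \<phi>) (D, E, norm_map (\<lambda>h. f * h) \<phi>)"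
    if "(D, E + principal \<iota> f, \<phi>) \<in> triples \<iota>" "E \<in> Div0 \<iota>" "f \<noteq> 0"
| change_D: "ident \<iota>
      (D + principal \<iota> f, E, \<lambda>v. c * norm_section \<iota> (D + principal \<iota> f) (\<O> E) s v)
      (D, E, \<lambda>v. c * eval_div \<iota> f (section_div \<iota> (\<O> E) s) * norm_section \<iota> D (\<O> E) s v)"
    if "D \<in> Div0 \<iota>" "D + principal \<iota> f \<in> Div0 \<iota>" "E \<in> Div0 \<iota>" "f \<noteq> 0" "s \<noteq> 0" "c \<noteq> 0"
       "disjoint_div (section_div \<iota> (\<O> E) s) D"
       "disjoint_div (section_div \<iota> (\<O> E) s) (principal \<iota> f)"

definition point_of :: "('k::field \<Rightarrow> 'f::field) \<Rightarrow> ('k, 'f) triple \<Rightarrow> ('k, 'f) triple set" where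
  "point_of \<iota> t = {t'. equivclp (ident \<iota>) t t'}"

definition fibre ::
    "('k::field \<Rightarrow> 'f::field) \<Rightarrow> 'f divisor set \<Rightarrow> 'f divisor set \<Rightarrow> ('k, 'f) triple set set" where
  "fibre \<iota> x y =
     {point_of \<iota> (D, E, \<phi>) | D E \<phi>. (D, E, \<phi>) \<in> triples \<iota> \<and> div_class \<iota> D = x \<and> div_class \<iota> E = y}"

text \<open>The action of \<open>K\<^sup>\<times>\<close>.\<close>

definition scale_point :: "'k::field \<Rightarrow> ('k, 'f) triple set \<Rightarrow> ('k, 'f) triple set" where
  "scale_point c \<pi> = (\<lambda>(D, E, \<phi>). (D, E, \<lambda>v. c * \<phi> v)) ` \<pi>"

text \<open>The point \<open>(D, E)\<close>, for disjoint \<open>D\<close> and \<open>E\<close>.\<close>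

definition div_point ::
    "('k::field \<Rightarrow> 'f::field) \<Rightarrow> 'f divisor \<Rightarrow> 'f divisor \<Rightarrow> ('k, 'f) triple set" where
  "div_point \<iota> D E = point_of \<iota> (D, E, norm_section \<iota> D (\<O> E) 1)"

definition tensor1 ::
    "('k::field \<Rightarrow> 'f::field) \<Rightarrow> ('k, 'f) triple set \<Rightarrow> ('k, 'f) triple set \<Rightarrow> ('k, 'f) triple set" where
  "tensor1 \<iota> \<pi> \<pi>' = (THE \<tau>. \<exists>D D' E \<phi> \<phi>'. (D, E, \<phi>) \<in> \<pi> \<and> (D', E, \<phi>') \<in> \<pi>' \<and>
     \<tau> = point_of \<iota> (D + D', E, norm_tensor1 \<phi> \<phi>'))"

definition tensor2 ::
    "('k::field \<Rightarrow> 'f::field) \<Rightarrow> ('k, 'f) triple set \<Rightarrow> ('k, 'f) triple set \<Rightarrow> ('k, 'f) triple set" where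
  "tensor2 \<iota> \<pi> \<pi>' = (THE \<tau>. \<exists>D E E' \<phi> \<phi>'. (D, E, \<phi>) \<in> \<pi> \<and> (D, E', \<phi>') \<in> \<pi>' \<and>
     \<tau> = point_of \<iota> (D, E + E', norm_tensor2 \<iota> D E E' \<phi> \<phi>'))"

text \<open>
  The group laws for fixed \<open>y\<close> and for fixed \<open>x\<close>. The units come from \<open>N\<^sub>0(\<O>(E)) = K\<close>, an empty
  tensor product whose element \<open>1\<close> has coordinate \<open>1\<close> in every frame, and from
  \<open>N\<^sub>D(\<O>) = K\<close>, in which \<open>1\<close> is the norm of the section \<open>1\<close>.
\<close>

definition group1 ::
    "('k::field \<Rightarrow> 'f::field) \<Rightarrow> 'f divisor set \<Rightarrow> ('k, 'f) triple set monoid" where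
  "group1 \<iota> y = \<lparr>carrier = (\<Union>x\<in>carrier (Jac \<iota>). fibre \<iota> x y), monoid.mult = tensor1 \<iota>,
     one = (THE \<tau>. \<exists>E\<in>Div0 \<iota>. div_class \<iota> E = y \<and>
              \<tau> = point_of \<iota> (0, E, \<lambda>v. if v \<in> frames \<iota> (\<O> E) then 1 else 0))\<rparr>"

definition group2 ::
    "('k::field \<Rightarrow> 'f::field) \<Rightarrow> 'f divisor set \<Rightarrow> ('k, 'f) triple set monoid" where
  "group2 \<iota> x = \<lparr>carrier = (\<Union>y\<in>carrier (Jac \<iota>). fibre \<iota> x y), monoid.mult = tensor2 \<iota>,
     one = (THE \<tau>. \<exists>D\<in>Div0 \<iota>. div_class \<iota> D = x \<and>
              \<tau> = point_of \<iota> (D, 0, norm_section \<iota> D (\<O> 0) 1))\<rparr>"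

end

(*
  The identifications that define the Poincare torsor are expressed in coordinates. Choosing a
  uniformizer t_P at each closed point P gives the line N_D(O(E)) the basis vector attached to the
  frame t_P^(-E(P)), and gives a pairing pair f A = prod_P N(f t_P^(-ord_P f))^(A(P)) that is
  bimultiplicative for all functions f <> 0 and divisors A and equals f(A) if the supports are
  disjoint. Replacing E + (f) by E multiplies the coordinate by pair f D, and replacing D + (g) by D
  multiplies it by a factor that is bimultiplicative in g and E modulo the group generated by all
  g((h)) / h((g)) with (g) and (h) disjoint. By Weil reciprocity this group is trivial, but it
  suffices to compute modulo it: both partial group laws multiply coordinates, so they are
  well-defined commutative group laws, compatible with the action of K^*.
*)

theory Submission
  imports Defs
begin

section \<open>Valuations of closed points\<close>

text \<open>The difficulty is well-definedness: units and products of the torsor are given by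
  \<open>THE\<close> over representatives, and points are classes of a generated equivalence, so an
  exact criterion for two triples to represent the same point is required. A change of D is
  prescribed only through sections whose divisor avoids both D and (g), and two such sections may
  give different scalars. Weak approximation supplies enough sections. Conversely, every discrepancy
  between two sections is realized by a chain of identifications, so a criterion modulo these
  discrepancies loses nothing. Two global facts make the products meaningful. A function is
  determined by its divisor up to a constant; this follows from the rational point and from
  principal divisors having degree zero. And a constant drops out, because its value on a divisor of
  degree zero is 1. All of this rests on norms from residue fields, which are defined by a chosen
  basis, so the residue fields must first be shown to be finite over K.\<close>

locale closed_pt = field_hom \<iota> for \<iota> :: "'k::field \<Rightarrow> 'f::field" +
  fixes P :: "'f set"
  assumes closed: "closed_point \<iota> P"
begin

lemma const_mem [simp]: "\<iota> c \<in> P"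
  using closed unfolding closed_point_def by blast

lemma zero_mem [simp]: "0 \<in> P" and one_mem [simp]: "1 \<in> P"
  using const_mem[of 0] const_mem[of 1] by simp_all

lemma add_mem: "a \<in> P \<Longrightarrow> b \<in> P \<Longrightarrow> a + b \<in> P"
  and diff_mem: "a \<in> P \<Longrightarrow> b \<in> P \<Longrightarrow> a - b \<in> P"
  and mult_mem: "a \<in> P \<Longrightarrow> b \<in> P \<Longrightarrow> a * b \<in> P"
  using closed unfolding closed_point_def by blast+

lemma uminus_mem: "a \<in> P \<Longrightarrow> - a \<in> P"
  using diff_mem[of 0 a] by simp

lemma power_mem: "a \<in> P \<Longrightarrow> a ^ n \<in> P"
  by (induction n) (auto intro: mult_mem)

lemma unit_iff: "u \<in> local_units P \<longleftrightarrow> u \<in> P \<and> u \<noteq> 0 \<and> inverse u \<in> P"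
  by (simp add: local_units_def)

lemma unit_mult: "u \<in> local_units P \<Longrightarrow> v \<in> local_units P \<Longrightarrow> u * v \<in> local_units P"
  by (auto simp: unit_iff intro: mult_mem)

lemma unit_inverse: "u \<in> local_units P \<Longrightarrow> inverse u \<in> local_units P"
  by (auto simp: unit_iff)

lemma unit_powi: "u \<in> local_units P \<Longrightarrow> u powi n \<in> local_units P"
  by (auto simp: unit_iff power_int_def power_mem simp flip: power_inverse)

lemma powi_mem_iff:
  assumes t: "uniformizer P t" and u: "u \<in> local_units P"
  shows "t powi n * u \<in> P \<longleftrightarrow> n \<ge> 0"
proof
  from t have t': "t \<in> P" "t \<noteq> 0" "inverse t \<notin> P"
    by (auto simp: uniformizer_def max_ideal_def unit_iff)
  show "t powi n * u \<in> P" if "n \<ge> 0"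
    using that t' u mult_mem[OF power_mem, of t u "nat n"] by (simp add: power_int_def unit_iff)
  show "n \<ge> 0" if "t powi n * u \<in> P"
  proof (rule ccontr)
    assume "\<not> n \<ge> 0"
    \<comment> \<open>For negative n this exponent makes the product with
      \<open>inverse u * t ^ k\<close> equal to \<open>inverse t\<close>, which is not in P.\<close>
    define k where "k = nat (- n - 1)"
    with \<open>\<not> n \<ge> 0\<close> have n: "n = - 1 - int k" by simp
    have "t powi n * u * (inverse u * t ^ k) \<in> P"
      using mult_mem[OF that mult_mem[OF _ power_mem]] u t' by (simp add: unit_iff)
    also have "t powi n * u * (inverse u * t ^ k) = inverse t"
      using t' u by (simp add: n power_int_diff power_int_minus unit_iff)
    finally show False using t' by simp
  qed
qed

lemma powi_unit_iff:
  assumes t: "uniformizer P t" and u: "u \<in> local_units P"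
  shows "t powi n * u \<in> local_units P \<longleftrightarrow> n = 0"
proof -
  have "inverse (t powi n * u) = t powi (-n) * inverse u"
    by (simp add: power_int_minus)
  moreover have "t \<noteq> 0" "u \<noteq> 0"
    using t u by (auto simp: uniformizer_def unit_iff)
  ultimately show ?thesis
    using powi_mem_iff[OF t u, of n] powi_mem_iff[OF t unit_inverse[OF u], of "-n"]
    by (auto simp: unit_iff)
qed

lemma powi_max_ideal_iff:
  assumes t: "uniformizer P t" and u: "u \<in> local_units P"
  shows "t powi n * u \<in> max_ideal P \<longleftrightarrow> n \<ge> 1"
  using powi_mem_iff[OF assms, of n] powi_unit_iff[OF assms, of n]
  by (auto simp: max_ideal_def)

lemma uniformizer_decomp:
  assumes "uniformizer P t" "f \<noteq> 0"
  obtains n u where "u \<in> local_units P" "f = t powi n * u"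
  using assms by (auto simp: uniformizer_def)

text \<open>The definition lets the uniformizer vary. Two uniformizers satisfy t' = t^a v and t =
  t'^b v' with units v, v' and with a, b >= 1, as both lie in the maximal ideal. Hence ab = 1, and
  they differ by a unit.\<close>

lemma ord_at_eq:
  assumes t: "uniformizer P t" and u: "u \<in> local_units P"
  shows "ord_at P (t powi n * u) = n"
  unfolding ord_at_def
proof (rule the_equality)
  fix k assume "\<exists>t' w. uniformizer P t' \<and> w \<in> local_units P \<and> t powi n * u = t' powi k * w"
  then obtain t' w where t': "uniformizer P t'" "w \<in> local_units P" "t powi n * u = t' powi k * w"
    by blast
  have nz: "t \<noteq> 0" "t' \<noteq> 0" "u \<noteq> 0" "w \<noteq> 0"
    using t t' u by (auto simp: uniformizer_def unit_iff)
  obtain a v where v: "v \<in> local_units P" "t' = t powi a * v"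
    by (rule uniformizer_decomp[OF t nz(2)])
  obtain b v' where v': "v' \<in> local_units P" "t = t' powi b * v'"
    by (rule uniformizer_decomp[OF t'(1) nz(1)])
  have "a \<ge> 1" "b \<ge> 1"
    using t t' powi_max_ideal_iff[OF t v(1), of a] powi_max_ideal_iff[OF t'(1) v'(1), of b]
    by (simp_all add: uniformizer_def flip: v(2) v'(2))
  have "v \<noteq> 0" "v' \<noteq> 0" using v v' by (auto simp: unit_iff)
  have "t powi (a * b - 1) * (v powi b * v') = (t powi a * v) powi b * v' / t"
    using nz by (simp add: power_int_diff power_int_mult power_int_mult_distrib field_simps)
  also have "\<dots> = 1" using v(2) v'(2) nz by simp
  finally have "t powi (a * b - 1) * (v powi b * v') \<in> local_units P"
    by (simp add: unit_iff)
  then have "a * b = 1"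
    using powi_unit_iff[OF t unit_mult[OF unit_powi[OF v(1)] v'(1)]] by simp
  with \<open>a \<ge> 1\<close> have a: "a = 1"
    using zmult_eq_1_iff[of a b] by auto
  have "t powi (n - k) * u = (t powi n * u) / t powi k"
    using nz by (simp add: power_int_diff)
  also have "\<dots> = v powi k * w"
    using nz t'(3) v(2) a by (simp add: power_int_mult_distrib)
  finally have "t powi (n - k) * u \<in> local_units P"
    using unit_mult[OF unit_powi[OF v(1)] t'(2)] by simp
  then show "k = n" using powi_unit_iff[OF t u] by simp
qed (use t u in blast)

lemma ex_uniformizer: "\<exists>t. uniformizer P t"
  using closed by (simp add: closed_point_def)

lemma ord_decomp:
  assumes "f \<noteq> 0"
  obtains t u where "uniformizer P t" "u \<in> local_units P" "f = t powi ord_at P f * u"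
proof -
  obtain t where t: "uniformizer P t" using ex_uniformizer by blast
  obtain n u where "u \<in> local_units P" "f = t powi n * u"
    by (rule uniformizer_decomp[OF t assms])
  with t ord_at_eq[OF t this(1)] that show thesis by simp
qed

lemma mem_iff: "f \<noteq> 0 \<Longrightarrow> f \<in> P \<longleftrightarrow> ord_at P f \<ge> 0"
proof -
  assume f: "f \<noteq> 0"
  then obtain t u where t: "uniformizer P t" "u \<in> local_units P" "f = t powi ord_at P f * u"
    by (rule ord_decomp)
  show ?thesis
    using powi_mem_iff[OF t(1,2), of "ord_at P f"] by (simp flip: t(3))
qed

lemma unit_iff_ord: "f \<in> local_units P \<longleftrightarrow> f \<noteq> 0 \<and> ord_at P f = 0"
proof (cases "f = 0")
  case False
  then obtain t u where t: "uniformizer P t" "u \<in> local_units P" "f = t powi ord_at P f * u"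
    by (rule ord_decomp)
  show ?thesis
    using powi_unit_iff[OF t(1,2), of "ord_at P f"] False by (simp flip: t(3))
qed (simp add: unit_iff)

lemma max_ideal_iff: "f \<in> max_ideal P \<longleftrightarrow> f = 0 \<or> ord_at P f \<ge> 1"
proof (cases "f = 0")
  case False
  then obtain t u where t: "uniformizer P t" "u \<in> local_units P" "f = t powi ord_at P f * u"
    by (rule ord_decomp)
  show ?thesis
    using powi_max_ideal_iff[OF t(1,2), of "ord_at P f"] False by (simp flip: t(3))
qed (simp add: max_ideal_def local_units_def)

lemma ord_mult: 
  assumes "f \<noteq> 0" "g \<noteq> 0"
  shows "ord_at P (f * g) = ord_at P f + ord_at P g"
proof -
  obtain t u where t: "uniformizer P t" "u \<in> local_units P" "f = t powi ord_at P f * u"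
    by (rule ord_decomp[OF assms(1)])
  obtain n v where v: "v \<in> local_units P" "g = t powi n * v"
    by (rule uniformizer_decomp[OF t(1) assms(2)])
  have n: "ord_at P g = n" using ord_at_eq[OF t(1) v(1)] v(2) by simp
  have "t \<noteq> 0" using t by (auto simp: uniformizer_def)
  then have "f * g = t powi (ord_at P f + n) * (u * v)"
    using t(3) v(2) by (simp add: power_int_add)
  then show ?thesis using ord_at_eq[OF t(1) unit_mult[OF t(2) v(1)]] n by simp
qed

lemma ord_one [simp]: "ord_at P 1 = 0"
  using ord_mult[of 1 1] by simp

lemma ord_inverse: "f \<noteq> 0 \<Longrightarrow> ord_at P (inverse f) = - ord_at P f"
  using ord_mult[of f "inverse f"] by simp

lemma ord_divide: "f \<noteq> 0 \<Longrightarrow> g \<noteq> 0 \<Longrightarrow> ord_at P (f / g) = ord_at P f - ord_at P g"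
  using ord_mult[of f "inverse g"] by (simp add: ord_inverse divide_inverse)

lemma ord_const [simp]: "c \<noteq> 0 \<Longrightarrow> ord_at P (\<iota> c) = 0"
  using unit_iff_ord[of "\<iota> c"] const_mem[of c] const_mem[of "inverse c"]
  by (simp add: unit_iff hom_inverse)

lemma ord_uminus [simp]: "f \<noteq> 0 \<Longrightarrow> ord_at P (- f) = ord_at P f"
  using ord_mult[of "\<iota> (- 1)" f] ord_const[of "- 1"] by (simp add: hom_uminus del: ord_const)

lemma ord_power: "f \<noteq> 0 \<Longrightarrow> ord_at P (f ^ n) = int n * ord_at P f"
  by (induction n) (simp_all add: ord_mult algebra_simps)

lemma ord_powi: "f \<noteq> 0 \<Longrightarrow> ord_at P (f powi n) = n * ord_at P f"
  by (simp add: power_int_def ord_power ord_inverse flip: power_inverse)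

lemma ord_uniformizer: "uniformizer P t \<Longrightarrow> ord_at P t = 1"
  using ord_at_eq[of t 1 1] by (simp add: unit_iff)

text \<open>After division by t^k this is the closure of the valuation ring under addition.\<close>

lemma ord_add_ge:
  assumes "f \<noteq> 0" "g \<noteq> 0" "f + g \<noteq> 0" "ord_at P f \<ge> k" "ord_at P g \<ge> k"
  shows "ord_at P (f + g) \<ge> k"
proof -
  obtain t where t: "uniformizer P t" using ex_uniformizer by blast
  have t0: "t \<noteq> 0" using t by (auto simp: uniformizer_def)
  have "h * t powi (- k) \<in> P" if "h \<noteq> 0" "ord_at P h \<ge> k" for h
    using that t0 by (simp add: mem_iff ord_mult ord_powi ord_uniformizer[OF t])
  from add_mem[OF this[of f] this[of g]] assms have "(f + g) * t powi (- k) \<in> P"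
    by (simp add: distrib_right)
  then show ?thesis
    using assms(3) t0 by (simp add: mem_iff ord_mult ord_powi ord_uniformizer[OF t])
qed

lemma ord_add_eq:
  assumes "f \<noteq> 0" "g = 0 \<or> ord_at P f < ord_at P g"
  shows "f + g \<noteq> 0 \<and> ord_at P (f + g) = ord_at P f"
proof (cases "g = 0")
  case False
  with assms have lt: "ord_at P f < ord_at P g" by simp
  have nz: "f + g \<noteq> 0"
    using lt ord_uminus[OF False] by (metis add_eq_0_iff2 less_irrefl)
  have 1: "ord_at P (f + g) \<ge> ord_at P f"
    using ord_add_ge[OF assms(1) False nz] lt by simp
  \<comment> \<open>Otherwise f = (f + g) + (- g) would be a sum of two elements of order above that
    of f.\<close>
  have "\<not> ord_at P (f + g) \<ge> ord_at P f + 1"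
    using ord_add_ge[of "f + g" "- g" "ord_at P f + 1"] lt assms(1) False nz by auto
  with 1 nz show ?thesis by simp
qed (use assms in simp)

lemma ideal_add: "a \<in> max_ideal P \<Longrightarrow> b \<in> max_ideal P \<Longrightarrow> a + b \<in> max_ideal P"
  using ord_add_ge[of a b 1] unfolding max_ideal_iff
  by (cases "a = 0"; cases "b = 0"; cases "a + b = 0") auto

lemma ideal_mult: "a \<in> P \<Longrightarrow> b \<in> max_ideal P \<Longrightarrow> a * b \<in> max_ideal P"
  unfolding max_ideal_iff using mem_iff[of a]
  by (cases "a = 0"; cases "b = 0") (auto simp: ord_mult)

lemma ideal_uminus: "a \<in> max_ideal P \<Longrightarrow> - a \<in> max_ideal P"
  unfolding max_ideal_iff by (cases "a = 0") auto

lemma ideal_diff: "a \<in> max_ideal P \<Longrightarrow> b \<in> max_ideal P \<Longrightarrow> a - b \<in> max_ideal P"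
  using ideal_add[of a "- b"] ideal_uminus[of b] by simp

lemma ideal_zero [simp]: "0 \<in> max_ideal P"
  by (simp add: max_ideal_iff)

lemma ideal_one [simp]: "1 \<notin> max_ideal P"
  by (simp add: max_ideal_iff)

lemma ideal_sum: "(\<And>i. i \<in> A \<Longrightarrow> f i \<in> max_ideal P) \<Longrightarrow> sum f A \<in> max_ideal P"
  by (induction A rule: infinite_finite_induct) (auto intro: ideal_add)

lemma unit_iff_not_ideal: "a \<in> local_units P \<longleftrightarrow> a \<in> P \<and> a \<notin> max_ideal P"
  by (auto simp: max_ideal_def unit_iff)

lemma ideal_prime: "a \<in> P \<Longrightarrow> b \<in> P \<Longrightarrow> a * b \<in> max_ideal P \<Longrightarrow> a \<in> max_ideal P \<or> b \<in> max_ideal P"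
  using unit_mult unit_iff_not_ideal by blast

end

section \<open>Finiteness of residue fields\<close>

definition subfield_set :: "'f::field set \<Rightarrow> bool" where
  "subfield_set S \<longleftrightarrow> 1 \<in> S \<and> (\<forall>a\<in>S. \<forall>b\<in>S. a + b \<in> S \<and> a - b \<in> S \<and> a * b \<in> S \<and> a / b \<in> S)"

lemma subfield_set_zero: "subfield_set S \<Longrightarrow> 0 \<in> S"
  unfolding subfield_set_def by (metis diff_self)

lemma subfield_set_sum:
  assumes "subfield_set S" "\<And>i. i \<in> A \<Longrightarrow> f i \<in> S"
  shows "sum f A \<in> S"
  using assms(2)
  by (induction A rule: infinite_finite_induct)
     (use assms(1) subfield_set_zero in \<open>auto simp: subfield_set_def\<close>)

text \<open>Gaussian elimination, by induction on the equations. It uses only field operations of S,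
  so the nonzero solution stays in S although the ambient field is larger.\<close>

lemma homogeneous_system:
  fixes A :: "'j \<Rightarrow> 'i \<Rightarrow> 'f::field"
  assumes S: "subfield_set S" and "finite I" and "finite J" and "card I < card J"
    and "\<And>i j. i \<in> I \<Longrightarrow> j \<in> J \<Longrightarrow> A j i \<in> S"
  shows "\<exists>c. (\<forall>j\<in>J. c j \<in> S) \<and> (\<exists>j\<in>J. c j \<noteq> 0) \<and> (\<forall>i\<in>I. (\<Sum>j\<in>J. c j * A j i) = 0)"
  using assms(2-)
proof (induction I arbitrary: J A rule: finite_induct)
  case empty
  then obtain j where "j \<in> J" by fastforce
  with S show ?case by (intro exI[of _ "\<lambda>_. 1"]) (auto simp: subfield_set_def)
next
  case (insert i0 I)
  show ?case
  proof (cases "\<forall>j\<in>J. A j i0 = 0")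
    case True
    have "card I < card J" using insert.prems(2) insert.hyps by simp
    then obtain c where
      "\<forall>j\<in>J. c j \<in> S" "\<exists>j\<in>J. c j \<noteq> 0" "\<forall>i\<in>I. (\<Sum>j\<in>J. c j * A j i) = 0"
      using insert.IH[of J A] insert.prems by blast
    with True show ?thesis by (intro exI[of _ c]) simp
  next
    case False
    then obtain k where k: "k \<in> J" "A k i0 \<noteq> 0" by blast
    define J' where "J' = J - {k}"
    \<comment> \<open>The coefficients left after the unknown k has been eliminated by means of the
      equation i0 with pivot \<open>A k i0\<close>.\<close>
    define B where "B = (\<lambda>j i. A j i - A j i0 / A k i0 * A k i)"
    have "finite J'" "card I < card J'"
      using insert.prems insert.hyps k by (auto simp: J'_def)
    moreover have "B j i \<in> S" if "i \<in> I" "j \<in> J'" for i j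
      using S that insert.prems(3)[of i] insert.prems(3)[of i0] k
      by (auto simp: B_def J'_def subfield_set_def)
    ultimately obtain c where c: "\<forall>j\<in>J'. c j \<in> S" "\<exists>j\<in>J'. c j \<noteq> 0"
        "\<forall>i\<in>I. (\<Sum>j\<in>J'. c j * B j i) = 0"
      using insert.IH[of J' B] by blast
    \<comment> \<open>The eliminated unknown gets the value that the equation i0 forces.\<close>
    define c' where "c' = c(k := - (\<Sum>j\<in>J'. c j * (A j i0 / A k i0)))"
    have c'k: "c' k = - (\<Sum>j\<in>J'. c j * (A j i0 / A k i0))" by (simp add: c'_def)
    have c'j: "c' j = c j" if "j \<in> J'" for j using that by (auto simp: c'_def J'_def)
    have split: "(\<Sum>j\<in>J. c' j * A j i) = c' k * A k i + (\<Sum>j\<in>J'. c j * A j i)" for i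
      using k(1) insert.prems(1) c'j by (simp add: J'_def sum.remove[of J k])
    have "(\<Sum>j\<in>J'. c j * (A j i0 / A k i0)) \<in> S"
      using S c(1) insert.prems(3) k
      by (intro subfield_set_sum) (auto simp: subfield_set_def J'_def)
    then have "c' k \<in> S"
      using S subfield_set_zero[OF S] unfolding c'k subfield_set_def by (metis diff_0)
    with c(1) have 1: "\<forall>j\<in>J. c' j \<in> S"
      by (metis J'_def c'j insertE insert_Diff k(1))
    have 2: "\<exists>j\<in>J. c' j \<noteq> 0"
      using c(2) c'j unfolding J'_def by (metis Diff_iff)
    have "(\<Sum>j\<in>J. c' j * A j i) = 0" if "i \<in> I" for i
    proof -
      have "(\<Sum>j\<in>J. c' j * A j i) = (\<Sum>j\<in>J'. c j * B j i)"
        unfolding split c'k B_def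
        by (simp add: sum_distrib_right right_diff_distrib sum_subtractf mult.assoc)
      with c(3) that show ?thesis by simp
    qed
    moreover have "(\<Sum>j\<in>J. c' j * A j i0) = 0"
      unfolding split c'k using k(2) by (simp add: sum_distrib_right mult.assoc)
    ultimately show ?thesis using 1 2 by blast
  qed
qed

section \<open>Values of polynomials and the subfield K(y)\<close>

context field_hom
begin

abbreviation ev :: "'b \<Rightarrow> 'a poly \<Rightarrow> 'b" where
  "ev y p \<equiv> poly (map_poly hom p) y"

lemma ev_const [simp]: "ev y [:c:] = hom c"
  by (simp add: Polynomial.map_poly_pCons)

lemma ev_pCons: "ev y (pCons c p) = hom c + y * ev y p"
  by (simp add: Polynomial.map_poly_pCons)

lemma ev_add: "ev y (p + q) = ev y p + ev y q"
proof (induction p arbitrary: q)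
  case (pCons a p)
  show ?case
  proof (cases q)
    case (pCons b q')
    then show ?thesis by (simp add: ev_pCons pCons.IH hom_add algebra_simps)
  qed
qed simp

lemma ev_smult: "ev y (smult c p) = hom c * ev y p"
  by (induction p) (simp_all add: ev_pCons hom_mult algebra_simps)

lemma ev_uminus: "ev y (- p) = - ev y p"
  using ev_smult[where c = "- 1" and y = y and p = p] by (simp add: hom_uminus)

lemma ev_diff: "ev y (p - q) = ev y p - ev y q"
  using ev_add[where y = y and p = p and q = "- q"] by (simp add: ev_uminus)

lemma ev_mult: "ev y (p * q) = ev y p * ev y q"
  by (induction p) (simp_all add: ev_pCons ev_add ev_smult algebra_simps)

lemma ev_altdef: "ev y p = (\<Sum>j\<le>degree p. hom (poly.coeff p j) * y ^ j)"
proof -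
  have "degree (map_poly hom p) = degree p" by (rule degree_map_poly) simp
  then show ?thesis by (simp add: poly_altdef Polynomial.coeff_map_poly)
qed

text \<open>The definition admits vanishing denominators. As division by 0 gives 0, such a fraction
  can be rewritten as 0 / 1.\<close>

lemma rational_subfield_iff:
  "a \<in> rational_subfield hom y \<longleftrightarrow> (\<exists>p q. ev y q \<noteq> 0 \<and> a = ev y p / ev y q)"
proof
  assume "a \<in> rational_subfield hom y"
  then obtain p q where a: "a = ev y p / ev y q" by (auto simp: rational_subfield_def)
  show "\<exists>p q. ev y q \<noteq> 0 \<and> a = ev y p / ev y q"
  proof (cases "ev y q = 0")
    case True
    with a show ?thesis by (intro exI[of _ 0] exI[of _ "[:1:]"]) simp
  qed (use a in blast)
qed (auto simp: rational_subfield_def)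

lemma subfield_rational_subfield: "subfield_set (rational_subfield hom y)"
  unfolding subfield_set_def
proof (intro conjI ballI)
  show "1 \<in> rational_subfield hom y"
    unfolding rational_subfield_iff by (intro exI[of _ "[:1:]"]) simp
next
  fix a b assume "a \<in> rational_subfield hom y" "b \<in> rational_subfield hom y"
  then obtain p q p' q' where nz: "ev y q \<noteq> 0" "ev y q' \<noteq> 0"
    and ab: "a = ev y p / ev y q" "b = ev y p' / ev y q'"
    unfolding rational_subfield_iff by blast
  show "a + b \<in> rational_subfield hom y" unfolding rational_subfield_iff
    by (intro exI[of _ "p * q' + p' * q"] exI[of _ "q * q'"])
       (use nz in \<open>simp add: ab ev_add ev_mult field_simps\<close>)
  show "a - b \<in> rational_subfield hom y" unfolding rational_subfield_iff
    by (intro exI[of _ "p * q' - p' * q"] exI[of _ "q * q'"])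
       (use nz in \<open>simp add: ab ev_diff ev_mult field_simps\<close>)
  show "a * b \<in> rational_subfield hom y" unfolding rational_subfield_iff
    by (intro exI[of _ "p * p'"] exI[of _ "q * q'"])
       (use nz in \<open>simp add: ab ev_mult\<close>)
  show "a / b \<in> rational_subfield hom y" unfolding rational_subfield_def
    by (intro CollectI exI[of _ "p * q'"] exI[of _ "q * p'"])
       (simp add: ab ev_mult)
qed

lemma const_rational_subfield: "hom c \<in> rational_subfield hom y"
  unfolding rational_subfield_iff by (intro exI[of _ "[:c:]"] exI[of _ "[:1:]"]) simp

lemma gen_rational_subfield: "y \<in> rational_subfield hom y"
  unfolding rational_subfield_iff
  by (intro exI[of _ "[:0,1:]"] exI[of _ "[:1:]"]) (simp add: ev_pCons)

lemma rational_subfield_subset: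
  assumes S: "subfield_set S" and "range hom \<subseteq> S" "x \<in> S"
  shows "rational_subfield hom x \<subseteq> S"
proof -
  have "ev x p \<in> S" for p
  proof (induction p)
    case 0 then show ?case using subfield_set_zero[OF S] by simp
  next
    case (pCons c p)
    then show ?case using assms unfolding subfield_set_def ev_pCons by blast
  qed
  with S show ?thesis unfolding rational_subfield_def subfield_set_def by blast
qed

end

section \<open>The residue field as a finite extension of K\<close>

context closed_pt
begin

lemma ev_mem: "y \<in> P \<Longrightarrow> ev y p \<in> P"
  by (induction p) (auto simp: ev_pCons intro: add_mem mult_mem)

text \<open>Either x or 1/x lies in a valuation ring, and both generate the same subfield.\<close>

lemma ex_generator_in_point:
  assumes "function_field \<iota>"
  obtains y n and b :: "nat \<Rightarrow> 'f" where "y \<in> P"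
    "\<forall>h. \<exists>a. (\<forall>i<n. a i \<in> rational_subfield \<iota> y) \<and> h = (\<Sum>i<n. a i * b i)"
proof -
  from assms obtain x bs where span:
    "\<And>h. \<exists>a. (\<forall>i<length bs. a i \<in> rational_subfield \<iota> x) \<and> h = (\<Sum>i<length bs. a i * bs ! i)"
    unfolding function_field_def by blast
  show thesis
  proof (cases "x \<in> P")
    case True
    then show ?thesis using that[of x "length bs" "nth bs"] span by blast
  next
    case False
    then have x: "x \<noteq> 0" by auto
    with False have "inverse x \<in> P" by (simp add: mem_iff ord_inverse)
    have "inverse (inverse x) \<in> rational_subfield \<iota> (inverse x)"
      using subfield_rational_subfield[of "inverse x"] gen_rational_subfield[of "inverse x"]
      unfolding subfield_set_def inverse_eq_divide by blast
    then have "rational_subfield \<iota> x \<subseteq> rational_subfield \<iota> (inverse x)"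
      using rational_subfield_subset[OF subfield_rational_subfield, of "inverse x" x]
        const_rational_subfield by auto
    with span have "\<exists>a. (\<forall>i<length bs. a i \<in> rational_subfield \<iota> (inverse x)) \<and>
        h = (\<Sum>i<length bs. a i * bs ! i)" for h
      by blast
    with \<open>inverse x \<in> P\<close> that[of "inverse x" "length bs" "nth bs"] show ?thesis by blast
  qed
qed

text \<open>
  Otherwise \<open>K(y)\<close> lies in the valuation ring, and the powers of a pole, which have distinct
  orders, would be independent over it.
\<close>

lemma ex_residue_relation:
  fixes b :: "nat \<Rightarrow> 'f"
  assumes y: "y \<in> P"
    and span: "\<forall>h. \<exists>a. (\<forall>i<n. a i \<in> rational_subfield \<iota> y) \<and> h = (\<Sum>i<n. a i * b i)"
  shows "\<exists>q. q \<noteq> 0 \<and> ev y q \<in> max_ideal P"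
proof (rule ccontr)
  assume "\<not> ?thesis"
  then have unit: "ev y q \<in> local_units P" if "q \<noteq> 0" for q
    using that ev_mem[OF y] unit_iff_not_ideal by blast
  have units: "a \<in> local_units P" if "a \<in> rational_subfield \<iota> y" "a \<noteq> 0" for a
  proof -
    from that obtain p q where "ev y q \<noteq> 0" "a = ev y p / ev y q" "ev y p \<noteq> 0"
      unfolding rational_subfield_iff by auto
    moreover from this have "p \<noteq> 0" "q \<noteq> 0" by auto
    ultimately show ?thesis
      using unit_mult[OF unit unit_inverse[OF unit], of p q] by (simp add: divide_inverse)
  qed
  obtain t where t: "uniformizer P t" using ex_uniformizer by blast
  then have t0: "t \<noteq> 0" by (simp add: uniformizer_def)
  from span have "\<forall>j. \<exists>a. (\<forall>i<n. a i \<in> rational_subfield \<iota> y) \<and> t powi (- int j) = (\<Sum>i<n. a i * b i)"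
    by blast
  from choice[OF this] obtain A where A: "\<And>j i. i < n \<Longrightarrow> A j i \<in> rational_subfield \<iota> y"
    "\<And>j. t powi (- int j) = (\<Sum>i<n. A j i * b i)"
    by blast
  \<comment> \<open>The n + 1 powers t^0, ..., t^(-n) lie in a space spanned by n vectors over K(y),
    so they satisfy a nontrivial relation.\<close>
  from homogeneous_system[OF subfield_rational_subfield, of "{..<n}" "{..n}" A y] A(1)
  obtain c where c: "\<forall>j\<in>{..n}. c j \<in> rational_subfield \<iota> y" "\<exists>j\<in>{..n}. c j \<noteq> 0"
    "\<forall>i\<in>{..<n}. (\<Sum>j\<le>n. c j * A j i) = 0" by auto
  have rel: "(\<Sum>j\<le>n. c j * t powi (- int j)) = 0"
  proof -
    have "(\<Sum>j\<le>n. c j * t powi (- int j)) = (\<Sum>i<n. (\<Sum>j\<le>n. c j * A j i) * b i)"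
      unfolding A(2) sum_distrib_left sum_distrib_right by (subst sum.swap) (simp add: mult.assoc)
    then show ?thesis using c(3) by simp
  qed
  \<comment> \<open>The pole of highest order that occurs in the relation. After multiplication by
    t^m all other terms lie in the maximal ideal, hence so does \<open>c m\<close>, although it is a
    unit.\<close>
  define m where "m = Max {j. j \<le> n \<and> c j \<noteq> 0}"
  have fin: "finite {j. j \<le> n \<and> c j \<noteq> 0}" by simp
  have "{j. j \<le> n \<and> c j \<noteq> 0} \<noteq> {}" using c(2) by auto
  from Max_in[OF fin this] have m: "m \<le> n" "c m \<noteq> 0" by (simp_all add: m_def)
  have above: "c j = 0" if "j \<le> n" "m < j" for j
    using Max_ge[OF fin, of j] that unfolding m_def by fastforce
  have "0 = t powi int m * (\<Sum>j\<le>n. c j * t powi (- int j))" by (simp add: rel)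
  also have "\<dots> = (\<Sum>j\<le>n. c j * t powi (int m - int j))"
    unfolding sum_distrib_left using t0 
    by (intro sum.cong) (simp_all add: power_int_diff power_int_minus field_simps)
  also have "\<dots> = c m + (\<Sum>j\<in>{..n} - {m}. c j * t powi (int m - int j))"
    using m(1) by (subst sum.remove[of _ m]) auto
  finally have "c m = - (\<Sum>j\<in>{..n} - {m}. c j * t powi (int m - int j))"
    by (simp add: eq_neg_iff_add_eq_0)
  moreover have "(\<Sum>j\<in>{..n} - {m}. c j * t powi (int m - int j)) \<in> max_ideal P"
  proof (rule ideal_sum)
    fix j assume "j \<in> {..n} - {m}"
    then consider "c j = 0" | "j \<le> n" "j < m" "c j \<noteq> 0" using above[of j] by fastforce
    then show "c j * t powi (int m - int j) \<in> max_ideal P"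
    proof cases
      case 2
      then show ?thesis using powi_max_ideal_iff[OF t units, of "c j" "int m - int j"] c(1)
        by (simp add: mult.commute)
    qed simp
  qed
  ultimately have "c m \<in> max_ideal P" using ideal_uminus by metis
  then show False using units[of "c m"] c(1) m unit_iff_not_ideal by auto
qed

text \<open>Up to a scalar, the minimal polynomial over K of the residue class of
  \<open>y\<close>.\<close>

definition min_relation :: "'f \<Rightarrow> 'k poly \<Rightarrow> bool" where
  "min_relation y q \<longleftrightarrow> q \<noteq> 0 \<and> ev y q \<in> max_ideal P \<and>
     (\<forall>p. p \<noteq> 0 \<and> ev y p \<in> max_ideal P \<longrightarrow> degree q \<le> degree p)"

lemma ex_min_relation:
  assumes "q \<noteq> 0" "ev y q \<in> max_ideal P"
  shows "\<exists>q. min_relation y q"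
  using ex_has_least_nat[of "\<lambda>q. q \<noteq> 0 \<and> ev y q \<in> max_ideal P" q degree] assms
  unfolding min_relation_def by blast

lemma min_relation_mod:
  assumes y: "y \<in> P" and q: "min_relation y q"
  shows "ev y p - ev y (p mod q) \<in> max_ideal P"
    and "degree (p mod q) < degree q"
    and "ev y p \<in> max_ideal P \<longleftrightarrow> q dvd p"
proof -
  have "degree q \<noteq> 0"
  proof
    assume "degree q = 0"
    then obtain c where "q = [:c:]" by (meson degree_eq_zeroE)
    with q show False by (auto simp: min_relation_def max_ideal_iff)
  qed
  then show deg: "degree (p mod q) < degree q" for p
    using degree_mod_less'[of q p] q by (cases "p mod q = 0") (auto simp: min_relation_def)
  have "ev y p = ev y (p div q) * ev y q + ev y (p mod q)"
    by (simp flip: ev_add ev_mult)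
  then show 1: "ev y p - ev y (p mod q) \<in> max_ideal P"
    using q ev_mem[OF y] by (auto simp: min_relation_def intro: ideal_mult)
  show "ev y p \<in> max_ideal P \<longleftrightarrow> q dvd p"
  proof
    assume "ev y p \<in> max_ideal P"
    then have "ev y (p mod q) \<in> max_ideal P" using ideal_diff[OF _ 1] by fastforce
    then have "p mod q = 0" using q deg[of p] unfolding min_relation_def by fastforce
    then show "q dvd p" by auto
  next
    assume "q dvd p"
    then show "ev y p \<in> max_ideal P" using 1 by auto
  qed
qed

text \<open>Euclidean algorithm: if q = a r + r1, then - a r is congruent to r1 modulo the maximal
  ideal, and r1 has smaller degree, so it is inverted by induction. By minimality of q, a nonzero
  remainder has its value outside the ideal.\<close>

lemma min_relation_inverse:
  assumes y: "y \<in> P" and q: "min_relation y q" and r: "ev y r \<notin> max_ideal P"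
  shows "\<exists>r'. ev y r' * ev y r - 1 \<in> max_ideal P"
proof -
  have small: "\<exists>r'. ev y r' * ev y r - 1 \<in> max_ideal P"
    if "degree r < degree q" "ev y r \<notin> max_ideal P" for r
    using that
  proof (induction "degree r" arbitrary: r rule: less_induct)
    case less
    have r0: "r \<noteq> 0" using less.prems by auto
    show ?case
    proof (cases "degree r = 0")
      case True
      then obtain c where "r = [:c:]" by (meson degree_eq_zeroE)
      then show ?thesis using r0
        by (intro exI[of _ "[:inverse c:]"]) (simp flip: hom_mult)
    next
      case False
      define a r1 where "a = q div r" and "r1 = q mod r"
      have eq: "ev y q = ev y a * ev y r + ev y r1"
        by (simp add: a_def r1_def flip: ev_add ev_mult)
      have q0: "q \<noteq> 0" "ev y q \<in> max_ideal P" using q by (auto simp: min_relation_def)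
      show ?thesis
      proof (cases "r1 = 0")
        case True
        \<comment> \<open>An exact division is impossible: a has smaller degree than q, so its value
          lies outside the ideal, like that of r, while the product of the two values lies in
          it.\<close>
        then have "q = a * r" unfolding a_def r1_def by (simp add: mod_eq_0_iff_dvd)
        with q0 have a0: "a \<noteq> 0" and "degree q = degree a + degree r"
          using r0 by (auto simp: degree_mult_eq)
        with False q have "ev y a \<notin> max_ideal P"
          unfolding min_relation_def by fastforce
        then have False
          using ideal_prime[OF ev_mem[OF y, of a] ev_mem[OF y, of r]] q0 less.prems(2) eq True
          by simp
        then show ?thesis ..
      next
        case False
        have deg: "degree r1 < degree r"
          using degree_mod_less'[OF r0] False unfolding r1_def by blast
        then have "ev y r1 \<notin> max_ideal P"
          using q False less.prems(1) unfolding min_relation_def by fastforce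
        then obtain r' where r': "ev y r' * ev y r1 - 1 \<in> max_ideal P"
          using less.hyps[OF deg] deg less.prems(1) by auto
        have "ev y (- (r' * a)) * ev y r - 1 = (ev y r' * ev y r1 - 1) - ev y r' * ev y q"
          unfolding eq by (simp add: ev_uminus ev_mult algebra_simps)
        also have "\<dots> \<in> max_ideal P"
          using r' ideal_mult[OF ev_mem[OF y] q0(2)] by (rule ideal_diff)
        finally show ?thesis by blast
      qed
    qed
  qed
  have "ev y (r mod q) \<notin> max_ideal P"
    using r ideal_add[OF min_relation_mod(1)[OF y q, of r]] by force
  from small[OF min_relation_mod(2)[OF y q] this] obtain r' where
    r': "ev y r' * ev y (r mod q) - 1 \<in> max_ideal P" by blast
  have "ev y r' * ev y r - 1 =
      (ev y r' * ev y (r mod q) - 1) + ev y r' * (ev y r - ev y (r mod q))"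
    by (simp add: algebra_simps)
  also have "\<dots> \<in> max_ideal P"
    using r' ideal_mult[OF ev_mem[OF y] min_relation_mod(1)[OF y q]] by (rule ideal_add)
  finally show ?thesis by blast
qed

text \<open>If the denominator of a fraction in P has its value in the maximal ideal, so does the
  numerator. Then q divides both and cancels, which lowers the degree of the denominator. A
  denominator with value outside the ideal is inverted modulo it.\<close>

lemma rational_residue:
  assumes y: "y \<in> P" and q: "min_relation y q"
    and a: "a \<in> rational_subfield \<iota> y" "a \<in> P"
  shows "\<exists>p. degree p < degree q \<and> a - ev y p \<in> max_ideal P"
proof -
  have "\<exists>u v. a = ev y u / ev y v \<and> ev y v \<notin> max_ideal P"
    if "a = ev y u / ev y v" "ev y v \<noteq> 0" for u v
    using that
  proof (induction "degree v" arbitrary: u v rule: less_induct)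
    case less
    show ?case
    proof (cases "ev y v \<in> max_ideal P")
      case True
      then have "a * ev y v \<in> max_ideal P" using a(2) by (rule ideal_mult[rotated])
      then have "ev y u \<in> max_ideal P" using less.prems by simp
      with True obtain u' v' where uv: "u = q * u'" "v = q * v'"
        unfolding min_relation_mod(3)[OF y q] by (elim dvdE)
      have "v' \<noteq> 0" "q \<noteq> 0" using less.prems uv by auto
      then have "degree v' < degree v"
        using min_relation_mod(2)[OF y q, of 0] by (simp add: uv degree_mult_eq)
      moreover have "a = ev y u' / ev y v'" "ev y v' \<noteq> 0"
        using less.prems by (auto simp: uv ev_mult)
      ultimately show ?thesis using less.hyps by blast
    qed (use less.prems in blast)
  qed
  with a(1) obtain u v where uv: "a = ev y u / ev y v" "ev y v \<notin> max_ideal P"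
    unfolding rational_subfield_iff by blast
  then have nz: "ev y v \<noteq> 0" by auto
  obtain v' where v': "ev y v' * ev y v - 1 \<in> max_ideal P"
    using min_relation_inverse[OF y q uv(2)] by blast
  define p where "p = (u * v') mod q"
  have "a - ev y p = - a * (ev y v' * ev y v - 1) + (ev y (u * v') - ev y p)"
    using nz by (simp add: uv ev_mult algebra_simps)
  also have "\<dots> \<in> max_ideal P"
    unfolding p_def using ideal_mult[OF uminus_mem[OF a(2)] v'] min_relation_mod(1)[OF y q]
    by (rule ideal_add)
  finally show ?thesis using min_relation_mod(2)[OF y q, of "u * v'"] p_def by blast
qed

definition res_span :: "'f set \<Rightarrow> 'f set" where
  "res_span W = {h. \<exists>c. h - (\<Sum>w\<in>W. \<iota> (c w) * w) \<in> max_ideal P}"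

lemma res_span_ideal: "h \<in> max_ideal P \<Longrightarrow> h \<in> res_span W"
  unfolding res_span_def by (intro CollectI exI[of _ "\<lambda>_. 0"]) simp

lemma res_span_add:
  assumes "h \<in> res_span W" "h' \<in> res_span W"
  shows "h + h' \<in> res_span W"
proof -
  from assms obtain c c' where "h - (\<Sum>w\<in>W. \<iota> (c w) * w) \<in> max_ideal P"
    "h' - (\<Sum>w\<in>W. \<iota> (c' w) * w) \<in> max_ideal P" unfolding res_span_def by blast
  from ideal_add[OF this] show ?thesis
    unfolding res_span_def
    by (intro CollectI exI[of _ "\<lambda>w. c w + c' w"])
       (simp add: hom_add distrib_right sum.distrib algebra_simps)
qed

lemma res_span_scale:
  assumes "h \<in> res_span W"
  shows "\<iota> k * h \<in> res_span W"
proof -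
  from assms obtain c where "h - (\<Sum>w\<in>W. \<iota> (c w) * w) \<in> max_ideal P"
    unfolding res_span_def by blast
  from ideal_mult[OF const_mem this, of k] show ?thesis
    unfolding res_span_def
    by (intro CollectI exI[of _ "\<lambda>w. k * c w"])
       (simp add: hom_mult right_diff_distrib sum_distrib_left mult.assoc)
qed

lemma res_span_base:
  assumes "finite W" "w \<in> W"
  shows "w \<in> res_span W"
proof -
  have "(\<Sum>v\<in>W. \<iota> (if v = w then 1 else 0) * v) = (\<Sum>v\<in>W. if v = w then v else 0)"
    by (intro sum.cong) auto
  with assms show ?thesis
    unfolding res_span_def by (intro CollectI exI[of _ "\<lambda>v. if v = w then 1 else 0"]) simp
qed

lemma res_span_sum: "(\<And>i. i \<in> A \<Longrightarrow> f i \<in> res_span W) \<Longrightarrow> sum f A \<in> res_span W"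
  by (induction A rule: infinite_finite_induct) (auto intro: res_span_add res_span_ideal)

lemma res_span_cong:
  assumes "g \<in> res_span W" "h - g \<in> max_ideal P"
  shows "h \<in> res_span W"
  using res_span_add[OF assms(1) res_span_ideal[OF assms(2)]] by simp

lemma res_span_trans:
  assumes "V \<subseteq> res_span W"
  shows "res_span V \<subseteq> res_span W"
proof
  fix h assume "h \<in> res_span V"
  then obtain c where c: "h - (\<Sum>v\<in>V. \<iota> (c v) * v) \<in> max_ideal P" unfolding res_span_def by blast
  have "(\<Sum>v\<in>V. \<iota> (c v) * v) \<in> res_span W"
    using assms by (intro res_span_sum res_span_scale) auto
  then show "h \<in> res_span W" using c by (rule res_span_cong)
qed

text \<open>Modulo the maximal ideal, at most n elements of P are independent over the valuation
  ring of K(y), where n is the size of a spanning family of F over K(y). The residue field of K(y)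
  is spanned by the powers of y below the degree of q. The products of the two families
  span.\<close>

lemma finite_res_span:
  assumes "function_field \<iota>"
  obtains W where "finite W" "W \<subseteq> P" "P \<subseteq> res_span W"
proof -
  obtain y n and b :: "nat \<Rightarrow> 'f" where y: "y \<in> P" and
    span: "\<forall>h. \<exists>a. (\<forall>i<n. a i \<in> rational_subfield \<iota> y) \<and> h = (\<Sum>i<n. a i * b i)"
    by (rule ex_generator_in_point[OF assms])
  obtain q where q: "min_relation y q"
    using ex_residue_relation[OF y span] ex_min_relation by blast
  define S where "S = rational_subfield \<iota> y"
  have S: "subfield_set S" unfolding S_def by (rule subfield_rational_subfield)
  \<comment> \<open>Independence of the residue classes over the residue field of the valuation ring
    of K(y).\<close>
  define indep where "indep = (\<lambda>vs. set vs \<subseteq> P \<and> (\<forall>a. (\<forall>i<length vs. a i \<in> S \<inter> P) \<and>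
      (\<Sum>i<length vs. a i * vs ! i) \<in> max_ideal P \<longrightarrow> (\<forall>i<length vs. a i \<in> max_ideal P)))"
  have bound: "length vs \<le> n" if "indep vs" for vs
  proof (rule ccontr)
    assume len: "\<not> length vs \<le> n"
    from span have "\<forall>j. \<exists>a. (\<forall>i<n. a i \<in> S) \<and> vs ! j = (\<Sum>i<n. a i * b i)"
      unfolding S_def by blast
    from choice[OF this] obtain A where A: "\<And>j i. i < n \<Longrightarrow> A j i \<in> S"
      "\<And>j. vs ! j = (\<Sum>i<n. A j i * b i)" by blast
    have "\<exists>c. (\<forall>j\<in>{..<length vs}. c j \<in> S) \<and> (\<exists>j\<in>{..<length vs}. c j \<noteq> 0) \<and>
        (\<forall>i\<in>{..<n}. (\<Sum>j<length vs. c j * A j i) = 0)"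
      using homogeneous_system[OF S, of "{..<n}" "{..<length vs}" A] A(1) len by simp
    then obtain c where c: "\<And>j. j < length vs \<Longrightarrow> c j \<in> S" "\<exists>j<length vs. c j \<noteq> 0"
      "\<And>i. i < n \<Longrightarrow> (\<Sum>j<length vs. c j * A j i) = 0" by auto
    have rel: "(\<Sum>j<length vs. c j * vs ! j) = 0"
    proof -
      have "(\<Sum>j<length vs. c j * vs ! j) = (\<Sum>i<n. (\<Sum>j<length vs. c j * A j i) * b i)"
        unfolding A(2) sum_distrib_left sum_distrib_right
        by (subst sum.swap) (simp add: mult.assoc)
      then show ?thesis using c(3) by simp
    qed
    define J where "J = {j. j < length vs \<and> c j \<noteq> 0}"
    have "finite J" "J \<noteq> {}" using c(2) by (auto simp: J_def)
    \<comment> \<open>Division by a coefficient of least order makes all coefficients integral and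
      one of them equal to 1, so the relation stays nontrivial modulo the maximal ideal.\<close>
    then obtain k where k: "k \<in> J" "\<And>j. j \<in> J \<Longrightarrow> ord_at P (c k) \<le> ord_at P (c j)"
      using ex_min_if_finite[of "(\<lambda>j. ord_at P (c j)) ` J"] by (force simp: not_less)
    have k': "k < length vs" "c k \<noteq> 0" using k(1) by (auto simp: J_def)
    have "c j / c k \<in> S \<inter> P" if "j < length vs" for j
    proof (cases "c j = 0")
      case False
      then show ?thesis
        using c(1)[OF that] c(1)[OF k'(1)] k(2)[of j] S that k'
        by (auto simp: mem_iff ord_divide J_def subfield_set_def)
    qed (use subfield_set_zero[OF S] in simp)
    moreover have "(\<Sum>j<length vs. c j / c k * vs ! j) = 0"
      using rel by (simp flip: sum_divide_distrib)
    ultimately have "(\<forall>j<length vs. c j / c k \<in> S \<inter> P) \<and>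
        (\<Sum>j<length vs. c j / c k * vs ! j) \<in> max_ideal P" by (simp only:) simp
    then have "\<forall>j<length vs. c j / c k \<in> max_ideal P"
      using \<open>indep vs\<close>[unfolded indep_def, THEN conjunct2, THEN spec, of "\<lambda>j. c j / c k"]
      by (rule mp[rotated])
    with k' show False by fastforce
  qed
  have "indep []" by (simp add: indep_def)
  then obtain vs where vs: "indep vs" "\<And>ws. indep ws \<Longrightarrow> length ws \<le> length vs"
    using ex_has_greatest_nat[of indep "[]" length "Suc n"] bound by (auto simp: less_Suc_eq_le)
  define N where "N = length vs"
  define W where "W = (\<lambda>(i, j). y ^ j * vs ! i) ` ({..<N} \<times> {..<degree q})"
  have vsP: "vs ! i \<in> P" if "i < N" for i
    using vs(1) that nth_mem unfolding indep_def N_def by blast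
  have fin: "finite W" and WP: "W \<subseteq> P"
    unfolding W_def using y vsP by (auto intro!: mult_mem power_mem)
  have "P \<subseteq> res_span W"
  proof
    fix h assume h: "h \<in> P"
    \<comment> \<open>As \<open>vs\<close> is a longest independent list, adding h makes it
      dependent. The coefficient of h is then a unit, and dividing by it expresses h.\<close>
    have "\<not> indep (vs @ [h])" using vs(2)[of "vs @ [h]"] by auto
    moreover have "set (vs @ [h]) \<subseteq> P" using vs(1) h by (simp add: indep_def)
    ultimately obtain a where a: "\<And>i. i \<le> N \<Longrightarrow> a i \<in> S \<inter> P"
      "(\<Sum>i<Suc N. a i * (vs @ [h]) ! i) \<in> max_ideal P" "\<exists>i\<le>N. a i \<notin> max_ideal P"
      unfolding indep_def N_def by (auto simp: less_Suc_eq_le)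
    have "(\<Sum>i<N. a i * (vs @ [h]) ! i) = (\<Sum>i<N. a i * vs ! i)"
      by (intro sum.cong) (auto simp: nth_append N_def)
    then have a2: "(\<Sum>i<N. a i * vs ! i) + a N * h \<in> max_ideal P"
      using a(2) by (simp add: N_def nth_append)
    have aN: "a N \<notin> max_ideal P"
    proof
      assume *: "a N \<in> max_ideal P"
      then have "(\<Sum>i<N. a i * vs ! i) \<in> max_ideal P"
        using ideal_diff[OF a2 ideal_mult[OF h *]] by (simp add: mult.commute)
      then have "\<forall>i<N. a i \<in> max_ideal P"
        using vs(1) a(1) unfolding indep_def N_def by auto
      with * a(3) show False by (metis le_neq_implies_less)
    qed
    then have unit: "a N \<in> local_units P" using a(1)[of N] unit_iff_not_ideal by auto
    then have inv: "inverse (a N) \<in> P" "a N \<noteq> 0" by (auto simp: unit_iff)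
    have "\<exists>p. degree p < degree q \<and> - (a i / a N) - ev y p \<in> max_ideal P" if "i < N" for i
    proof (rule rational_residue[OF y q])
      show "- (a i / a N) \<in> P"
        using uminus_mem[OF mult_mem[OF _ inv(1)], of "a i"] a(1)[of i] that
        by (simp add: divide_inverse)
      have "0 - a i / a N \<in> S"
        using S subfield_set_zero[OF S] a(1)[of i] a(1)[of N] that
        unfolding subfield_set_def by (meson IntD1 less_imp_le order_refl)
      then show "- (a i / a N) \<in> rational_subfield \<iota> y" by (simp add: S_def)
    qed
    then have "\<forall>i. \<exists>p. i < N \<longrightarrow> degree p < degree q \<and> - (a i / a N) - ev y p \<in> max_ideal P"
      by blast
    from choice[OF this] obtain p where p: "\<And>i. i < N \<Longrightarrow> degree (p i) < degree q"
      "\<And>i. i < N \<Longrightarrow> - (a i / a N) - ev y (p i) \<in> max_ideal P" by blast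
    have "(\<Sum>i<N. ev y (p i) * vs ! i) \<in> res_span W"
    proof (rule res_span_sum)
      fix i assume i: "i \<in> {..<N}"
      have "ev y (p i) * vs ! i = (\<Sum>j\<le>degree (p i). \<iota> (poly.coeff (p i) j) * (y ^ j * vs ! i))"
        by (simp add: ev_altdef sum_distrib_right mult.assoc)
      also have "\<dots> \<in> res_span W"
      proof (intro res_span_sum res_span_scale res_span_base[OF fin])
        fix j assume "j \<in> {..degree (p i)}"
        with p(1)[of i] i show "y ^ j * vs ! i \<in> W" unfolding W_def by force
      qed
      finally show "ev y (p i) * vs ! i \<in> res_span W" .
    qed
    moreover have "h - (\<Sum>i<N. ev y (p i) * vs ! i) \<in> max_ideal P"
    proof -
      have "h - (\<Sum>i<N. ev y (p i) * vs ! i) =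
          inverse (a N) * ((\<Sum>i<N. a i * vs ! i) + a N * h)
          + (\<Sum>i<N. vs ! i * (- (a i / a N) - ev y (p i)))"
        using inv(2)
        by (simp add: distrib_left right_diff_distrib sum_distrib_left sum_subtractf sum_negf
            divide_inverse algebra_simps)
      also have "\<dots> \<in> max_ideal P"
        using vsP p(2) by (intro ideal_add ideal_mult[OF inv(1) a2] ideal_sum ideal_mult) auto
      finally show ?thesis .
    qed
    ultimately show "h \<in> res_span W" by (rule res_span_cong)
  qed
  with fin WP that show thesis by blast
qed

text \<open>A generating set of least size is independent: an element with nonzero coefficient in a
  relation lies in the span of the others and could be dropped.\<close>

lemma ex_residue_basis:
  assumes "function_field \<iota>"
  shows "\<exists>bs. residue_basis \<iota> P bs"
proof -
  define spans where "spans = (\<lambda>W. finite W \<and> W \<subseteq> P \<and> P \<subseteq> res_span W)"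
  obtain W0 where "spans W0" using finite_res_span[OF assms] unfolding spans_def by metis
  then obtain W where W: "spans W" "\<And>V. spans V \<Longrightarrow> card W \<le> card V"
    using ex_has_least_nat[of spans W0 card] by blast
  obtain bs where bs: "set bs = W" "distinct bs"
    using W(1) finite_distinct_list unfolding spans_def by blast
  have reindex: "(\<Sum>i<length bs. f (bs ! i)) = (\<Sum>w\<in>W. f w)" for f :: "'f \<Rightarrow> 'f"
    using sum.reindex_bij_betw[OF bij_betw_nth[OF bs(2) refl bs(1)[symmetric]], of f] by simp
  have indep: "d j = 0" if d: "(\<Sum>i<length bs. \<iota> (d i) * bs ! i) \<in> max_ideal P" "j < length bs"
    for d j
  proof (rule ccontr)
    assume dj: "d j \<noteq> 0"
    define V where "V = W - {bs ! j}"
    have bj: "bs ! j \<in> W" using d(2) bs(1) by auto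
    have fin: "finite V" using W(1) by (simp add: V_def spans_def)
    have "(\<Sum>i\<in>{..<length bs} - {j}. \<iota> (d i) * bs ! i) \<in> res_span V"
    proof (intro res_span_sum res_span_scale res_span_base[OF fin])
      fix i assume "i \<in> {..<length bs} - {j}"
      then show "bs ! i \<in> V" using bs d(2) by (auto simp: V_def nth_eq_iff_index_eq)
    qed
    moreover have "(\<Sum>i<length bs. \<iota> (d i) * bs ! i) =
        \<iota> (d j) * bs ! j + (\<Sum>i\<in>{..<length bs} - {j}. \<iota> (d i) * bs ! i)"
      by (rule sum.remove) (use d(2) in auto)
    then have "(- \<iota> (d j)) * bs ! j - (\<Sum>i\<in>{..<length bs} - {j}. \<iota> (d i) * bs ! i)
        \<in> max_ideal P"
      using ideal_uminus[OF d(1)] by (simp only: minus_add_distrib mult_minus_left diff_conv_add_uminus)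
    ultimately have "(- \<iota> (d j)) * bs ! j \<in> res_span V"
      by (rule res_span_cong)
    from res_span_scale[OF this, of "- inverse (d j)"] have "bs ! j \<in> res_span V"
      using dj by (simp add: hom_uminus hom_inverse flip: mult.assoc)
    then have "W \<subseteq> res_span V" using res_span_base[OF fin] by (auto simp: V_def)
    then have "spans V" using res_span_trans[of W V] W(1) by (auto simp: spans_def V_def)
    with W(2)[of V] bj W(1) show False
      using card_Diff1_less[of W "bs ! j"] by (auto simp: V_def spans_def)
  qed
  have "\<exists>!c. c \<in> carrier_vec (length bs) \<and>
        h - (\<Sum>i<length bs. \<iota> (c $ i) * bs ! i) \<in> max_ideal P" if "h \<in> P" for h
  proof (rule ex_ex1I)
    have "h \<in> res_span W" using that W(1) by (auto simp: spans_def)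
    then obtain c where "h - (\<Sum>w\<in>W. \<iota> (c w) * w) \<in> max_ideal P" unfolding res_span_def by blast
    then have "h - (\<Sum>i<length bs. \<iota> (vec (length bs) (\<lambda>i. c (bs ! i)) $ i) * bs ! i) \<in> max_ideal P"
      using reindex[of "\<lambda>w. \<iota> (c w) * w"] by simp
    then show "\<exists>c. c \<in> carrier_vec (length bs) \<and>
        h - (\<Sum>i<length bs. \<iota> (c $ i) * bs ! i) \<in> max_ideal P"
      using vec_carrier by blast
  next
    fix c c' assume c: "c \<in> carrier_vec (length bs) \<and>
        h - (\<Sum>i<length bs. \<iota> (c $ i) * bs ! i) \<in> max_ideal P"
      and c': "c' \<in> carrier_vec (length bs) \<and>
        h - (\<Sum>i<length bs. \<iota> (c' $ i) * bs ! i) \<in> max_ideal P"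
    have "(\<Sum>i<length bs. \<iota> (c $ i - c' $ i) * bs ! i) \<in> max_ideal P"
      using ideal_diff[of "h - (\<Sum>i<length bs. \<iota> (c' $ i) * bs ! i)"
          "h - (\<Sum>i<length bs. \<iota> (c $ i) * bs ! i)"] c c'
      by (simp add: hom_minus left_diff_distrib sum_subtractf)
    from indep[OF this] c c' show "c = c'" by (intro eq_vecI) auto
  qed
  then have "residue_basis \<iota> P bs"
    using W(1) bs(1) unfolding residue_basis_def spans_def by blast
  then show ?thesis ..
qed

end

section \<open>Norms of residue classes\<close>

locale ff_point = closed_pt \<iota> P for \<iota> :: "'k::field \<Rightarrow> 'f::field" and P +
  assumes ff: "function_field \<iota>"
begin

abbreviation "bs \<equiv> some_residue_basis \<iota> P"
abbreviation "pdeg \<equiv> point_degree \<iota> P"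
abbreviation "crd \<equiv> residue_coords \<iota> P"
abbreviation lin :: "'k vec \<Rightarrow> 'f" where "lin c \<equiv> (\<Sum>i<pdeg. \<iota> (c $ i) * bs ! i)"

lemma residue_basis: "residue_basis \<iota> P bs"
  unfolding some_residue_basis_def by (rule someI_ex) (rule ex_residue_basis[OF ff])

lemma basis_mem: "i < pdeg \<Longrightarrow> bs ! i \<in> P"
  using residue_basis unfolding residue_basis_def point_degree_def by auto

lemma coords_ex1: "h \<in> P \<Longrightarrow> \<exists>!c. c \<in> carrier_vec pdeg \<and> h - lin c \<in> max_ideal P"
  using residue_basis unfolding residue_basis_def point_degree_def by blast

lemma coords_carrier: "h \<in> P \<Longrightarrow> crd h \<in> carrier_vec pdeg"
  and coords_lin: "h \<in> P \<Longrightarrow> h - lin (crd h) \<in> max_ideal P"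
  using theI'[OF coords_ex1] unfolding residue_coords_def by blast+

lemma coords_unique:
  assumes "h \<in> P" "c \<in> carrier_vec pdeg" "h - lin c \<in> max_ideal P"
  shows "crd h = c"
  using coords_ex1[OF assms(1)] coords_carrier[OF assms(1)] coords_lin[OF assms(1)] assms(2,3)
  by blast

definition mult_mat :: "'f \<Rightarrow> 'k mat" where
  "mult_mat h = mat_of_cols pdeg (map (\<lambda>b. crd (h * b)) bs)"

lemma residue_norm_eq: "residue_norm \<iota> P h = det (mult_mat h)"
  unfolding residue_norm_def mult_mat_def ..

lemma mult_mat_carrier [simp]: "mult_mat h \<in> carrier_mat pdeg pdeg"
  unfolding mult_mat_def by (metis length_map mat_of_cols_carrier(1) point_degree_def)

lemma mult_mat_dim [simp]: "dim_row (mult_mat h) = pdeg" "dim_col (mult_mat h) = pdeg"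
  using mult_mat_carrier[of h] by blast+

lemma mult_mat_index:
  assumes "i < pdeg" "j < pdeg"
  shows "mult_mat h $$ (i, j) = crd (h * bs ! j) $ i"
  unfolding mult_mat_def using assms by (subst mat_of_cols_index) (auto simp: point_degree_def)

text \<open>Expanding first h b_j and then each g b_k in the basis leaves errors in the maximal
  ideal only; uniqueness of coordinates turns this congruence into an equality of columns.\<close>

lemma mult_mat_mult:
  assumes g: "g \<in> P" and h: "h \<in> P"
  shows "mult_mat (g * h) = mult_mat g * mult_mat h"
proof (rule eq_matI)
  show "dim_row (mult_mat (g * h)) = dim_row (mult_mat g * mult_mat h)"
    "dim_col (mult_mat (g * h)) = dim_col (mult_mat g * mult_mat h)"
    by simp_all
next
  fix i j assume "i < dim_row (mult_mat g * mult_mat h)" "j < dim_col (mult_mat g * mult_mat h)"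
  then have ij: "i < pdeg" "j < pdeg"
    by auto
  define G where "G = (\<lambda>k. crd (g * bs ! k))"
  define H where "H = crd (h * bs ! j)"
  define c where "c = vec pdeg (\<lambda>i. \<Sum>k<pdeg. G k $ i * H $ k)"
  have gb: "g * bs ! k \<in> P" "h * bs ! k \<in> P" if "k < pdeg" for k
    using that g h basis_mem by (auto intro: mult_mem)
  have lin_c: "lin c = (\<Sum>k<pdeg. \<iota> (H $ k) * lin (G k))"
  proof -
    have "lin c = (\<Sum>i<pdeg. \<Sum>k<pdeg. \<iota> (G k $ i) * \<iota> (H $ k) * bs ! i)"
      unfolding c_def by (intro sum.cong) (auto simp: hom_sum hom_mult sum_distrib_right)
    also have "\<dots> = (\<Sum>k<pdeg. \<Sum>i<pdeg. \<iota> (G k $ i) * \<iota> (H $ k) * bs ! i)"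
      by (rule sum.swap)
    also have "\<dots> = (\<Sum>k<pdeg. \<iota> (H $ k) * lin (G k))"
      by (simp add: sum_distrib_left mult_ac)
    finally show ?thesis .
  qed
  have "g * h * bs ! j - lin c =
      g * (h * bs ! j - lin H) + (\<Sum>k<pdeg. \<iota> (H $ k) * (g * bs ! k - lin (G k)))"
    unfolding lin_c by (simp add: right_diff_distrib sum_subtractf sum_distrib_left mult_ac)
  also have "\<dots> \<in> max_ideal P"
    unfolding G_def H_def using gb ij g coords_lin
    by (intro ideal_add ideal_sum ideal_mult const_mem) auto
  finally have "crd (g * h * bs ! j) = c"
    by (intro coords_unique mult_mem g h basis_mem ij) (simp_all add: c_def)
  then have "mult_mat (g * h) $$ (i, j) = (\<Sum>k<pdeg. G k $ i * H $ k)"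
    using ij by (simp add: mult_mat_index c_def)
  also have "\<dots> = (\<Sum>k<pdeg. mult_mat g $$ (i, k) * mult_mat h $$ (k, j))"
    using ij by (intro sum.cong) (auto simp: mult_mat_index G_def H_def)
  also have "\<dots> = (mult_mat g * mult_mat h) $$ (i, j)"
    using ij by (simp add: scalar_prod_def atLeast0LessThan)
  finally show "mult_mat (g * h) $$ (i, j) = (mult_mat g * mult_mat h) $$ (i, j)" .
qed

lemma residue_norm_mult:
  "g \<in> P \<Longrightarrow> h \<in> P \<Longrightarrow> residue_norm \<iota> P (g * h) = residue_norm \<iota> P g * residue_norm \<iota> P h"
  unfolding residue_norm_eq by (simp add: mult_mat_mult det_mult[OF mult_mat_carrier mult_mat_carrier])

lemma residue_norm_const: "residue_norm \<iota> P (\<iota> c) = c ^ pdeg"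
proof -
  have "mult_mat (\<iota> c) = c \<cdot>\<^sub>m 1\<^sub>m pdeg"
  proof (rule eq_matI)
    show "dim_row (mult_mat (\<iota> c)) = dim_row (c \<cdot>\<^sub>m 1\<^sub>m pdeg)"
      "dim_col (mult_mat (\<iota> c)) = dim_col (c \<cdot>\<^sub>m 1\<^sub>m pdeg)"
      by simp_all
  next
    fix i j assume "i < dim_row (c \<cdot>\<^sub>m 1\<^sub>m pdeg)" "j < dim_col (c \<cdot>\<^sub>m 1\<^sub>m pdeg)"
    then have ij: "i < pdeg" "j < pdeg" by auto
    have "lin (vec pdeg (\<lambda>i. if i = j then c else 0)) = (\<Sum>i<pdeg. if i = j then \<iota> c * bs ! i else 0)"
      by (intro sum.cong) auto
    also have "\<dots> = \<iota> c * bs ! j" using ij by simp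
    finally have "crd (\<iota> c * bs ! j) = vec pdeg (\<lambda>i. if i = j then c else 0)"
      using ij basis_mem[of j] by (intro coords_unique mult_mem) auto
    then show "mult_mat (\<iota> c) $$ (i, j) = (c \<cdot>\<^sub>m 1\<^sub>m pdeg) $$ (i, j)"
      using ij by (simp add: mult_mat_index)
  qed
  then show ?thesis unfolding residue_norm_eq by (simp add: det_smult)
qed

lemma residue_norm_one [simp]: "residue_norm \<iota> P 1 = 1"
  using residue_norm_const[of 1] by simp

lemma residue_norm_nonzero:
  assumes "u \<in> local_units P"
  shows "residue_norm \<iota> P u \<noteq> 0"
proof
  assume "residue_norm \<iota> P u = 0"
  then have "residue_norm \<iota> P (u * inverse u) = 0"
    using assms by (simp add: residue_norm_mult unit_iff del: right_inverse)
  then show False using assms by (simp add: unit_iff)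
qed

text \<open>With an empty basis 1 would lie in the maximal ideal.\<close>

lemma point_degree_pos: "pdeg > 0"
proof (rule ccontr)
  assume "\<not> pdeg > 0"
  then show False using coords_lin[OF one_mem] by simp
qed

end

section \<open>Weak approximation\<close>

context closed_pt
begin

lemma ord_sum_ge:
  assumes "finite A" "\<And>i. i \<in> A \<Longrightarrow> f i = 0 \<or> ord_at P (f i) \<ge> k"
  shows "sum f A = 0 \<or> ord_at P (sum f A) \<ge> k"
  using assms
proof (induction A rule: finite_induct)
  case (insert a A)
  then have "f a = 0 \<or> ord_at P (f a) \<ge> k" "sum f A = 0 \<or> ord_at P (sum f A) \<ge> k" by auto
  then show ?case
    using insert.hyps ord_add_ge[of "f a" "sum f A" k]
    by (cases "f a = 0"; cases "sum f A = 0"; cases "f a + sum f A = 0") auto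
qed simp

lemma ord_add_min:
  assumes "f \<noteq> 0" "g \<noteq> 0" "ord_at P f \<noteq> ord_at P g"
  shows "f + g \<noteq> 0 \<and> ord_at P (f + g) = min (ord_at P f) (ord_at P g)"
proof (cases "ord_at P f < ord_at P g")
  case True
  then show ?thesis using ord_add_eq[of f g] assms by auto
next
  case False
  then have "ord_at P g < ord_at P f" using assms(3) by simp
  then show ?thesis using ord_add_eq[of g f] assms by (auto simp: add.commute)
qed

lemma uniformizer_nonzero: "uniformizer P t \<Longrightarrow> t \<noteq> 0"
  by (simp add: uniformizer_def)

text \<open>If q in Q has a pole at P, then every f divided by a high power of q lies in P, hence in
  Q, and so f lies in Q. Then Q would be the whole field, which has no uniformizer.\<close>

lemma point_maximal:
  assumes Q: "closed_point \<iota> Q" and sub: "P \<subseteq> Q"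
  shows "P = Q"
proof (rule ccontr)
  assume "P \<noteq> Q"
  interpret Q: closed_pt \<iota> Q using Q by unfold_locales
  obtain q where q: "q \<in> Q" "q \<notin> P" using sub \<open>P \<noteq> Q\<close> by blast
  have q0: "q \<noteq> 0" using q(2) by auto
  then have ordq: "ord_at P q < 0" using q(2) mem_iff[OF q0] by simp
  have all: "f \<in> Q" if f0: "f \<noteq> 0" for f
  proof -
    define N where "N = nat \<bar>ord_at P f\<bar>"
    have "ord_at P (f / q ^ N) = ord_at P f - int N * ord_at P q"
      using f0 q0 by (simp add: ord_divide ord_power)
    also have "\<dots> \<ge> ord_at P f + int N"
      using ordq mult_left_mono[of "ord_at P q" "- 1" "int N"] by simp
    finally have "ord_at P (f / q ^ N) \<ge> 0" unfolding N_def by linarith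
    then have "f / q ^ N \<in> Q" using sub mem_iff[of "f / q ^ N"] f0 q0 by auto
    then have "f / q ^ N * q ^ N \<in> Q" using q(1) by (intro Q.mult_mem Q.power_mem)
    then show ?thesis using q0 by simp
  qed
  obtain t where t: "uniformizer Q t" using Q.ex_uniformizer by blast
  then have "t \<noteq> 0" by (rule Q.uniformizer_nonzero)
  then show False
    using all[of "inverse t"] Q.mem_iff[of "inverse t"] by (simp add: Q.ord_inverse Q.ord_uniformizer[OF t])
qed

lemma separate_two:
  assumes Q: "closed_point \<iota> Q" and ne: "P \<noteq> Q"
  shows "\<exists>f. f \<noteq> 0 \<and> ord_at P f > 0 \<and> ord_at Q f < 0"
proof -
  interpret Q: closed_pt \<iota> Q using Q by unfold_locales
  obtain a where a: "a \<in> P" "a \<notin> Q" using point_maximal[OF Q] ne by blast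
  obtain b where b: "b \<in> Q" "b \<notin> P" using Q.point_maximal[OF closed] ne by blast
  have nz: "a \<noteq> 0" "b \<noteq> 0" using a b by auto
  then have "ord_at P (a / b) > 0" "ord_at Q (a / b) < 0"
    using a b mem_iff[of a] mem_iff[of b] Q.mem_iff[of a] Q.mem_iff[of b]
    by (auto simp: ord_divide Q.ord_divide)
  then show ?thesis using nz by (intro exI[of _ "a / b"]) auto
qed

text \<open>Induction on S with f + g^r, where g has a zero at P and a pole at the new point Q. At
  each point of \<open>insert Q S\<close> one of f, g has a pole. If f and g^r have different orders
  there, the smaller one is negative and is the order of the sum.\<close>

lemma separate:
  assumes "finite S" "\<And>Q. Q \<in> S \<Longrightarrow> closed_point \<iota> Q" "P \<notin> S"
  shows "\<exists>f. f \<noteq> 0 \<and> ord_at P f > 0 \<and> (\<forall>Q\<in>S. ord_at Q f < 0)"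
  using assms
proof (induction S rule: finite_induct)
  case empty
  obtain t where "uniformizer P t" using ex_uniformizer by blast
  then show ?case using ord_uniformizer[of t] uniformizer_nonzero by (intro exI[of _ t]) auto
next
  case (insert Q S)
  then obtain f where f: "f \<noteq> 0" "ord_at P f > 0" "\<And>Q. Q \<in> S \<Longrightarrow> ord_at Q f < 0" by auto
  obtain g where g: "g \<noteq> 0" "ord_at P g > 0" "ord_at Q g < 0"
    using separate_two[of Q] insert.prems by auto
  \<comment> \<open>As r exceeds |ord f| at all these points, equality of ord f and r ord g would
    force both ord g and ord f to vanish, contrary to the pole.\<close>
  define r where "r = 1 + (\<Sum>R\<in>insert Q S. nat \<bar>ord_at R f\<bar>)"
  have r: "nat \<bar>ord_at R f\<bar> < r" if "R \<in> insert Q S" for R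
    using member_le_sum[of R "insert Q S" "\<lambda>R. nat \<bar>ord_at R f\<bar>"] that insert.hyps
    unfolding r_def by auto
  have neg: "f + g ^ r \<noteq> 0 \<and> ord_at R (f + g ^ r) < 0" if R: "R \<in> insert Q S" for R
  proof -
    interpret R: closed_pt \<iota> R using insert.prems(1)[OF R] by unfold_locales
    have cases: "ord_at R f < 0 \<or> ord_at R g < 0" using R f(3) g(3) by auto
    have "ord_at R f \<noteq> int r * ord_at R g"
    proof
      assume eq: "ord_at R f = int r * ord_at R g"
      then have "ord_at R g \<noteq> 0" using cases by auto
      then have "\<bar>ord_at R f\<bar> \<ge> int r" using mult_left_mono[of 1 "\<bar>ord_at R g\<bar>" "int r"] by (simp add: eq abs_mult)
      with r[OF R] show False by linarith
    qed
    then have "f + g ^ r \<noteq> 0 \<and> ord_at R (f + g ^ r) = min (ord_at R f) (int r * ord_at R g)"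
      using R.ord_add_min[of f "g ^ r"] f(1) g(1) by (simp add: R.ord_power)
    moreover have "min (ord_at R f) (int r * ord_at R g) < 0"
      using cases mult_pos_neg[of "int r" "ord_at R g"] r[OF R] by (auto simp: min_less_iff_disj)
    ultimately show ?thesis by simp
  qed
  then have nz: "f + g ^ r \<noteq> 0" by blast
  have "int r * ord_at P g \<ge> 1"
    using mult_mono[of 1 "int r" 1 "ord_at P g"] g(2) by (simp add: r_def)
  then have "ord_at P (f + g ^ r) \<ge> 1"
    using f(1,2) g(1,2) nz by (intro ord_add_ge) (auto simp: ord_power)
  with neg nz show ?case by (intro exI[of _ "f + g ^ r"]) auto
qed

end

text \<open>\<open>e P\<close> has order 0 at P and order at least m at the other points of S,
  because \<open>f P\<close> has a zero at P and poles elsewhere in S. So at each Q in S the term of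
  Q dominates the sum.\<close>

lemma (in field_hom) weak_approximation:
  assumes "finite S" and closed: "\<And>P. P \<in> S \<Longrightarrow> closed_point hom P"
  shows "\<exists>f. f \<noteq> 0 \<and> (\<forall>P\<in>S. ord_at P f = a P)"
proof (cases "S = {}")
  case False
  have pt: "closed_pt hom P" if "P \<in> S" for P
    using closed[OF that] by unfold_locales
  have "\<forall>P. \<exists>t. P \<in> S \<longrightarrow> uniformizer P t"
    using closed_pt.ex_uniformizer[OF pt] by blast
  from choice[OF this] obtain t where t: "\<And>P. P \<in> S \<Longrightarrow> uniformizer P (t P)" by blast
  have t0: "t P \<noteq> 0" if "P \<in> S" for P
    by (rule closed_pt.uniformizer_nonzero[OF pt[OF that] t[OF that]])
  have "\<forall>P. \<exists>f. P \<in> S \<longrightarrow> f \<noteq> 0 \<and> ord_at P f > 0 \<and> (\<forall>Q\<in>S - {P}. ord_at Q f < 0)"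
  proof (intro allI)
    fix P
    show "\<exists>f. P \<in> S \<longrightarrow> f \<noteq> 0 \<and> ord_at P f > 0 \<and> (\<forall>Q\<in>S - {P}. ord_at Q f < 0)"
      using closed_pt.separate[OF pt, of P "S - {P}"] assms by (cases "P \<in> S") auto
  qed
  from choice[OF this] obtain f where f: "\<And>P. P \<in> S \<Longrightarrow> f P \<noteq> 0"
    "\<And>P. P \<in> S \<Longrightarrow> ord_at P (f P) > 0"
    "\<And>P Q. P \<in> S \<Longrightarrow> Q \<in> S \<Longrightarrow> Q \<noteq> P \<Longrightarrow> ord_at Q (f P) < 0" by blast
  \<comment> \<open>\<open>b P Q\<close> bounds how far \<open>t P powi a P\<close> can fall short
    of the order prescribed at Q; m exceeds all these bounds, so \<open>e P\<close> makes up for it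
    strictly.\<close>
  define b where "b = (\<lambda>P Q. nat \<bar>a Q - a P * ord_at Q (t P)\<bar>)"
  define m where "m = 1 + (\<Sum>P\<in>S. \<Sum>Q\<in>S. b P Q)"
  have m: "b P Q < m" if "P \<in> S" "Q \<in> S" for P Q
    using member_le_sum[of P S "\<lambda>P. \<Sum>Q\<in>S. b P Q"] member_le_sum[of Q S "b P"] that assms(1)
    unfolding m_def by fastforce
  have m1: "m \<ge> 1" by (simp add: m_def)
  define e where "e = (\<lambda>P. inverse (1 + f P ^ m))"
  have eP: "e P \<noteq> 0 \<and> ord_at P (e P) = 0" if "P \<in> S" for P
  proof -
    interpret closed_pt hom P by (rule pt[OF that])
    have "ord_at P (f P ^ m) > 0" using f(1,2)[OF that] m1 by (simp add: ord_power)
    then have "1 + f P ^ m \<noteq> 0 \<and> ord_at P (1 + f P ^ m) = 0"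
      using ord_add_eq[of 1 "f P ^ m"] by simp
    then show ?thesis by (simp add: e_def ord_inverse)
  qed
  have eQ: "ord_at Q (e P) \<ge> int m" if "P \<in> S" "Q \<in> S" "Q \<noteq> P" for P Q
  proof -
    interpret closed_pt hom Q by (rule pt[OF that(2)])
    have "int m * ord_at Q (f P) \<le> - int m"
      using f(3)[OF that] mult_left_mono[of "ord_at Q (f P)" "- 1" "int m"] by simp
    then have "1 + f P ^ m \<noteq> 0 \<and> ord_at Q (1 + f P ^ m) \<le> - int m"
      using ord_add_eq[of "f P ^ m" 1] f(1)[OF that(1)] m1 by (simp add: ord_power add.commute)
    then show ?thesis by (simp add: e_def ord_inverse)
  qed
  define h where "h = (\<Sum>P\<in>S. e P * t P powi a P)"
  have h: "h \<noteq> 0 \<and> ord_at Q h = a Q" if Q: "Q \<in> S" for Q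
  proof -
    interpret closed_pt hom Q by (rule pt[OF Q])
    have split: "h = e Q * t Q powi a Q + (\<Sum>P\<in>S - {Q}. e P * t P powi a P)"
      unfolding h_def by (rule sum.remove[OF assms(1) Q])
    have main: "e Q * t Q powi a Q \<noteq> 0" "ord_at Q (e Q * t Q powi a Q) = a Q"
      using eP[OF Q] t0[OF Q] by (auto simp: ord_mult ord_powi ord_uniformizer[OF t[OF Q]])
    have "ord_at Q (e P * t P powi a P) \<ge> a Q + 1" if "P \<in> S - {Q}" for P
    proof -
      have "ord_at Q (e P * t P powi a P) = ord_at Q (e P) + a P * ord_at Q (t P)"
        using that eP[of P] t0[of P] by (simp add: ord_mult ord_powi)
      moreover have "ord_at Q (e P) \<ge> int m" using eQ[of P Q] that Q by auto
      moreover have "b P Q < m" using m[of P Q] that Q by auto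
      ultimately show ?thesis unfolding b_def by linarith
    qed
    then have "(\<Sum>P\<in>S - {Q}. e P * t P powi a P) = 0 \<or>
        ord_at Q (\<Sum>P\<in>S - {Q}. e P * t P powi a P) \<ge> a Q + 1"
      using assms(1) by (intro ord_sum_ge) auto
    then have "(\<Sum>P\<in>S - {Q}. e P * t P powi a P) = 0 \<or>
        ord_at Q (e Q * t Q powi a Q) < ord_at Q (\<Sum>P\<in>S - {Q}. e P * t P powi a P)"
      using main(2) by linarith
    from ord_add_eq[OF main(1) this] show ?thesis unfolding split main(2) by blast
  qed
  with False show ?thesis by blast
qed (auto intro: exI[of _ 1])

section \<open>Divisors and the pairing with functions\<close>

lemma Supp_add: "Supp (A + B) \<subseteq> Supp A \<union> Supp B"
  and Supp_uminus: "Supp (- A) = Supp A"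
  and Supp_zero: "Supp 0 = {}"
  by (auto simp: Supp_def)

lemma Supp_diff: "Supp (A - B) \<subseteq> Supp A \<union> Supp B"
  by (auto simp: Supp_def)

lemma disjoint_div_iff: "disjoint_div A B \<longleftrightarrow> (\<forall>P\<in>Supp B. A P = 0)"
  by (auto simp: disjoint_div_def disjnt_def Supp_def)

lemma disjoint_div_sym: "disjoint_div A B \<longleftrightarrow> disjoint_div B A"
  by (auto simp: disjoint_div_def disjnt_def)

lemma Div_zero: "0 \<in> Div \<iota>"
  and Div_add: "A \<in> Div \<iota> \<Longrightarrow> B \<in> Div \<iota> \<Longrightarrow> A + B \<in> Div \<iota>"
  and Div_uminus: "A \<in> Div \<iota> \<Longrightarrow> - A \<in> Div \<iota>"
  and Div_diff: "A \<in> Div \<iota> \<Longrightarrow> B \<in> Div \<iota> \<Longrightarrow> A - B \<in> Div \<iota>"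
  using finite_subset[OF Supp_add, of A B] Supp_add[of A B]
    finite_subset[OF Supp_diff, of A B] Supp_diff[of A B]
  by (auto simp: Div_def Supp_uminus Supp_zero)

lemma finite_Supp: "A \<in> Div \<iota> \<Longrightarrow> finite (Supp A)"
  by (simp add: Div_def)

lemma degree_div_superset:
  assumes "finite S" "Supp A \<subseteq> S"
  shows "degree_div \<iota> A = (\<Sum>P\<in>S. A P * int (point_degree \<iota> P))"
  unfolding degree_div_def by (rule sum.mono_neutral_left) (use assms in \<open>auto simp: Supp_def\<close>)

lemma degree_div_add:
  assumes "A \<in> Div \<iota>" "B \<in> Div \<iota>"
  shows "degree_div \<iota> (A + B) = degree_div \<iota> A + degree_div \<iota> B"
proof -
  have "finite (Supp A \<union> Supp B)" using assms by (simp add: finite_Supp)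
  note sup = degree_div_superset[OF this]
  show ?thesis
    using sup[OF Supp_add, of \<iota>] sup[of A \<iota>] sup[of B \<iota>]
    by (simp add: distrib_right sum.distrib)
qed

lemma degree_div_uminus: "degree_div \<iota> (- A) = - degree_div \<iota> A"
  by (simp add: degree_div_def Supp_uminus sum_negf)

lemma degree_div_diff:
  assumes "A \<in> Div \<iota>" "B \<in> Div \<iota>"
  shows "degree_div \<iota> (A - B) = degree_div \<iota> A - degree_div \<iota> B"
  using degree_div_add[OF assms(1) Div_uminus[OF assms(2)]] by (simp add: degree_div_uminus)

lemma degree_div_zero: "degree_div \<iota> 0 = 0"
  by (simp add: degree_div_def Supp_zero)

lemma Div0_Div: "A \<in> Div0 \<iota> \<Longrightarrow> A \<in> Div \<iota>"
  by (simp add: Div0_def)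

lemma Div0_zero: "0 \<in> Div0 \<iota>"
  and Div0_add: "A \<in> Div0 \<iota> \<Longrightarrow> B \<in> Div0 \<iota> \<Longrightarrow> A + B \<in> Div0 \<iota>"
  and Div0_uminus: "A \<in> Div0 \<iota> \<Longrightarrow> - A \<in> Div0 \<iota>"
  by (auto simp: Div0_def Div_zero Div_add Div_uminus degree_div_zero degree_div_add
      degree_div_uminus)

lemma prod_powi_sum:
  fixes c :: "'a::field"
  assumes "c \<noteq> 0"
  shows "(\<Prod>i\<in>A. c powi e i) = c powi (\<Sum>i\<in>A. e i)"
  by (induction A rule: infinite_finite_induct) (simp_all add: power_int_add assms)

text \<open>
  In the theorem the second assumption is inherited from the line bundle, all of whose nonzero
  sections have the same positive degree.
\<close>

locale degree_zero_curve = field_hom \<iota> for \<iota> :: "'k::field \<Rightarrow> 'f::field" +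
  assumes ff: "function_field \<iota>"
    and principal_Div0: "f \<noteq> 0 \<Longrightarrow> principal \<iota> f \<in> Div0 \<iota>"
    and rational_point: "has_rational_point \<iota>"
begin

abbreviation pr :: "'f \<Rightarrow> 'f divisor" where
  "pr \<equiv> principal \<iota>"

lemma point: "closed_point \<iota> P \<Longrightarrow> ff_point \<iota> P"
  using ff by unfold_locales

lemma point_val: "closed_point \<iota> P \<Longrightarrow> closed_pt \<iota> P"
  by unfold_locales

lemma principal_Div: "f \<noteq> 0 \<Longrightarrow> pr f \<in> Div \<iota>"
  by (rule Div0_Div[OF principal_Div0])

lemma Supp_closed: "A \<in> Div \<iota> \<Longrightarrow> P \<in> Supp A \<Longrightarrow> closed_point \<iota> P"
  by (simp add: Div_def)

lemma principal_mult: "f \<noteq> 0 \<Longrightarrow> g \<noteq> 0 \<Longrightarrow> pr (f * g) = pr f + pr g"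
  by (auto simp: principal_def closed_pt.ord_mult[OF point_val])

lemma principal_one: "pr 1 = 0"
  by (auto simp: principal_def closed_pt.ord_one[OF point_val])

lemma principal_inverse: "f \<noteq> 0 \<Longrightarrow> pr (inverse f) = - pr f"
  by (auto simp: principal_def closed_pt.ord_inverse[OF point_val])

lemma principal_const: "c \<noteq> 0 \<Longrightarrow> pr (\<iota> c) = 0"
  by (auto simp: principal_def closed_pt.ord_const[OF point_val])

text \<open>Subtracting from f its value at the rational point gives a function without poles that
  vanishes there. If it were nonzero, its divisor would have positive degree.\<close>

lemma principal_zero_const:
  assumes "f \<noteq> 0" "pr f = 0"
  obtains c where "c \<noteq> 0" "f = \<iota> c"
proof -
  obtain P0 where P0: "closed_point \<iota> P0" "\<And>h. h \<in> P0 \<Longrightarrow> \<exists>c. h - \<iota> c \<in> max_ideal P0"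
    using rational_point unfolding has_rational_point_def by blast
  have mem: "f \<in> P" if "closed_point \<iota> P" for P
  proof -
    have "pr f P = 0" by (simp add: assms(2))
    with that assms(1) show ?thesis by (simp add: principal_def closed_pt.mem_iff[OF point_val])
  qed
  obtain c where c: "f - \<iota> c \<in> max_ideal P0" using P0(2)[OF mem[OF P0(1)]] by blast
  have "f = \<iota> c"
  proof (rule ccontr)
    assume "f \<noteq> \<iota> c"
    define g where "g = f - \<iota> c"
    have g0: "g \<noteq> 0" using \<open>f \<noteq> \<iota> c\<close> by (simp add: g_def)
    have nonneg: "pr g P \<ge> 0" for P
    proof (cases "closed_point \<iota> P")
      case True
      interpret closed_pt \<iota> P using True by (rule point_val)
      have "g \<in> P" unfolding g_def using mem[OF True] by (intro diff_mem) simp_all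
      then show ?thesis using g0 True by (simp add: principal_def mem_iff)
    qed (simp add: principal_def)
    interpret ff_point \<iota> P0 using P0(1) by (rule point)
    have pos: "pr g P0 \<ge> 1"
      using c g0 P0(1) unfolding g_def[symmetric] by (simp add: max_ideal_iff principal_def)
    have "degree_div \<iota> (pr g) > 0"
      unfolding degree_div_def
    proof (rule sum_pos2)
      show "finite (Supp (pr g))" using principal_Div[OF g0] by (rule finite_Supp)
      show "P0 \<in> Supp (pr g)" using pos by (simp add: Supp_def)
      show "0 < pr g P0 * int (point_degree \<iota> P0)" using pos point_degree_pos by simp
      show "0 \<le> pr g P * int (point_degree \<iota> P)" if "P \<in> Supp (pr g)" for P
        using nonneg by simp
    qed
    then show False using principal_Div0[OF g0] by (simp add: Div0_def)
  qed
  with assms(1) that[of c] show thesis by auto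
qed

lemma principal_eq_const:
  assumes "f \<noteq> 0" "g \<noteq> 0" "pr f = pr g"
  obtains c where "c \<noteq> 0" "f = \<iota> c * g"
proof -
  have "pr (f * inverse g) = 0"
    using assms by (simp add: principal_mult principal_inverse)
  then obtain c where "c \<noteq> 0" "f * inverse g = \<iota> c"
    using assms principal_zero_const[of "f * inverse g"] by auto
  with assms that[of c] show thesis by (simp add: field_simps)
qed

lemma approximation:
  assumes "finite S" "\<And>P. P \<in> S \<Longrightarrow> closed_point \<iota> P"
  obtains f where "f \<noteq> 0" "\<And>P. P \<in> S \<Longrightarrow> ord_at P f = a P"
  using weak_approximation[OF assms] by blast

text \<open>The value 1 off the closed points keeps \<open>unif P\<close> nonzero for every set P,
  so its powers need no side conditions.\<close>

definition unif :: "'f set \<Rightarrow> 'f" where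
  "unif P = (if closed_point \<iota> P then SOME t. uniformizer P t else 1)"

lemma uniformizer_unif: "closed_point \<iota> P \<Longrightarrow> uniformizer P (unif P)"
  unfolding unif_def using closed_pt.ex_uniformizer[OF point_val] by (simp add: someI_ex)

lemma unif_nonzero [simp]: "unif P \<noteq> 0"
  using closed_pt.uniformizer_nonzero[OF point_val uniformizer_unif, of P]
  by (cases "closed_point \<iota> P") (auto simp: unif_def)

lemma ord_unif: "closed_point \<iota> P \<Longrightarrow> ord_at P (unif P) = 1"
  by (rule closed_pt.ord_uniformizer[OF point_val uniformizer_unif])

text \<open>The norm of the leading coefficient of \<open>f\<close> with respect to the chosen
  uniformizer. This normalization extends multiplicativity from units to all nonzero
  functions.\<close>

definition lead_norm :: "'f set \<Rightarrow> 'f \<Rightarrow> 'k" where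
  "lead_norm P f = residue_norm \<iota> P (f * unif P powi (- ord_at P f))"

lemma lead_unit:
  assumes "closed_point \<iota> P" "f \<noteq> 0"
  shows "f * unif P powi (- ord_at P f) \<in> local_units P"
proof -
  interpret closed_pt \<iota> P using assms(1) by (rule point_val)
  show ?thesis using assms by (simp add: unit_iff_ord ord_mult ord_powi ord_unif)
qed

lemma lead_norm_nonzero: "closed_point \<iota> P \<Longrightarrow> f \<noteq> 0 \<Longrightarrow> lead_norm P f \<noteq> 0"
  unfolding lead_norm_def using ff_point.residue_norm_nonzero[OF point] lead_unit by blast

lemma lead_norm_mult:
  assumes P: "closed_point \<iota> P" and nz: "f \<noteq> 0" "g \<noteq> 0"
  shows "lead_norm P (f * g) = lead_norm P f * lead_norm P g"
proof -
  interpret ff_point \<iota> P using P by (rule point)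
  have "f * g * unif P powi (- ord_at P (f * g)) =
      (f * unif P powi (- ord_at P f)) * (g * unif P powi (- ord_at P g))"
    using nz power_int_add[of "unif P" "- ord_at P f" "- ord_at P g"] by (simp add: ord_mult)
  note eq = this
  show ?thesis
    unfolding lead_norm_def eq
    by (rule residue_norm_mult)
       (use lead_unit[OF P nz(1)] lead_unit[OF P nz(2)] in \<open>simp_all add: unit_iff\<close>)
qed

lemma lead_norm_unit: "ord_at P f = 0 \<Longrightarrow> lead_norm P f = residue_norm \<iota> P f"
  by (simp add: lead_norm_def)

lemma lead_norm_const:
  "closed_point \<iota> P \<Longrightarrow> c \<noteq> 0 \<Longrightarrow> lead_norm P (\<iota> c) = c ^ point_degree \<iota> P"
  by (simp add: lead_norm_unit closed_pt.ord_const[OF point_val] ff_point.residue_norm_const[OF point])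

definition pair :: "'f \<Rightarrow> 'f divisor \<Rightarrow> 'k" where
  "pair f A = (\<Prod>P\<in>Supp A. lead_norm P f powi A P)"

lemma pair_superset:
  assumes "finite S" "Supp A \<subseteq> S"
  shows "pair f A = (\<Prod>P\<in>S. lead_norm P f powi A P)"
  unfolding pair_def by (rule prod.mono_neutral_left) (use assms in \<open>auto simp: Supp_def\<close>)

lemma pair_add:
  assumes A: "A \<in> Div \<iota>" and B: "B \<in> Div \<iota>" and f: "f \<noteq> 0"
  shows "pair f (A + B) = pair f A * pair f B"
proof -
  define S where "S = Supp A \<union> Supp B"
  have S: "finite S" "Supp A \<subseteq> S" "Supp B \<subseteq> S" "Supp (A + B) \<subseteq> S"
    using A B Supp_add by (auto simp: S_def finite_Supp)
  have "lead_norm P f \<noteq> 0" if "P \<in> S" for P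
    using that A B f Supp_closed lead_norm_nonzero unfolding S_def by blast
  then show ?thesis
    unfolding pair_superset[OF S(1,2)] pair_superset[OF S(1,3)] pair_superset[OF S(1,4)]
    by (simp add: power_int_add flip: prod.distrib)
qed

lemma pair_mult:
  assumes A: "A \<in> Div \<iota>" and "f \<noteq> 0" "g \<noteq> 0"
  shows "pair (f * g) A = pair f A * pair g A"
  unfolding pair_def prod.distrib[symmetric]
  by (intro prod.cong refl)
     (use assms Supp_closed[OF A] in \<open>simp add: lead_norm_mult power_int_mult_distrib\<close>)

lemma pair_zero [simp]: "pair f 0 = 1"
  by (simp add: pair_def Supp_zero)

lemma pair_nonzero: "A \<in> Div \<iota> \<Longrightarrow> f \<noteq> 0 \<Longrightarrow> pair f A \<noteq> 0"
  unfolding pair_def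
  by (cases "finite (Supp A)") (auto simp: lead_norm_nonzero Supp_closed)

lemma pair_one [simp]: "A \<in> Div \<iota> \<Longrightarrow> pair 1 A = 1"
  using pair_mult[of A 1 1] pair_nonzero[of A 1] by simp

lemma pair_uminus: "A \<in> Div \<iota> \<Longrightarrow> f \<noteq> 0 \<Longrightarrow> pair f (- A) = inverse (pair f A)"
  using pair_add[of A "- A" f] by (simp add: Div_uminus inverse_unique)

lemma pair_inverse: "A \<in> Div \<iota> \<Longrightarrow> f \<noteq> 0 \<Longrightarrow> pair (inverse f) A = inverse (pair f A)"
  using pair_mult[of A f "inverse f"] by (simp add: inverse_unique)

text \<open>The exponents of c add up to the degree of A. This is what makes pairings with divisors
  of degree zero insensitive to rescaling a function.\<close>

lemma pair_const:
  assumes A: "A \<in> Div0 \<iota>" and c: "c \<noteq> 0"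
  shows "pair (\<iota> c) A = 1"
proof -
  have "pair (\<iota> c) A = (\<Prod>P\<in>Supp A. c powi (A P * int (point_degree \<iota> P)))"
    unfolding pair_def
    by (intro prod.cong refl)
       (use c Supp_closed[OF Div0_Div[OF A]] in
        \<open>simp add: lead_norm_const power_int_mult mult.commute[of "A _"]\<close>)
  also have "\<dots> = 1"
    using A by (simp add: prod_powi_sum[OF c] Div0_def flip: degree_div_def)
  finally show ?thesis .
qed

lemma eval_div_eq_pair:
  assumes "A \<in> Div \<iota>" "disjoint_div (pr f) A"
  shows "eval_div \<iota> f A = pair f A"
  unfolding eval_div_def pair_def
proof (intro prod.cong refl)
  fix P assume "P \<in> Supp A"
  then have "ord_at P f = 0"
    using assms Supp_closed[OF assms(1)] by (auto simp: disjoint_div_iff principal_def)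
  then show "residue_norm \<iota> P f powi A P = lead_norm P f powi A P" by (simp add: lead_norm_unit)
qed

section \<open>The Weil symbol and its values on disjoint divisors\<close>

text \<open>The product over all closed points of the tame symbols of \<open>g\<close> and
  \<open>h\<close> without their signs; the chosen uniformizers cancel in it.\<close>

definition weil :: "'f \<Rightarrow> 'f \<Rightarrow> 'k" where
  "weil g h = pair g (pr h) / pair h (pr g)"

lemma weil_nonzero: "g \<noteq> 0 \<Longrightarrow> h \<noteq> 0 \<Longrightarrow> weil g h \<noteq> 0"
  by (simp add: weil_def pair_nonzero principal_Div)

lemma weil_mult_left: "f \<noteq> 0 \<Longrightarrow> g \<noteq> 0 \<Longrightarrow> h \<noteq> 0 \<Longrightarrow> weil (f * g) h = weil f h * weil g h"
  by (simp add: weil_def pair_mult pair_add principal_mult principal_Div)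

lemma weil_mult_right: "f \<noteq> 0 \<Longrightarrow> g \<noteq> 0 \<Longrightarrow> h \<noteq> 0 \<Longrightarrow> weil f (g * h) = weil f g * weil f h"
  by (simp add: weil_def pair_mult pair_add principal_mult principal_Div)

lemma weil_swap: "inverse (weil g h) = weil h g"
  by (simp add: weil_def)

lemma weil_inverse_right: "f \<noteq> 0 \<Longrightarrow> g \<noteq> 0 \<Longrightarrow> weil f (inverse g) = inverse (weil f g)"
  by (simp add: weil_def pair_inverse pair_uminus principal_inverse principal_Div divide_inverse)

lemma weil_one_right: "f \<noteq> 0 \<Longrightarrow> weil f 1 = 1"
  by (simp add: weil_def principal_one principal_Div)

text \<open>
  By Weil reciprocity this group is trivial. The identifications defining the Poincare torsor make
  sense modulo this group whether or not it is trivial, so reciprocity is never needed.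
\<close>

inductive_set weil_group :: "'k set" where
  one: "1 \<in> weil_group"
| mult_weil: "\<chi> \<in> weil_group \<Longrightarrow> g \<noteq> 0 \<Longrightarrow> h \<noteq> 0 \<Longrightarrow> disjoint_div (pr g) (pr h) \<Longrightarrow>
    \<chi> * weil g h \<in> weil_group"

lemma weil_group_mult:
  assumes "a \<in> weil_group" "b \<in> weil_group"
  shows "a * b \<in> weil_group"
  using assms(2)
proof induction
  case (mult_weil \<chi> g h)
  then show ?case using weil_group.mult_weil[of "a * \<chi>" g h] by (simp add: mult.assoc)
qed (use assms(1) in simp)

lemma weil_group_inverse: "a \<in> weil_group \<Longrightarrow> inverse a \<in> weil_group"
proof (induction rule: weil_group.induct)
  case (mult_weil \<chi> g h)
  then show ?case
    using weil_group.mult_weil[of "inverse \<chi>" h g] by (simp add: weil_swap disjoint_div_sym)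
qed (simp add: weil_group.one)

lemma weil_group_nonzero: "a \<in> weil_group \<Longrightarrow> a \<noteq> 0"
  by (induction rule: weil_group.induct) (simp_all add: weil_nonzero)

definition wcong :: "'k \<Rightarrow> 'k \<Rightarrow> bool" (infix \<open>\<approx>\<close> 50) where
  "a \<approx> b \<longleftrightarrow> (\<exists>\<chi>\<in>weil_group. a = b * \<chi>)"

lemma wcong_refl [simp]: "a \<approx> a"
  unfolding wcong_def using weil_group.one by force

lemma wcong_sym:
  assumes "a \<approx> b"
  shows "b \<approx> a"
proof -
  from assms obtain \<chi> where "\<chi> \<in> weil_group" "a = b * \<chi>" unfolding wcong_def by blast
  then show ?thesis unfolding wcong_def
    by (intro bexI[of _ "inverse \<chi>"]) (simp_all add: weil_group_inverse weil_group_nonzero)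
qed

lemma wcong_trans [trans]: "a \<approx> b \<Longrightarrow> b \<approx> c \<Longrightarrow> a \<approx> c"
  unfolding wcong_def by (metis mult.assoc weil_group_mult)

lemma wcong_mult: "a \<approx> b \<Longrightarrow> c \<approx> d \<Longrightarrow> a * c \<approx> b * d"
  unfolding wcong_def
  by (elim bexE, rule_tac x = "\<chi> * \<chi>'" in bexI) (auto simp: weil_group_mult mult_ac)

lemma wcong_inverse: "a \<approx> b \<Longrightarrow> inverse a \<approx> inverse b"
  unfolding wcong_def
  by (elim bexE, rule_tac x = "inverse \<chi>" in bexI) (simp_all add: weil_group_inverse)

text \<open>As a section of \<open>\<O> E\<close>, \<open>s\<close> has the divisor
  \<open>E + pr s\<close>. The condition on orders says that this divisor avoids the support of
  (g).\<close>

definition compensates :: "'f \<Rightarrow> 'f divisor \<Rightarrow> 'f \<Rightarrow> bool" where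
  "compensates g E s \<longleftrightarrow> s \<noteq> 0 \<and> (\<forall>P\<in>Supp (pr g). ord_at P s = - E P)"

text \<open>
  The factor by which coordinates change when \<open>D + (g)\<close> is replaced by \<open>D\<close>; it depends on the
  choice of the section \<open>s\<close> only up to the Weil group.
\<close>

definition twist :: "'f \<Rightarrow> 'f divisor \<Rightarrow> 'k" where
  "twist g E = pair g E * weil g (SOME s. compensates g E s)"

lemma weil_mem: "g \<noteq> 0 \<Longrightarrow> h \<noteq> 0 \<Longrightarrow> disjoint_div (pr g) (pr h) \<Longrightarrow> weil g h \<in> weil_group"
  using weil_group.mult_weil[OF weil_group.one] by simp

lemma ex_compensates:
  assumes "g \<noteq> 0"
  shows "\<exists>s. compensates g E s"
proof -
  have "finite (Supp (pr g))" "\<And>P. P \<in> Supp (pr g) \<Longrightarrow> closed_point \<iota> P"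
    using principal_Div[OF assms] by (auto simp: Div_def)
  then show ?thesis
    using approximation[of "Supp (pr g)" "\<lambda>P. - E P"] unfolding compensates_def by metis
qed

text \<open>The quotient s / s' has order 0 along the support of (g). So its divisor is disjoint
  from (g), and the two symbols differ by a generator of the Weil group.\<close>

lemma weil_compensates:
  assumes g: "g \<noteq> 0" and s: "compensates g E s" "compensates g E s'"
  shows "weil g s \<approx> weil g s'"
proof -
  have nz: "s \<noteq> 0" "s' \<noteq> 0" using s by (auto simp: compensates_def)
  have "disjoint_div (pr (s * inverse s')) (pr g)"
    unfolding disjoint_div_iff
  proof
    fix P assume "P \<in> Supp (pr g)"
    then show "pr (s * inverse s') P = 0"
      using s nz by (simp add: principal_mult principal_inverse) (simp add: principal_def compensates_def)
  qed
  then have "weil g (s * inverse s') \<in> weil_group"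
    using g nz by (intro weil_mem) (simp_all add: disjoint_div_sym)
  moreover have "weil g s = weil g s' * weil g (s * inverse s')"
  proof -
    have eq: "s' * (s * inverse s') = s" using nz by (simp add: field_simps)
    have "s * inverse s' \<noteq> 0" using nz by simp
    from weil_mult_right[OF g nz(2) this] show ?thesis unfolding eq .
  qed
  ultimately show ?thesis unfolding wcong_def by blast
qed

lemma twist_eq:
  assumes "g \<noteq> 0" "compensates g E s"
  shows "twist g E \<approx> pair g E * weil g s"
  unfolding twist_def
  by (intro wcong_mult wcong_refl
      weil_compensates[OF assms(1) someI_ex[OF ex_compensates[OF assms(1)]] assms(2)])

lemma twist_nonzero:
  assumes "g \<noteq> 0" "E \<in> Div \<iota>"
  shows "twist g E \<noteq> 0"
proof -
  have "compensates g E (SOME s. compensates g E s)"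
    by (rule someI_ex[OF ex_compensates[OF assms(1)]])
  with assms show ?thesis by (simp add: twist_def pair_nonzero weil_nonzero compensates_def)
qed

lemma compensates_mult:
  assumes "compensates g E s" "compensates g E' s'"
  shows "compensates g (E + E') (s * s')"
  using assms unfolding compensates_def
  by (auto simp: Supp_def principal_def closed_pt.ord_mult[OF point_val] split: if_splits)

text \<open>A section that compensates on the supports of both (g) and (h) serves g, h and gh at
  once.\<close>

lemma twist_mult:
  assumes g: "g \<noteq> 0" and h: "h \<noteq> 0" and E: "E \<in> Div \<iota>"
  shows "twist (g * h) E \<approx> twist g E * twist h E"
proof -
  have "finite (Supp (pr g) \<union> Supp (pr h))"
    "\<And>P. P \<in> Supp (pr g) \<union> Supp (pr h) \<Longrightarrow> closed_point \<iota> P"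
    using principal_Div[OF g] principal_Div[OF h] by (auto simp: Div_def)
  then obtain s where s: "s \<noteq> 0" "\<And>P. P \<in> Supp (pr g) \<union> Supp (pr h) \<Longrightarrow> ord_at P s = - E P"
    using approximation[of "Supp (pr g) \<union> Supp (pr h)" "\<lambda>P. - E P"] by metis
  have "compensates (g * h) E s" "compensates g E s" "compensates h E s"
    using s Supp_add[of "pr g" "pr h"] g h by (auto simp: compensates_def principal_mult)
  note tw = this
  have "twist (g * h) E \<approx> pair (g * h) E * weil (g * h) s"
    using g h by (intro twist_eq tw) simp
  also have "\<dots> = (pair g E * weil g s) * (pair h E * weil h s)"
    using g h E s(1) by (simp add: pair_mult weil_mult_left)
  also have "\<dots> \<approx> twist g E * twist h E"
    by (intro wcong_mult wcong_sym[OF twist_eq] g h tw)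
  finally show ?thesis .
qed

lemma twist_add:
  assumes g: "g \<noteq> 0" and E: "E \<in> Div \<iota>" "E' \<in> Div \<iota>"
  shows "twist g (E + E') \<approx> twist g E * twist g E'"
proof -
  obtain s s' where s: "compensates g E s" "compensates g E' s'"
    using ex_compensates[OF g] by blast
  then have nz: "s \<noteq> 0" "s' \<noteq> 0" by (auto simp: compensates_def)
  have "twist g (E + E') \<approx> pair g (E + E') * weil g (s * s')"
    by (intro twist_eq g compensates_mult s)
  also have "\<dots> = (pair g E * weil g s) * (pair g E' * weil g s')"
    using g E nz by (simp add: pair_add weil_mult_right)
  also have "\<dots> \<approx> twist g E * twist g E'"
    by (intro wcong_mult wcong_sym[OF twist_eq] g s)
  finally show ?thesis .
qed

text \<open>The section 1/f has the divisor (f) + (1/f) = 0, so it compensates for every g. The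
  formula is what makes a change of E commute with a change of D.\<close>

lemma twist_principal:
  assumes g: "g \<noteq> 0" and f: "f \<noteq> 0"
  shows "twist g (pr f) \<approx> pair f (pr g)"
proof -
  have "compensates g (pr f) (inverse f)"
    using f by (auto simp: compensates_def principal_def Supp_def closed_pt.ord_inverse[OF point_val]
        split: if_splits)
  then have "twist g (pr f) \<approx> pair g (pr f) * weil g (inverse f)" by (rule twist_eq[OF g])
  also have "\<dots> = pair f (pr g)"
    using f g by (simp add: weil_inverse_right weil_swap) (simp add: weil_def pair_nonzero principal_Div)
  finally show ?thesis .
qed

text \<open>The divisor of a constant has empty support, so the section 1 compensates, and the
  remaining factor is 1 because E has degree zero.\<close>

lemma twist_const:
  assumes "c \<noteq> 0" "E \<in> Div0 \<iota>"
  shows "twist (\<iota> c) E \<approx> 1"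
proof -
  have "compensates (\<iota> c) E 1"
    using assms by (simp add: compensates_def principal_const Supp_zero)
  then have "twist (\<iota> c) E \<approx> pair (\<iota> c) E * weil (\<iota> c) 1" using assms by (intro twist_eq) auto
  also have "\<dots> = 1" using assms by (simp add: pair_const weil_one_right)
  finally show ?thesis .
qed

lemma twist_zero:
  assumes "g \<noteq> 0"
  shows "twist g 0 \<approx> 1"
proof -
  have "compensates g 0 1"
    by (auto simp: compensates_def principal_def Supp_def closed_pt.ord_one[OF point_val] split: if_splits)
  then have "twist g 0 \<approx> pair g 0 * weil g 1" using assms by (intro twist_eq) auto
  also have "\<dots> = 1" using assms by (simp add: weil_one_right)
  finally show ?thesis .
qed

lemma twist_one: "E \<in> Div0 \<iota> \<Longrightarrow> twist 1 E \<approx> 1"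
  using twist_const[of 1 E] by simp

lemma twist_inverse:
  assumes "g \<noteq> 0" "E \<in> Div0 \<iota>"
  shows "twist (inverse g) E \<approx> inverse (twist g E)"
proof -
  have "twist (inverse g) E = inverse (twist g E) * (twist g E * twist (inverse g) E)"
    using assms by (simp add: twist_nonzero Div0_Div)
  also have "\<dots> \<approx> inverse (twist g E) * twist 1 E"
    using wcong_sym[OF twist_mult[of g "inverse g" E]] assms
    by (intro wcong_mult wcong_refl) (simp add: Div0_Div)
  also have "\<dots> \<approx> inverse (twist g E) * 1"
    by (intro wcong_mult wcong_refl twist_one assms)
  finally show ?thesis by simp
qed

end

section \<open>Coordinates on the norm lines\<close>

context degree_zero_curve
begin

lemma generator_O:
  assumes P: "closed_point \<iota> P"
  shows "generator (\<O> E) P g \<longleftrightarrow> g \<noteq> 0 \<and> ord_at P g = - E P"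
proof -
  interpret closed_pt \<iota> P using P by (rule point_val)
  have stalk: "stalk (\<O> E) P = {h. h = 0 \<or> ord_at P h \<ge> - E P}"
    and smul: "smul (\<O> E) = (*)" by (simp_all add: \<O>_def)
  show ?thesis
  proof
    assume "generator (\<O> E) P g"
    then have g: "g \<noteq> 0" "{h. h = 0 \<or> ord_at P h \<ge> - E P} = {c * g | c. c \<in> P}"
      by (simp_all add: generator_def stalk smul)
    have "g \<in> {h. h = 0 \<or> ord_at P h \<ge> - E P}"
      unfolding g(2) by (intro CollectI exI[of _ 1]) simp
    then have ge: "ord_at P g \<ge> - E P" using g(1) by blast
    \<comment> \<open>This element of the stalk must be a multiple of g, which bounds the order of g
      from above.\<close>
    have "unif P powi (- E P) \<in> {h. h = 0 \<or> ord_at P h \<ge> - E P}"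
      using P by (simp add: ord_powi ord_unif)
    then obtain c where c: "unif P powi (- E P) = c * g" "c \<in> P" unfolding g(2) by blast
    have c0: "c \<noteq> 0" using c(1) by (metis mult_zero_left power_int_eq_0_iff unif_nonzero)
    have "- E P = ord_at P (unif P powi (- E P))" using P by (simp add: ord_powi ord_unif)
    also have "\<dots> = ord_at P c + ord_at P g" using c0 g(1) by (simp add: c(1) ord_mult)
    finally have "ord_at P g \<le> - E P" using c(2) mem_iff[OF c0] by simp
    with ge g(1) show "g \<noteq> 0 \<and> ord_at P g = - E P" by simp
  next
    assume g: "g \<noteq> 0 \<and> ord_at P g = - E P"
    have "{h. h = 0 \<or> ord_at P h \<ge> - E P} = {c * g | c. c \<in> P}"
    proof (intro equalityI subsetI)
      fix h assume "h \<in> {h. h = 0 \<or> ord_at P h \<ge> - E P}"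
      then have "h / g \<in> P" using g by (cases "h = 0") (auto simp: mem_iff ord_divide)
      then show "h \<in> {c * g | c. c \<in> P}" using g by (intro CollectI exI[of _ "h / g"]) simp
    next
      fix h assume "h \<in> {c * g | c. c \<in> P}"
      then obtain c where "h = c * g" "c \<in> P" by blast
      then show "h \<in> {h. h = 0 \<or> ord_at P h \<ge> - E P}"
        using g by (cases "c = 0") (auto simp: mem_iff ord_mult)
    qed
    with g show "generator (\<O> E) P g" by (simp add: generator_def stalk smul)
  qed
qed

lemma ratio_O: "v \<noteq> 0 \<Longrightarrow> ratio (\<O> E) w v = w / v"
  unfolding ratio_def \<O>_def by (rule the_equality) auto

lemma frames_iff:
  "v \<in> frames \<iota> (\<O> E) \<longleftrightarrow> (\<forall>P. closed_point \<iota> P \<longrightarrow> v P \<noteq> 0 \<and> ord_at P (v P) = - E P)"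
  unfolding frames_def using generator_O by auto

lemma frame_nonzero: "v \<in> frames \<iota> (\<O> E) \<Longrightarrow> closed_point \<iota> P \<Longrightarrow> v P \<noteq> 0"
  by (simp add: frames_iff)

lemma frame_quotient_mem:
  assumes P: "closed_point \<iota> P" and v: "v \<in> frames \<iota> (\<O> E)" and w: "w \<in> frames \<iota> (\<O> E)"
  shows "w P / v P \<in> P"
proof -
  interpret closed_pt \<iota> P using P by (rule point_val)
  have nz: "v P \<noteq> 0" "w P \<noteq> 0" using v w P by (simp_all add: frames_iff)
  have "ord_at P (w P) = ord_at P (v P)" using v w P by (simp add: frames_iff)
  with nz show ?thesis by (simp add: mem_iff ord_divide)
qed

definition std_frame :: "'f divisor \<Rightarrow> 'f set \<Rightarrow> 'f" where
  "std_frame E P = unif P powi (- E P)"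

lemma std_frame: "std_frame E \<in> frames \<iota> (\<O> E)"
  by (auto simp: frames_iff std_frame_def closed_pt.ord_powi[OF point_val] ord_unif)

lemma std_frame_add: "std_frame (E + E') P = std_frame E P * std_frame E' P"
  using power_int_add[of "unif P" "- E P" "- E' P"] by (simp add: std_frame_def)

text \<open>The transition factor of \<open>norm_line\<close> for a bundle \<open>\<O> E\<close>,
  where ratios of sections are quotients of functions, so the same expression serves all E.\<close>

definition frame_norm :: "'f divisor \<Rightarrow> ('f set \<Rightarrow> 'f) \<Rightarrow> ('f set \<Rightarrow> 'f) \<Rightarrow> 'k" where
  "frame_norm D w v = (\<Prod>P\<in>Supp D. residue_norm \<iota> P (w P / v P) powi D P)"

lemma frame_norm_cong:
  assumes "D \<in> Div \<iota>" "\<And>P. closed_point \<iota> P \<Longrightarrow> w P / v P = w' P / v' P"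
  shows "frame_norm D w v = frame_norm D w' v'"
  unfolding frame_norm_def by (intro prod.cong refl) (use assms Supp_closed[OF assms(1)] in simp)

lemma frame_norm_refl:
  assumes "D \<in> Div \<iota>" "v \<in> frames \<iota> (\<O> E)"
  shows "frame_norm D v v = 1"
  unfolding frame_norm_def
proof (rule prod.neutral, rule ballI)
  fix P assume "P \<in> Supp D"
  then have "closed_point \<iota> P" by (rule Supp_closed[OF assms(1)])
  with frame_nonzero[OF assms(2)] show "residue_norm \<iota> P (v P / v P) powi D P = 1"
    by (simp add: ff_point.residue_norm_one[OF point])
qed

lemma frame_norm_mult:
  assumes D: "D \<in> Div \<iota>" and v: "v \<in> frames \<iota> (\<O> E)" and w: "w \<in> frames \<iota> (\<O> E)"
    and v': "v' \<in> frames \<iota> (\<O> E')" and w': "w' \<in> frames \<iota> (\<O> E')"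
  shows "frame_norm D (\<lambda>P. w P * w' P) (\<lambda>P. v P * v' P) = frame_norm D w v * frame_norm D w' v'"
  unfolding frame_norm_def prod.distrib[symmetric]
proof (intro prod.cong refl)
  fix P assume "P \<in> Supp D"
  then have P: "closed_point \<iota> P" by (rule Supp_closed[OF D])
  interpret ff_point \<iota> P using P by (rule point)
  have "w P / v P \<in> P" "w' P / v' P \<in> P"
    using frame_quotient_mem[OF P] v w v' w' by blast+
  then show "residue_norm \<iota> P (w P * w' P / (v P * v' P)) powi D P =
      residue_norm \<iota> P (w P / v P) powi D P * residue_norm \<iota> P (w' P / v' P) powi D P"
    unfolding times_divide_times_eq[symmetric]
    by (simp only: residue_norm_mult power_int_mult_distrib)
qed

lemma frame_norm_trans:
  assumes D: "D \<in> Div \<iota>" and u: "u \<in> frames \<iota> (\<O> E)" and v: "v \<in> frames \<iota> (\<O> E)"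
    and w: "w \<in> frames \<iota> (\<O> E)"
  shows "frame_norm D w v = frame_norm D w u * frame_norm D u v"
proof -
  \<comment> \<open>Writing w / v as (w u) / (u v) reduces transitivity to multiplicativity.\<close>
  have "frame_norm D w v = frame_norm D (\<lambda>P. w P * u P) (\<lambda>P. u P * v P)"
    using frame_nonzero[OF u] by (intro frame_norm_cong D) simp
  then show ?thesis using frame_norm_mult[OF D u w v u] by simp
qed

text \<open>By the transformation law an element of the line is determined by its coordinate in one
  frame. That frame is \<open>std_frame E\<close>, and \<open>c\<close> is the coordinate in
  it.\<close>

definition coord :: "'f divisor \<Rightarrow> 'f divisor \<Rightarrow> 'k \<Rightarrow> ('f set \<Rightarrow> 'f) \<Rightarrow> 'k" where
  "coord D E c = (\<lambda>v. if v \<in> frames \<iota> (\<O> E) then c * frame_norm D (std_frame E) v else 0)"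

lemma coord_std: "D \<in> Div \<iota> \<Longrightarrow> coord D E c (std_frame E) = c"
  by (simp add: coord_def std_frame frame_norm_refl[OF _ std_frame])

lemma norm_line_O:
  assumes "D \<in> Div \<iota>"
  shows "\<phi> \<in> norm_line \<iota> D (\<O> E) \<longleftrightarrow> (\<forall>v. v \<notin> frames \<iota> (\<O> E) \<longrightarrow> \<phi> v = 0) \<and>
     (\<forall>v\<in>frames \<iota> (\<O> E). \<forall>w\<in>frames \<iota> (\<O> E). \<phi> v = \<phi> w * frame_norm D w v)"
proof -
  have "(\<Prod>P\<in>Supp D. residue_norm \<iota> P (ratio (\<O> E) (w P) (v P)) powi D P) = frame_norm D w v"
    if "v \<in> frames \<iota> (\<O> E)" for v w
    unfolding frame_norm_def
    by (intro prod.cong refl)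
       (use Supp_closed[OF assms] frame_nonzero[OF that] in \<open>simp add: ratio_O\<close>)
  then show ?thesis unfolding norm_line_def by simp
qed

lemma coord_mem:
  assumes "D \<in> Div \<iota>"
  shows "coord D E c \<in> norm_line \<iota> D (\<O> E)"
  unfolding norm_line_O[OF assms]
proof (intro conjI ballI allI impI)
  fix v w assume "v \<in> frames \<iota> (\<O> E)" "w \<in> frames \<iota> (\<O> E)"
  then show "coord D E c v = coord D E c w * frame_norm D w v"
    using frame_norm_trans[OF assms _ _ std_frame, of w E v] by (simp add: coord_def)
qed (simp add: coord_def)

lemma norm_line_coord:
  assumes "D \<in> Div \<iota>" "\<phi> \<in> norm_line \<iota> D (\<O> E)"
  shows "\<phi> = coord D E (\<phi> (std_frame E))"
proof
  fix v
  note * = assms(2)[unfolded norm_line_O[OF assms(1)]]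
  show "\<phi> v = coord D E (\<phi> (std_frame E)) v"
  proof (cases "v \<in> frames \<iota> (\<O> E)")
    case True
    from bspec[OF bspec[OF conjunct2[OF *] True] std_frame] True show ?thesis
      unfolding coord_def by (simp only: if_True)
  next
    case False
    from spec[OF conjunct1[OF *], of v] False show ?thesis by (simp add: coord_def)
  qed
qed

lemma norm_line_eqI:
  assumes "D \<in> Div \<iota>" "\<phi> \<in> norm_line \<iota> D (\<O> E)" "\<psi> \<in> norm_line \<iota> D (\<O> E)"
    "\<phi> (std_frame E) = \<psi> (std_frame E)"
  shows "\<phi> = \<psi>"
proof -
  have "\<phi> = coord D E (\<phi> (std_frame E))" by (rule norm_line_coord[OF assms(1,2)])
  also have "\<dots> = coord D E (\<psi> (std_frame E))" by (simp only: assms(4))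
  also have "\<dots> = \<psi>" by (rule norm_line_coord[OF assms(1,3), symmetric])
  finally show ?thesis .
qed

lemma coord_scale: "(\<lambda>v. k * coord D E c v) = coord D E (k * c)"
  by (auto simp: coord_def)

lemma coord_eq_zero:
  assumes "D \<in> Div \<iota>"
  shows "coord D E c = (\<lambda>_. 0) \<longleftrightarrow> c = 0"
proof
  assume "coord D E c = (\<lambda>_. 0)"
  then show "c = 0" using coord_std[OF assms, of E c] by simp
qed (auto simp: coord_def)

definition trp :: "'f divisor \<Rightarrow> 'f divisor \<Rightarrow> 'k \<Rightarrow> ('k, 'f) triple" where
  "trp D E c = (D, E, coord D E c)"

lemma trp_inject:
  assumes "D \<in> Div \<iota>" "trp D E c = trp D' E' c'"
  shows "D' = D" "E' = E" "c' = c"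
proof -
  show "D' = D" "E' = E" using assms(2) by (simp_all add: trp_def)
  with assms(2) have "coord D E c (std_frame E) = coord D E c' (std_frame E)"
    by (simp add: trp_def)
  then show "c' = c" by (simp add: coord_std[OF assms(1)])
qed

lemma triples_iff:
  "t \<in> triples \<iota> \<longleftrightarrow> (\<exists>D E c. t = trp D E c \<and> D \<in> Div0 \<iota> \<and> E \<in> Div0 \<iota> \<and> c \<noteq> 0)"
proof
  assume "t \<in> triples \<iota>"
  then obtain D E \<phi> where t: "t = (D, E, \<phi>)" "D \<in> Div0 \<iota>" "E \<in> Div0 \<iota>"
    "\<phi> \<in> norm_line \<iota> D (\<O> E)" "\<phi> \<noteq> (\<lambda>_. 0)" unfolding triples_def by blast
  define c where "c = \<phi> (std_frame E)"
  have \<phi>: "\<phi> = coord D E c"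
    unfolding c_def by (rule norm_line_coord[OF Div0_Div[OF t(2)] t(4)])
  then have "c \<noteq> 0" using t(5) coord_eq_zero[OF Div0_Div[OF t(2)], of E c] by auto
  with t(1-3) \<phi> show "\<exists>D E c. t = trp D E c \<and> D \<in> Div0 \<iota> \<and> E \<in> Div0 \<iota> \<and> c \<noteq> 0"
    unfolding trp_def by blast
next
  assume "\<exists>D E c. t = trp D E c \<and> D \<in> Div0 \<iota> \<and> E \<in> Div0 \<iota> \<and> c \<noteq> 0"
  then show "t \<in> triples \<iota>"
    by (auto simp: triples_def trp_def coord_mem coord_eq_zero Div0_Div)
qed

text \<open>On the support of D the section s has the same order as the standard frame, so their
  quotient is the unit whose norm is \<open>lead_norm\<close>.\<close>

lemma norm_section_coord:
  assumes D: "D \<in> Div \<iota>" and s: "s \<noteq> 0" "\<And>P. P \<in> Supp D \<Longrightarrow> ord_at P s = - E P"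
  shows "norm_section \<iota> D (\<O> E) s = coord D E (pair s D)"
proof
  fix v
  show "norm_section \<iota> D (\<O> E) s v = coord D E (pair s D) v"
  proof (cases "v \<in> frames \<iota> (\<O> E)")
    case v: True
    have "(\<Prod>P\<in>Supp D. residue_norm \<iota> P (ratio (\<O> E) s (v P)) powi D P) =
        pair s D * frame_norm D (std_frame E) v"
      unfolding pair_def frame_norm_def prod.distrib[symmetric]
    proof (intro prod.cong refl)
      fix P assume PD: "P \<in> Supp D"
      then have P: "closed_point \<iota> P" by (rule Supp_closed[OF D])
      interpret ff_point \<iota> P using P by (rule point)
      define a where "a = s * unif P powi (- ord_at P s)"
      have a: "a \<in> P" using lead_unit[OF P s(1)] by (simp add: a_def unit_iff)
      have b: "std_frame E P / v P \<in> P"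
        using frame_quotient_mem[OF P v std_frame] .
      have "ratio (\<O> E) s (v P) = a * (std_frame E P / v P)"
        using s(2)[OF PD] frame_nonzero[OF v P]
        by (simp add: ratio_O a_def std_frame_def power_int_minus)
      then show "residue_norm \<iota> P (ratio (\<O> E) s (v P)) powi D P =
          lead_norm P s powi D P * residue_norm \<iota> P (std_frame E P / v P) powi D P"
        using a b by (simp only: residue_norm_mult power_int_mult_distrib lead_norm_def a_def)
    qed
    with v show ?thesis by (simp add: norm_section_def coord_def)
  qed (simp add: norm_section_def coord_def)
qed

lemma section_div_O:
  assumes "E \<in> Div \<iota>" "s \<noteq> 0"
  shows "section_div \<iota> (\<O> E) s = E + pr s"
proof
  fix P
  show "section_div \<iota> (\<O> E) s P = (E + pr s) P"
  proof (cases "closed_point \<iota> P")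
    case True
    interpret closed_pt \<iota> P using True by (rule point_val)
    have "generator (\<O> E) P (std_frame E P)" using std_frame True by (simp add: frames_def)
    then have "generator (\<O> E) P (SOME g. generator (\<O> E) P g)" by (rule someI)
    then have "(SOME g. generator (\<O> E) P g) \<noteq> 0"
      "ord_at P (SOME g. generator (\<O> E) P g) = - E P"
      using generator_O[OF True] by auto
    then show ?thesis using True assms(2)
      by (simp add: section_div_def principal_def ratio_O ord_divide)
  next
    case False
    then have "E P = 0" using Supp_closed[OF assms(1), of P] by (auto simp: Supp_def)
    with False show ?thesis by (simp add: section_div_def principal_def)
  qed
qed

text \<open>Multiplication by f carries the frame w / f to w, and the standard frame of E + (f)
  divided by w / f is the standard frame of E divided by w, times the leading unit of f. This is the
  origin of the factor \<open>pair f D\<close>.\<close>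

lemma norm_map_coord:
  assumes D: "D \<in> Div \<iota>" and f: "f \<noteq> 0"
  shows "norm_map (\<lambda>h. f * h) (coord D (E + pr f) c) = coord D E (c * pair f D)"
proof
  fix w :: "'f set \<Rightarrow> 'f"
  have inv: "inv_into UNIV (\<lambda>h. f * h) \<circ> w = (\<lambda>P. w P / f)"
  proof
    fix P
    have "inv_into UNIV (\<lambda>h. f * h) (f * (w P / f)) = w P / f"
      using inv_into_f_f[of "\<lambda>h. f * h" UNIV "w P / f"] f by (simp add: inj_on_def)
    then show "(inv_into UNIV (\<lambda>h. f * h) \<circ> w) P = w P / f" using f by simp
  qed
  have fr: "(\<lambda>P. w P / f) \<in> frames \<iota> (\<O> (E + pr f)) \<longleftrightarrow> w \<in> frames \<iota> (\<O> E)"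
    unfolding frames_iff
  proof (intro all_cong1 imp_cong refl)
    fix P assume P: "closed_point \<iota> P"
    interpret closed_pt \<iota> P using P by (rule point_val)
    show "(w P / f \<noteq> 0 \<and> ord_at P (w P / f) = - (E + pr f) P) \<longleftrightarrow>
        (w P \<noteq> 0 \<and> ord_at P (w P) = - E P)"
      using f P by (cases "w P = 0") (auto simp: ord_divide principal_def)
  qed
  show "norm_map (\<lambda>h. f * h) (coord D (E + pr f) c) w = coord D E (c * pair f D) w"
  proof (cases "w \<in> frames \<iota> (\<O> E)")
    case w: True
    have "frame_norm D (std_frame (E + pr f)) (\<lambda>P. w P / f) =
        pair f D * frame_norm D (std_frame E) w"
      unfolding pair_def frame_norm_def prod.distrib[symmetric]
    proof (intro prod.cong refl)
      fix P assume "P \<in> Supp D"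
      then have P: "closed_point \<iota> P" by (rule Supp_closed[OF D])
      interpret ff_point \<iota> P using P by (rule point)
      define a where "a = f * unif P powi (- ord_at P f)"
      have a: "a \<in> P" using lead_unit[OF P f] by (simp add: a_def unit_iff)
      have b: "std_frame E P / w P \<in> P"
        using frame_quotient_mem[OF P w std_frame] .
      have "std_frame (E + pr f) P / (w P / f) = a * (std_frame E P / w P)"
        unfolding std_frame_add using P by (simp add: a_def std_frame_def principal_def)
      then show "residue_norm \<iota> P (std_frame (E + pr f) P / (w P / f)) powi D P =
          lead_norm P f powi D P * residue_norm \<iota> P (std_frame E P / w P) powi D P"
        using a b by (simp only: residue_norm_mult power_int_mult_distrib lead_norm_def a_def)
    qed
    with w show ?thesis by (simp add: norm_map_def inv coord_def fr mult.assoc)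
  qed (simp add: norm_map_def inv coord_def fr)
qed

section \<open>The identifications in coordinates\<close>

text \<open>The composite of two moves: from \<open>E1\<close> to \<open>E\<close> while the first
  divisor is still \<open>D1\<close>, at the cost of \<open>pair f D1\<close>, and then from
  \<open>D1\<close> to \<open>D\<close>, at the cost of \<open>twist g E\<close>.\<close>

definition sim :: "'f divisor \<Rightarrow> 'f divisor \<Rightarrow> 'k \<Rightarrow> 'f divisor \<Rightarrow> 'f divisor \<Rightarrow> 'k \<Rightarrow> bool" where
  "sim D1 E1 c1 D E c \<longleftrightarrow> D1 \<in> Div0 \<iota> \<and> E1 \<in> Div0 \<iota> \<and> c1 \<noteq> 0 \<and> D \<in> Div0 \<iota> \<and> E \<in> Div0 \<iota> \<and> c \<noteq> 0 \<and>
     (\<exists>g f. g \<noteq> 0 \<and> f \<noteq> 0 \<and> D1 = D + pr g \<and> E1 = E + pr f \<and> c \<approx> c1 * pair f D1 * twist g E)"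

lemma simI:
  assumes "D \<in> Div0 \<iota>" "E \<in> Div0 \<iota>" "c1 \<noteq> 0" "c \<noteq> 0" "g \<noteq> 0" "f \<noteq> 0"
    "c \<approx> c1 * pair f (D + pr g) * twist g E"
  shows "sim (D + pr g) (E + pr f) c1 D E c"
  unfolding sim_def using assms principal_Div0 Div0_add by blast

lemma sim_refl: "D \<in> Div0 \<iota> \<Longrightarrow> E \<in> Div0 \<iota> \<Longrightarrow> c \<noteq> 0 \<Longrightarrow> sim D E c D E c"
proof -
  assume *: "D \<in> Div0 \<iota>" "E \<in> Div0 \<iota>" "c \<noteq> 0"
  have "c * pair 1 D * 1 \<approx> c * pair 1 D * twist 1 E"
    using * by (intro wcong_mult wcong_refl wcong_sym[OF twist_one])
  with * show ?thesis using simI[of D E c c 1 1] by (simp add: principal_one Div0_Div)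
qed

text \<open>The twist of the first step is taken over \<open>E1\<close> and has to be carried to
  \<open>E\<close>. By \<open>twist_principal\<close> this produces \<open>pair f' (pr g)\<close>,
  exactly the factor that turns \<open>pair f' D1\<close> into \<open>pair f' D2\<close>.\<close>

lemma sim_trans:
  assumes "sim D2 E2 c2 D1 E1 c1" "sim D1 E1 c1 D E c"
  shows "sim D2 E2 c2 D E c"
proof -
  from assms(1) obtain g f where 1: "g \<noteq> 0" "f \<noteq> 0" "D2 = D1 + pr g" "E2 = E1 + pr f"
    "c1 \<approx> c2 * pair f D2 * twist g E1" "D2 \<in> Div0 \<iota>" "c2 \<noteq> 0" unfolding sim_def by blast
  from assms(2) obtain g' f' where 2: "g' \<noteq> 0" "f' \<noteq> 0" "D1 = D + pr g'" "E1 = E + pr f'"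
    "c \<approx> c1 * pair f' D1 * twist g' E" "D \<in> Div0 \<iota>" "E \<in> Div0 \<iota>" "D1 \<in> Div0 \<iota>" "c \<noteq> 0"
    unfolding sim_def by blast
  have pg: "pr g \<in> Div \<iota>" "pr f' \<in> Div \<iota>" using 1 2 principal_Div by auto
  have "twist g E1 \<approx> twist g E * twist g (pr f')"
    unfolding 2(4) using 1 2 pg by (intro twist_add) (auto simp: Div0_Div)
  also have "\<dots> \<approx> twist g E * pair f' (pr g)"
    using 1 2 by (intro wcong_mult wcong_refl twist_principal)
  finally have tw: "twist g E1 \<approx> twist g E * pair f' (pr g)" .
  have "c \<approx> c1 * pair f' D1 * twist g' E" by (rule 2(5))
  also have "\<dots> \<approx> (c2 * pair f D2 * (twist g E * pair f' (pr g))) * pair f' D1 * twist g' E"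
    by (intro wcong_mult wcong_refl wcong_trans[OF 1(5)] tw)
  also have "\<dots> = c2 * (pair f D2 * (pair f' D1 * pair f' (pr g))) * (twist g E * twist g' E)"
    by (simp add: mult_ac)
  also have "\<dots> = c2 * pair (f * f') D2 * (twist g E * twist g' E)"
    using 1(1-3,6) 2(2,8) pg by (simp add: pair_mult pair_add Div0_Div Div_add)
  also have "\<dots> \<approx> c2 * pair (f * f') D2 * twist (g * g') E"
    using 1 2 by (intro wcong_mult wcong_refl wcong_sym[OF twist_mult]) (auto simp: Div0_Div)
  finally have c: "c \<approx> c2 * pair (f * f') D2 * twist (g * g') E" .
  have DE: "D2 = D + pr (g * g')" "E2 = E + pr (f * f')"
    using 1 2 by (simp_all add: principal_mult ac_simps)
  have "g * g' \<noteq> 0" "f * f' \<noteq> 0" using 1 2 by auto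
  from simI[OF 2(6,7) 1(7) 2(9) this c[unfolded DE(1)]] show ?thesis unfolding DE .
qed

lemma sim_sym:
  assumes "sim D1 E1 c1 D E c"
  shows "sim D E c D1 E1 c1"
proof -
  from assms obtain g f where 1: "g \<noteq> 0" "f \<noteq> 0" "D1 = D + pr g" "E1 = E + pr f"
    "c \<approx> c1 * pair f D1 * twist g E" and 2: "D1 \<in> Div0 \<iota>" "E1 \<in> Div0 \<iota>" "c1 \<noteq> 0"
    "D \<in> Div0 \<iota>" "E \<in> Div0 \<iota>" "c \<noteq> 0" unfolding sim_def by blast
  have nz: "pair f D \<noteq> 0" "pair f (pr g) \<noteq> 0" "twist g E \<noteq> 0" "twist g E1 \<noteq> 0"
    using 1 2 by (auto simp: pair_nonzero twist_nonzero Div0_Div principal_Div)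
  have "twist g E1 \<approx> twist g E * twist g (pr f)"
    unfolding 1(4) using 1 2 by (intro twist_add) (auto simp: Div0_Div principal_Div)
  also have "\<dots> \<approx> twist g E * pair f (pr g)"
    using 1 by (intro wcong_mult wcong_refl twist_principal)
  finally have tw: "twist g E1 \<approx> twist g E * pair f (pr g)" .
  have "c * pair (inverse f) D * twist (inverse g) E1 \<approx>
      (c1 * pair f D1 * twist g E) * pair (inverse f) D * inverse (twist g E * pair f (pr g))"
    using 1 2 by (intro wcong_mult wcong_refl wcong_trans[OF twist_inverse] wcong_inverse tw)
  also have "\<dots> = c1"
  proof -
    have "pair (inverse f) D = inverse (pair f D)" "pair f D1 = pair f D * pair f (pr g)"
      using 1(1-3) 2 by (simp_all add: pair_add pair_inverse Div0_Div principal_Div)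
    with nz show ?thesis by (simp add: field_simps)
  qed
  finally have c: "c1 \<approx> c * pair (inverse f) D * twist (inverse g) E1" by (rule wcong_sym)
  have DE: "D = D1 + pr (inverse g)" "E = E1 + pr (inverse f)"
    using 1 by (simp_all add: principal_inverse)
  have "inverse g \<noteq> 0" "inverse f \<noteq> 0" using 1 by auto
  from simI[OF 2(1,2,6,3) this] c DE show ?thesis by metis
qed

lemma sim_change_E:
  assumes "D \<in> Div0 \<iota>" "E \<in> Div0 \<iota>" "f \<noteq> 0" "c \<noteq> 0"
  shows "sim D (E + pr f) c D E (c * pair f D)"
proof -
  have "c * pair f D * 1 \<approx> c * pair f D * twist 1 E"
    using assms by (intro wcong_mult wcong_refl wcong_sym[OF twist_one])
  then show ?thesis using simI[of D E c "c * pair f D" 1 f] assms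
    by (simp add: principal_one pair_nonzero Div0_Div)
qed

lemma sim_change_D:
  assumes "D \<in> Div0 \<iota>" "E \<in> Div0 \<iota>" "g \<noteq> 0" "c \<noteq> 0" "compensates g E s"
  shows "sim (D + pr g) E c D E (c * pair g E * weil g s)"
proof -
  have "c * pair 1 (D + pr g) * (pair g E * weil g s) \<approx> c * pair 1 (D + pr g) * twist g E"
    using assms by (intro wcong_mult wcong_refl wcong_sym[OF twist_eq])
  moreover have "s \<noteq> 0" using assms(5) by (simp add: compensates_def)
  ultimately show ?thesis using simI[of D E c "c * pair g E * weil g s" g 1] assms
    by (simp add: principal_one pair_nonzero Div0_Div Div_add principal_Div weil_nonzero mult.assoc)
qed

lemma ident_change_E:
  assumes "D \<in> Div0 \<iota>" "E \<in> Div0 \<iota>" "f \<noteq> 0" "c \<noteq> 0"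
  shows "ident \<iota> (trp D (E + pr f) c) (trp D E (c * pair f D))"
proof -
  have "(D, E + pr f, coord D (E + pr f) c) \<in> triples \<iota>"
    unfolding triples_iff trp_def using assms principal_Div0 Div0_add by blast
  from ident.change_E[OF this assms(2,3)] show ?thesis
    unfolding trp_def norm_map_coord[OF Div0_Div[OF assms(1)] assms(3)] .
qed

text \<open>The norm of s has coordinate \<open>pair s (D + pr g)\<close> before and
  \<open>pair s D\<close> after the change, and g evaluated on E + (s) is
  \<open>pair g E * pair g (pr s)\<close>. Together they give the factor
  \<open>pair g E * weil g s\<close>, from which \<open>twist\<close> is modelled.\<close>

lemma change_D_coord:
  assumes D: "D \<in> Div0 \<iota>" and E: "E \<in> Div0 \<iota>" and g: "g \<noteq> 0" and s: "s \<noteq> 0"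
    and dD: "disjoint_div (section_div \<iota> (\<O> E) s) D"
    and dg: "disjoint_div (section_div \<iota> (\<O> E) s) (pr g)"
  shows "(D + pr g, E, \<lambda>v. c * norm_section \<iota> (D + pr g) (\<O> E) s v) =
      trp (D + pr g) E (c * pair s (D + pr g))"
    and "(D, E, \<lambda>v. c * eval_div \<iota> g (section_div \<iota> (\<O> E) s) * norm_section \<iota> D (\<O> E) s v) =
      trp D E ((c * pair s (D + pr g)) * pair g E * weil g s)"
    and "compensates g E s"
proof -
  have Dv: "D \<in> Div \<iota>" "E \<in> Div \<iota>" "pr g \<in> Div \<iota>" "pr s \<in> Div \<iota>"
    using D E g s by (auto simp: Div0_Div principal_Div)
  have ordD: "ord_at P s = - E P" if "P \<in> Supp D \<union> Supp (pr g)" for P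
  proof -
    have "(E + pr s) P = 0"
      using dD dg that section_div_O[OF Dv(2) s] by (auto simp: disjoint_div_iff)
    moreover have "closed_point \<iota> P" using that Supp_closed Dv by blast
    ultimately show ?thesis by (simp add: principal_def)
  qed
  show "compensates g E s" using s ordD by (simp add: compensates_def)
  have "norm_section \<iota> (D + pr g) (\<O> E) s = coord (D + pr g) E (pair s (D + pr g))"
    using Supp_add[of D "pr g"] ordD by (intro norm_section_coord Div_add Dv s) blast
  then show "(D + pr g, E, \<lambda>v. c * norm_section \<iota> (D + pr g) (\<O> E) s v) =
      trp (D + pr g) E (c * pair s (D + pr g))"
    by (simp add: trp_def coord_scale)
  have 1: "norm_section \<iota> D (\<O> E) s = coord D E (pair s D)"
    using ordD by (intro norm_section_coord Dv s) blast
  have 2: "eval_div \<iota> g (section_div \<iota> (\<O> E) s) = pair g E * pair g (pr s)"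
    using dg g Dv unfolding section_div_O[OF Dv(2) s]
    by (simp add: eval_div_eq_pair Div_add disjoint_div_sym pair_add)
  have "c * (pair g E * pair g (pr s)) * pair s D = c * pair s (D + pr g) * pair g E * weil g s"
    using s g Dv by (simp add: pair_add weil_def pair_nonzero)
  then show "(D, E, \<lambda>v. c * eval_div \<iota> g (section_div \<iota> (\<O> E) s) * norm_section \<iota> D (\<O> E) s v) =
      trp D E ((c * pair s (D + pr g)) * pair g E * weil g s)"
    unfolding 1 2 trp_def coord_scale by (simp only:)
qed

lemma ident_change_D:
  assumes D: "D \<in> Div0 \<iota>" and E: "E \<in> Div0 \<iota>" and g: "g \<noteq> 0" and c: "c \<noteq> 0" and s: "s \<noteq> 0"
    and ord: "\<And>P. P \<in> Supp D \<union> Supp (pr g) \<Longrightarrow> ord_at P s = - E P"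
  shows "ident \<iota> (trp (D + pr g) E c) (trp D E (c * pair g E * weil g s))"
proof -
  have Dv: "D \<in> Div \<iota>" "E \<in> Div \<iota>" "pr g \<in> Div \<iota>" "pr s \<in> Div \<iota>"
    using D E g s by (auto simp: Div0_Div principal_Div)
  have nz: "pair s (D + pr g) \<noteq> 0" using Dv s by (simp add: pair_nonzero Div_add)
  have "(E + pr s) P = 0" if "P \<in> Supp D \<union> Supp (pr g)" for P
  proof -
    have "closed_point \<iota> P" using that Supp_closed Dv by blast
    with ord[OF that] show ?thesis by (simp add: principal_def)
  qed
  then have dis: "disjoint_div (section_div \<iota> (\<O> E) s) D"
    "disjoint_div (section_div \<iota> (\<O> E) s) (pr g)"
    unfolding section_div_O[OF Dv(2) s] by (auto simp: disjoint_div_iff)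
  \<comment> \<open>\<open>change_D\<close> moves multiples of the norm of s; this is the multiple
    with coordinate c.\<close>
  define b where "b = c / pair s (D + pr g)"
  have b: "b \<noteq> 0" "b * pair s (D + pr g) = c" using nz c by (simp_all add: b_def)
  show ?thesis
    using ident.change_D[OF D Div0_add[OF D principal_Div0[OF g]] E g s b(1) dis]
    unfolding change_D_coord(1,2)[OF D E g s dis] b(2) .
qed

lemma ident_sim:
  assumes "ident \<iota> t t'"
  shows "\<exists>D E c D' E' c'. t = trp D E c \<and> t' = trp D' E' c' \<and> sim D E c D' E' c'"
  using assms
proof cases
  case (change_E D E f \<phi>)
  then obtain c where c: "\<phi> = coord D (E + pr f) c" "c \<noteq> 0" and D: "D \<in> Div0 \<iota>"
    unfolding triples_iff trp_def by auto
  have "t = trp D (E + pr f) c" "t' = trp D E (c * pair f D)"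
    using change_E(1,2) c(1) norm_map_coord[OF Div0_Div[OF D] change_E(5)] by (simp_all add: trp_def)
  then show ?thesis using sim_change_E[OF D change_E(4,5) c(2)] by blast
next
  case (change_D D f E s c)
  note co = change_D_coord[OF change_D(3,5,6,7,9,10)]
  have "pair s (D + pr f) \<noteq> 0"
    using change_D by (intro pair_nonzero) (auto simp: Div0_Div)
  then have "c * pair s (D + pr f) \<noteq> 0" using change_D by simp
  from sim_change_D[OF change_D(3,5,6) this co(3)] show ?thesis
    unfolding change_D(1,2) co(1,2) by blast
qed

lemma sim_valid:
  assumes "sim D1 E1 c1 D E c"
  shows "D1 \<in> Div0 \<iota>" "E1 \<in> Div0 \<iota>" "c1 \<noteq> 0" "D \<in> Div0 \<iota>" "E \<in> Div0 \<iota>" "c \<noteq> 0"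
  using assms unfolding sim_def by auto

lemma equivclp_ident_sim:
  assumes "equivclp (ident \<iota>) (trp D E c) t" "D \<in> Div0 \<iota>" "E \<in> Div0 \<iota>" "c \<noteq> 0"
  shows "\<exists>D' E' c'. t = trp D' E' c' \<and> sim D E c D' E' c'"
  using assms(1)
proof (induction rule: equivclp_induct)
  case base
  then show ?case using sim_refl assms(2-4) by blast
next
  case (step y z)
  then obtain D1 E1 c1 where y: "y = trp D1 E1 c1" "sim D E c D1 E1 c1" by blast
  have D1: "D1 \<in> Div \<iota>" using sim_valid[OF y(2)] by (simp add: Div0_Div)
  from step(2) show ?case
  proof
    assume "ident \<iota> y z"
    then obtain D2 E2 c2 D3 E3 c3 where *: "y = trp D2 E2 c2" "z = trp D3 E3 c3"
      "sim D2 E2 c2 D3 E3 c3" using ident_sim by blast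
    then have "trp D1 E1 c1 = trp D2 E2 c2" using y(1) by simp
    note eq = trp_inject[OF D1 this]
    show ?thesis using sim_trans[OF y(2) *(3)[unfolded eq]] *(2) by blast
  next
    assume "ident \<iota> z y"
    then obtain D2 E2 c2 D3 E3 c3 where *: "z = trp D2 E2 c2" "y = trp D3 E3 c3"
      "sim D2 E2 c2 D3 E3 c3" using ident_sim by blast
    then have "trp D1 E1 c1 = trp D3 E3 c3" using y(1) by simp
    note eq = trp_inject[OF D1 this]
    show ?thesis using sim_trans[OF y(2) sim_sym[OF *(3)[unfolded eq]]] *(1) by blast
  qed
qed

lemma ex_section:
  assumes "A \<in> Div \<iota>" "B \<in> Div \<iota>"
  obtains s where "s \<noteq> 0" "\<And>P. P \<in> Supp A \<union> Supp B \<Longrightarrow> ord_at P s = - E P"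
proof -
  have "finite (Supp A \<union> Supp B)" "\<And>P. P \<in> Supp A \<union> Supp B \<Longrightarrow> closed_point \<iota> P"
    using assms by (auto simp: Div_def)
  from approximation[OF this, of "\<lambda>P. - E P"] that show thesis by blast
qed

text \<open>
  Two sections \<open>s\<close> and \<open>s h\<close> used in the same change of \<open>D\<close> give identifications that differ by
  \<open>weil g h\<close>; for this \<open>D\<close> is first moved away from \<open>h\<close>.
\<close>

lemma equivclp_weil:
  assumes D: "D \<in> Div0 \<iota>" and E: "E \<in> Div0 \<iota>" and c: "c \<noteq> 0"
    and g: "g \<noteq> 0" and h: "h \<noteq> 0" and gh: "disjoint_div (pr g) (pr h)"
  shows "equivclp (ident \<iota>) (trp D E c) (trp D E (c * weil g h))"
proof -
  obtain u where u: "u \<noteq> 0" "\<And>P. P \<in> Supp (pr h) \<union> Supp (pr h) \<Longrightarrow> ord_at P u = - D P"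
    using ex_section[of "pr h" "pr h" D] h principal_Div by metis
  define D2 where "D2 = D + pr u"
  have D2: "D2 \<in> Div0 \<iota>" "D = D2 + pr (inverse u)"
    using D u(1) by (simp_all add: D2_def Div0_add principal_Div0 principal_inverse)
  have D2h: "disjoint_div D2 (pr h)"
    unfolding disjoint_div_iff
  proof
    fix P assume "P \<in> Supp (pr h)"
    with u(2)[of P] Supp_closed[OF principal_Div[OF h]] show "D2 P = 0"
      by (simp add: D2_def principal_def)
  qed
  have iu: "inverse u \<noteq> 0" using u(1) by simp
  obtain s2 where s2: "s2 \<noteq> 0" "\<And>P. P \<in> Supp D2 \<union> Supp (pr (inverse u)) \<Longrightarrow> ord_at P s2 = - E P"
    using ex_section[of D2 "pr (inverse u)" E] D2(1) principal_Div[OF iu] Div0_Div by metis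
  \<comment> \<open>The cost of moving from D to \<open>D2\<close>. It is paid on the way there,
    recovered on the way back, and so cancels.\<close>
  define k where "k = pair (inverse u) E * weil (inverse u) s2"
  have k: "k \<noteq> 0" using iu s2(1) E by (simp add: k_def pair_nonzero weil_nonzero Div0_Div)
  have move: "ident \<iota> (trp D E b) (trp D2 E (b * k))" if "b \<noteq> 0" for b
    using ident_change_D[OF D2(1) E iu that s2] by (simp add: k_def mult.assoc flip: D2(2))
  obtain s where s: "s \<noteq> 0" "\<And>P. P \<in> Supp D2 \<union> Supp (pr g) \<Longrightarrow> ord_at P s = - E P"
    using ex_section[of D2 "pr g" E] D2(1) principal_Div[OF g] Div0_Div by metis
  have sh: "s * h \<noteq> 0" "ord_at P (s * h) = - E P" if P: "P \<in> Supp D2 \<union> Supp (pr g)" for P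
  proof -
    show "s * h \<noteq> 0" using s h by simp
    have cl: "closed_point \<iota> P"
      using P Supp_closed principal_Div[OF g] Div0_Div[OF D2(1)] by blast
    have "pr h P = 0"
      using P gh D2h disjoint_div_sym[of "pr h"] by (auto simp: disjoint_div_iff)
    then show "ord_at P (s * h) = - E P"
      using s h P cl by (simp add: closed_pt.ord_mult[OF point_val] principal_def)
  qed
  \<comment> \<open>Over \<open>D2 + pr g\<close> this coordinate is sent to \<open>c * k\<close> by
    the section s and to \<open>c * k * weil g h\<close> by the section s h, which links the
    two.\<close>
  define b where "b = c * k / (pair g E * weil g s)"
  have nz: "pair g E * weil g s \<noteq> 0" using g s E by (simp add: pair_nonzero weil_nonzero Div0_Div)
  then have b: "b \<noteq> 0" "b * pair g E * weil g s = c * k"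
    using c k by (simp_all add: b_def)
  have "ident \<iota> (trp (D2 + pr g) E b) (trp D2 E (b * pair g E * weil g s))"
    by (rule ident_change_D[OF D2(1) E g b(1) s])
  then have 1: "ident \<iota> (trp (D2 + pr g) E b) (trp D2 E (c * k))" by (simp only: b(2))
  have "s * h \<noteq> 0" using s h by simp
  from ident_change_D[OF D2(1) E g b(1) this sh(2)]
  have "ident \<iota> (trp (D2 + pr g) E b) (trp D2 E (b * pair g E * (weil g s * weil g h)))"
    using s h g by (simp add: weil_mult_right)
  moreover have "b * pair g E * (weil g s * weil g h) = c * weil g h * k"
  proof -
    have "b * pair g E * (weil g s * weil g h) = (b * pair g E * weil g s) * weil g h"
      by (simp only: mult.assoc)
    also have "\<dots> = c * weil g h * k" unfolding b(2) by (simp only: mult_ac)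
    finally show ?thesis .
  qed
  ultimately have 2: "ident \<iota> (trp (D2 + pr g) E b) (trp D2 E (c * weil g h * k))" by simp
  have w: "c * weil g h \<noteq> 0" using c g h by (simp add: weil_nonzero)
  have "equivclp (ident \<iota>) (trp D E c) (trp D2 E (c * k))"
    using move[OF c] by blast
  also have "equivclp (ident \<iota>) (trp D2 E (c * k)) (trp (D2 + pr g) E b)"
    using 1 by (meson equivclp_sym r_into_equivclp)
  also have "equivclp (ident \<iota>) (trp (D2 + pr g) E b) (trp D2 E (c * weil g h * k))"
    using 2 by blast
  also have "equivclp (ident \<iota>) (trp D2 E (c * weil g h * k)) (trp D E (c * weil g h))"
    using move[OF w] by (meson equivclp_sym r_into_equivclp)
  finally show ?thesis .
qed

lemma equivclp_weil_group:
  assumes "\<chi> \<in> weil_group" "D \<in> Div0 \<iota>" "E \<in> Div0 \<iota>" "c \<noteq> 0"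
  shows "equivclp (ident \<iota>) (trp D E c) (trp D E (c * \<chi>))"
  using assms(1)
proof induction
  case (mult_weil \<chi> g h)
  have "c * \<chi> \<noteq> 0" using mult_weil(1) assms(4) weil_group_nonzero by auto
  from equivclp_weil[OF assms(2,3) this mult_weil(2-4)] mult_weil.IH show ?case
    using equivclp_trans by (fastforce simp: mult.assoc)
qed simp

text \<open>The two moves behind \<open>sim\<close> are carried out with a concrete section s, and
  the remaining discrepancy lies in the Weil group, where \<open>equivclp_weil_group\<close> absorbs
  it. Together with \<open>equivclp_ident_sim\<close> this makes \<open>sim\<close> an exact
  description of the classes.\<close>

lemma sim_equivclp:
  assumes "sim D1 E1 c1 D E c"
  shows "equivclp (ident \<iota>) (trp D1 E1 c1) (trp D E c)"
proof -
  from assms obtain g f where 1: "g \<noteq> 0" "f \<noteq> 0" "D1 = D + pr g" "E1 = E + pr f"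
    "c \<approx> c1 * pair f D1 * twist g E" and 2: "D1 \<in> Div0 \<iota>" "E1 \<in> Div0 \<iota>" "c1 \<noteq> 0"
    "D \<in> Div0 \<iota>" "E \<in> Div0 \<iota>" "c \<noteq> 0" unfolding sim_def by blast
  define c2 where "c2 = c1 * pair f D1"
  have c2: "c2 \<noteq> 0" using 1 2 by (simp add: c2_def pair_nonzero Div0_Div)
  obtain s where s: "s \<noteq> 0" "\<And>P. P \<in> Supp D \<union> Supp (pr g) \<Longrightarrow> ord_at P s = - E P"
    using ex_section[of D "pr g" E] 2 principal_Div[OF 1(1)] Div0_Div by metis
  define c3 where "c3 = c2 * pair g E * weil g s"
  have c3: "c3 \<noteq> 0" using c2 s 1 2 by (simp add: c3_def pair_nonzero weil_nonzero Div0_Div)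
  have "compensates g E s" using s by (simp add: compensates_def)
  have "c \<approx> c2 * twist g E" using 1(5) by (simp add: c2_def)
  also have "\<dots> \<approx> c2 * (pair g E * weil g s)"
    by (intro wcong_mult wcong_refl twist_eq 1 \<open>compensates g E s\<close>)
  finally obtain \<chi> where \<chi>: "\<chi> \<in> weil_group" "c = c3 * \<chi>"
    unfolding wcong_def c3_def by (auto simp: mult.assoc)
  have "equivclp (ident \<iota>) (trp D1 E1 c1) (trp D1 E c2)"
    unfolding 1(4) c2_def using ident_change_E[OF 2(1,5) 1(2) 2(3)] by blast
  also have "equivclp (ident \<iota>) (trp D1 E c2) (trp D E c3)"
    unfolding 1(3) c3_def using ident_change_D[OF 2(4,5) 1(1) c2 s] by blast
  also have "equivclp (ident \<iota>) (trp D E c3) (trp D E c)"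
    unfolding \<chi>(2) by (rule equivclp_weil_group[OF \<chi>(1) 2(4,5) c3])
  finally show ?thesis .
qed

end

section \<open>Products in commutative groups\<close>

text \<open>The common setting of both partial laws in which scalars come out of powers and
  products.\<close>

locale scaled_comm_group = comm_group G for G (structure) +
  fixes sc :: "'k::field \<Rightarrow> 'a \<Rightarrow> 'a"
  assumes sc_closed: "a \<in> carrier G \<Longrightarrow> k \<noteq> 0 \<Longrightarrow> sc k a \<in> carrier G"
    and sc_mult: "a \<in> carrier G \<Longrightarrow> b \<in> carrier G \<Longrightarrow> k \<noteq> 0 \<Longrightarrow> l \<noteq> 0 \<Longrightarrow>
      sc k a \<otimes> sc l b = sc (k * l) (a \<otimes> b)"
    and sc_one: "a \<in> carrier G \<Longrightarrow> sc 1 a = a"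
begin

lemma sc_nat_pow:
  assumes "a \<in> carrier G" "k \<noteq> 0"
  shows "sc k a [^] (n::nat) = sc (k ^ n) (a [^] n)"
  by (induction n) (use assms in \<open>simp_all add: sc_mult sc_one mult.commute\<close>)

lemma sc_inv:
  assumes "a \<in> carrier G" "k \<noteq> 0"
  shows "inv (sc k a) = sc (inverse k) (inv a)"
  by (rule inv_equality) (use assms in \<open>simp_all add: sc_mult sc_one sc_closed\<close>)

lemma sc_int_pow:
  assumes "a \<in> carrier G" "k \<noteq> 0"
  shows "sc k a [^] (n::int) = sc (k powi n) (a [^] n)"
proof (cases "n < 0")
  case True
  have pow: "b [^] n = inv (b [^] nat (- n))" for b
    unfolding int_pow_def2 using True by (simp only: if_True)
  have "k powi n = inverse (k ^ nat (- n))"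
    using True by (simp add: power_int_def power_inverse)
  moreover have "sc k a [^] n = sc (inverse (k ^ nat (- n))) (inv (a [^] nat (- n)))"
    unfolding pow sc_nat_pow[OF assms]
    by (rule sc_inv[OF nat_pow_closed[OF assms(1)] power_not_zero[OF assms(2)]])
  ultimately show ?thesis unfolding pow by (simp only:)
next
  case False
  have pow: "b [^] n = b [^] nat n" for b
    unfolding int_pow_def2 using False by (simp only: if_False)
  have "k powi n = k ^ nat n" using False by (simp add: power_int_def)
  then show ?thesis unfolding pow sc_nat_pow[OF assms] by (simp only:)
qed

lemma sc_finprod:
  assumes "finite A" "\<And>i. i \<in> A \<Longrightarrow> f i \<in> carrier G" "\<And>i. i \<in> A \<Longrightarrow> k i \<noteq> 0"
  shows "finprod G (\<lambda>i. sc (k i) (f i)) A = sc (\<Prod>i\<in>A. k i) (finprod G f A)"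
  using assms
proof (induction A rule: finite_induct)
  case (insert i A)
  have f: "f \<in> A \<rightarrow> carrier G" "f i \<in> carrier G" using insert.prems by auto
  have g: "(\<lambda>i. sc (k i) (f i)) \<in> A \<rightarrow> carrier G" "sc (k i) (f i) \<in> carrier G"
    using insert.prems by (auto intro: sc_closed)
  have "(\<Prod>i\<in>A. k i) \<noteq> 0" "k i \<noteq> 0" using insert.prems insert.hyps by auto
  with insert f g show ?case by (simp add: finprod_insert sc_mult finprod_closed)
qed (simp add: sc_one)

end

text \<open>R is a subgroup of the product of G and H. With the incidence of points and fibres as R,
  it tells in which fibre a combination of points lies.\<close>

locale group_relation = G: comm_group G + H: comm_group H
  for G :: "('a, 'c) monoid_scheme" and H :: "('b, 'd) monoid_scheme" +
  fixes R :: "'a \<Rightarrow> 'b \<Rightarrow> bool"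
  assumes rel_carrier: "R a b \<Longrightarrow> a \<in> carrier G \<and> b \<in> carrier H"
    and rel_one: "R \<one>\<^bsub>G\<^esub> \<one>\<^bsub>H\<^esub>"
    and rel_mult: "R a b \<Longrightarrow> R a' b' \<Longrightarrow> R (a \<otimes>\<^bsub>G\<^esub> a') (b \<otimes>\<^bsub>H\<^esub> b')"
    and rel_inv: "R a b \<Longrightarrow> R (inv\<^bsub>G\<^esub> a) (inv\<^bsub>H\<^esub> b)"
begin

lemma rel_nat_pow: "R a b \<Longrightarrow> R (a [^]\<^bsub>G\<^esub> (n::nat)) (b [^]\<^bsub>H\<^esub> n)"
  by (induction n) (simp_all add: rel_one rel_mult)

lemma rel_int_pow: "R a b \<Longrightarrow> R (a [^]\<^bsub>G\<^esub> (n::int)) (b [^]\<^bsub>H\<^esub> n)"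
  unfolding int_pow_def2
  by (cases "n < 0") (simp_all only: if_True if_False rel_nat_pow rel_inv)

lemma rel_finprod:
  assumes "finite A" "\<And>i. i \<in> A \<Longrightarrow> R (f i) (g i)"
  shows "R (finprod G f A) (finprod H g A)"
  using assms
proof (induction A rule: finite_induct)
  case (insert i A)
  have "f \<in> A \<rightarrow> carrier G" "f i \<in> carrier G" "g \<in> A \<rightarrow> carrier H" "g i \<in> carrier H"
    using insert.prems rel_carrier by auto
  with insert show ?case by (simp add: rel_mult)
qed (simp add: rel_one)

end

section \<open>The partial group laws\<close>

context degree_zero_curve
begin

lemma sim_scale:
  assumes "sim D E c D' E' c'" "k \<noteq> 0"
  shows "sim D E (k * c) D' E' (k * c')"
proof -
  from assms(1) obtain g f where 1: "g \<noteq> 0" "f \<noteq> 0" "D = D' + pr g" "E = E' + pr f"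
    "c' \<approx> c * pair f D * twist g E'" unfolding sim_def by blast
  note 2 = sim_valid[OF assms(1)]
  have "k * c' \<approx> k * (c * pair f D * twist g E')" by (intro wcong_mult wcong_refl 1)
  then have c: "k * c' \<approx> k * c * pair f D * twist g E'" by (simp add: mult.assoc)
  have "k * c \<noteq> 0" "k * c' \<noteq> 0" using 2 assms(2) by auto
  from simI[OF 2(4,5) this 1(1,2) c[unfolded 1(3)]] show ?thesis by (simp only: 1(3,4))
qed

text \<open>Both factors pass from the same \<open>E\<close> to the same \<open>E1\<close>, so f and
  f' have equal divisors and differ by a constant. This constant has value 1 on D', which has degree
  zero, so one f serves both.\<close>

lemma sim_tensor1:
  assumes "sim D E c D1 E1 c1" "sim D' E c' D1' E1 c1'"
  shows "sim (D + D') E (c * c') (D1 + D1') E1 (c1 * c1')"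
proof -
  from assms(1) obtain g f where 1: "g \<noteq> 0" "f \<noteq> 0" "D = D1 + pr g" "E = E1 + pr f"
    "c1 \<approx> c * pair f D * twist g E1" unfolding sim_def by blast
  from assms(2) obtain g' f' where 2: "g' \<noteq> 0" "f' \<noteq> 0" "D' = D1' + pr g'" "E = E1 + pr f'"
    "c1' \<approx> c' * pair f' D' * twist g' E1" unfolding sim_def by blast
  note v = sim_valid[OF assms(1)] and v' = sim_valid[OF assms(2)]
  have "pr f' = pr f" using 1(4) 2(4) by simp
  then obtain k where k: "k \<noteq> 0" "f' = \<iota> k * f" by (rule principal_eq_const[OF 2(2) 1(2)])
  have f': "pair f' D' = pair f D'"
    using k v' 1(2) by (simp add: pair_mult pair_const Div0_Div)
  have "c1 * c1' \<approx> (c * pair f D * twist g E1) * (c' * pair f' D' * twist g' E1)"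
    by (intro wcong_mult 1 2)
  also have "\<dots> = (c * c') * pair f (D + D') * (twist g E1 * twist g' E1)"
    using v v' 1(2) by (simp add: f' pair_add Div0_Div)
  also have "\<dots> \<approx> (c * c') * pair f (D + D') * twist (g * g') E1"
    by (intro wcong_mult wcong_refl wcong_sym[OF twist_mult] 1 2 Div0_Div v)
  finally have c: "c1 * c1' \<approx> (c * c') * pair f (D + D') * twist (g * g') E1" .
  have DD: "D + D' = (D1 + D1') + pr (g * g')"
    using 1 2 by (simp add: principal_mult ac_simps)
  have "c * c' \<noteq> 0" "c1 * c1' \<noteq> 0" "g * g' \<noteq> 0" using v v' 1 2 by auto
  from simI[OF Div0_add[OF v(4) v'(4)] v(5) this 1(2) c[unfolded DD]] show ?thesis
    by (simp only: DD 1(4))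
qed

text \<open>Here g and g' have equal divisors and differ by a constant, whose twist over
  \<open>E1'\<close> is congruent to 1.\<close>

lemma sim_tensor2:
  assumes "sim D E c D1 E1 c1" "sim D E' c' D1 E1' c1'"
  shows "sim D (E + E') (c * c') D1 (E1 + E1') (c1 * c1')"
proof -
  from assms(1) obtain g f where 1: "g \<noteq> 0" "f \<noteq> 0" "D = D1 + pr g" "E = E1 + pr f"
    "c1 \<approx> c * pair f D * twist g E1" unfolding sim_def by blast
  from assms(2) obtain g' f' where 2: "g' \<noteq> 0" "f' \<noteq> 0" "D = D1 + pr g'" "E' = E1' + pr f'"
    "c1' \<approx> c' * pair f' D * twist g' E1'" unfolding sim_def by blast
  note v = sim_valid[OF assms(1)] and v' = sim_valid[OF assms(2)]
  have "pr g' = pr g" using 1(3) 2(3) by simp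
  then obtain k where k: "k \<noteq> 0" "g' = \<iota> k * g" by (rule principal_eq_const[OF 2(1) 1(1)])
  have "twist g' E1' \<approx> twist (\<iota> k) E1' * twist g E1'"
    unfolding k(2) using k 1 v' by (intro twist_mult) (auto simp: Div0_Div)
  also have "\<dots> \<approx> 1 * twist g E1'"
    by (intro wcong_mult wcong_refl twist_const k v')
  finally have g': "twist g' E1' \<approx> twist g E1'" by simp
  have "c1 * c1' \<approx> (c * pair f D * twist g E1) * (c' * pair f' D * twist g E1')"
    by (intro wcong_mult 1(5) wcong_trans[OF 2(5)] wcong_refl g')
  also have "\<dots> = (c * c') * pair (f * f') D * (twist g E1 * twist g E1')"
    using v 1(2) 2(2) by (simp add: pair_mult Div0_Div)
  also have "\<dots> \<approx> (c * c') * pair (f * f') D * twist g (E1 + E1')"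
    by (intro wcong_mult wcong_refl wcong_sym[OF twist_add] 1 Div0_Div v v')
  finally have c: "c1 * c1' \<approx> (c * c') * pair (f * f') D * twist g (E1 + E1')" .
  have EE: "E + E' = (E1 + E1') + pr (f * f')"
    using 1 2 by (simp add: principal_mult ac_simps)
  have "c * c' \<noteq> 0" "c1 * c1' \<noteq> 0" "f * f' \<noteq> 0" using v v' 1 2 by auto
  from simI[OF v(4) Div0_add[OF v(5) v'(5)] this(1,2) 1(1) this(3) c[unfolded 1(3)]] show ?thesis
    by (simp only: EE 1(3))
qed

section \<open>Points of the torsor and their products in coordinates\<close>

definition pt :: "'f divisor \<Rightarrow> 'f divisor \<Rightarrow> 'k \<Rightarrow> ('k, 'f) triple set" where
  "pt D E c = point_of \<iota> (trp D E c)"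

lemma mem_pt:
  assumes "D \<in> Div0 \<iota>" "E \<in> Div0 \<iota>" "c \<noteq> 0"
  shows "t \<in> pt D E c \<longleftrightarrow> (\<exists>D' E' c'. t = trp D' E' c' \<and> sim D E c D' E' c')"
  unfolding pt_def point_of_def using equivclp_ident_sim[OF _ assms] sim_equivclp by blast

lemma pt_eqI:
  assumes "sim D E c D' E' c'"
  shows "pt D E c = pt D' E' c'"
proof (rule Set.set_eqI)
  fix t
  note v = sim_valid[OF assms]
  show "t \<in> pt D E c \<longleftrightarrow> t \<in> pt D' E' c'"
    unfolding mem_pt[OF v(1-3)] mem_pt[OF v(4-6)]
    using sim_trans[OF assms] sim_trans[OF sim_sym[OF assms]] by blast
qed

lemma pt_mem_sim:
  assumes "trp D' E' c' \<in> pt D E c" "D \<in> Div0 \<iota>" "E \<in> Div0 \<iota>" "c \<noteq> 0"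
  shows "sim D E c D' E' c'"
proof -
  obtain D1 E1 c1 where *: "trp D' E' c' = trp D1 E1 c1" "sim D E c D1 E1 c1"
    using assms mem_pt by blast
  have "D1 \<in> Div \<iota>" using sim_valid[OF *(2)] by (simp add: Div0_Div)
  from trp_inject[OF this *(1)[symmetric]] *(2) show ?thesis by simp
qed

lemma pt_self: "D \<in> Div0 \<iota> \<Longrightarrow> E \<in> Div0 \<iota> \<Longrightarrow> c \<noteq> 0 \<Longrightarrow> trp D E c \<in> pt D E c"
  using mem_pt sim_refl by blast

lemma pt_eqD:
  assumes "pt D E c = pt D' E' c'" "D \<in> Div0 \<iota>" "E \<in> Div0 \<iota>" "c \<noteq> 0"
    "D' \<in> Div0 \<iota>" "E' \<in> Div0 \<iota>" "c' \<noteq> 0"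
  shows "sim D E c D' E' c'"
  using pt_mem_sim[OF _ assms(2-4)] pt_self[OF assms(5-7)] assms(1) by simp

text \<open>Scaling acts on representatives. The image of a class is a whole class, because scaling
  by 1/k undoes it.\<close>

lemma scale_point_pt:
  assumes v: "D \<in> Div0 \<iota>" "E \<in> Div0 \<iota>" "c \<noteq> 0" and k: "k \<noteq> 0"
  shows "scale_point k (pt D E c) = pt D E (k * c)"
proof -
  have kc: "k * c \<noteq> 0" using v k by simp
  have sc: "(\<lambda>(D, E, \<phi>). (D, E, \<lambda>v. k * \<phi> v)) (trp D' E' c') = trp D' E' (k * c')" for D' E' c'
    by (simp add: trp_def coord_scale)
  show ?thesis
  proof (intro equalityI subsetI)
    fix t assume "t \<in> scale_point k (pt D E c)"
    then obtain t' where t': "t' \<in> pt D E c" "t = (\<lambda>(D, E, \<phi>). (D, E, \<lambda>v. k * \<phi> v)) t'"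
      unfolding scale_point_def by (elim imageE)
    obtain D' E' c' where "t' = trp D' E' c'" "sim D E c D' E' c'"
      using t'(1) mem_pt[OF v] by blast
    then have "t = trp D' E' (k * c')" "sim D E c D' E' c'"
      by (simp_all only: t'(2) sc)
    then show "t \<in> pt D E (k * c)"
      using sim_scale[OF _ k] mem_pt[OF v(1,2) kc] by blast
  next
    fix t assume "t \<in> pt D E (k * c)"
    then obtain D' E' c' where t: "t = trp D' E' c'" "sim D E (k * c) D' E' c'"
      using mem_pt[OF v(1,2) kc] by blast
    have ik: "inverse k \<noteq> 0" using k by simp
    have "sim D E c D' E' (inverse k * c')"
      using sim_scale[OF t(2) ik] k by (simp flip: mult.assoc)
    then have "trp D' E' (inverse k * c') \<in> pt D E c" using mem_pt[OF v] by blast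
    then have "trp D' E' (k * (inverse k * c')) \<in> scale_point k (pt D E c)"
      unfolding scale_point_def sc[symmetric] by (rule imageI)
    moreover have "k * (inverse k * c') = c'" using k by (simp flip: mult.assoc)
    ultimately show "t \<in> scale_point k (pt D E c)" using t(1) by simp
  qed
qed

text \<open>Multiplicities of D and D' may cancel, so the law of exponents requires a nonzero base:
  a quotient of two frames is a unit and has nonzero norm.\<close>

lemma frame_norm_add:
  assumes D: "D \<in> Div \<iota>" "D' \<in> Div \<iota>" and v: "v \<in> frames \<iota> (\<O> E)" and w: "w \<in> frames \<iota> (\<O> E)"
  shows "frame_norm (D + D') w v = frame_norm D w v * frame_norm D' w v"
proof -
  define S where "S = Supp D \<union> Supp D'"
  have S: "finite S" "Supp D \<subseteq> S" "Supp D' \<subseteq> S" "Supp (D + D') \<subseteq> S"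
    using D Supp_add by (auto simp: S_def finite_Supp)
  have sup: "frame_norm A w v = (\<Prod>P\<in>S. residue_norm \<iota> P (w P / v P) powi A P)"
    if "Supp A \<subseteq> S" for A
    unfolding frame_norm_def
    by (rule prod.mono_neutral_left) (use S(1) that in \<open>auto simp: Supp_def\<close>)
  have "residue_norm \<iota> P (w P / v P) \<noteq> 0" if "P \<in> S" for P
  proof -
    have P: "closed_point \<iota> P" using that D Supp_closed unfolding S_def by blast
    interpret ff_point \<iota> P using P by (rule point)
    show ?thesis
      using frame_quotient_mem[OF P v w] frame_quotient_mem[OF P w v]
        frame_nonzero[OF v P] frame_nonzero[OF w P]
      by (intro residue_norm_nonzero) (simp add: unit_iff)
  qed
  then show ?thesis
    unfolding sup[OF S(2)] sup[OF S(3)] sup[OF S(4)]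
    by (simp add: power_int_add flip: prod.distrib)
qed

lemma norm_tensor1_coord:
  assumes "D \<in> Div \<iota>" "D' \<in> Div \<iota>"
  shows "norm_tensor1 (coord D E c) (coord D' E c') = coord (D + D') E (c * c')"
  by (auto simp: norm_tensor1_def coord_def frame_norm_add[OF assms _ std_frame])

lemma frames_mult:
  assumes v: "v \<in> frames \<iota> (\<O> E)" and w: "w \<in> frames \<iota> (\<O> E')"
  shows "(\<lambda>P. v P * w P) \<in> frames \<iota> (\<O> (E + E'))"
  unfolding frames_iff
proof (intro allI impI)
  fix P assume P: "closed_point \<iota> P"
  interpret closed_pt \<iota> P using P by (rule point_val)
  have "v P \<noteq> 0" "ord_at P (v P) = - E P" "w P \<noteq> 0" "ord_at P (w P) = - E' P"
    using v w P by (simp_all add: frames_iff)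
  then show "v P * w P \<noteq> 0 \<and> ord_at P (v P * w P) = - (E + E') P" by (simp add: ord_mult)
qed

text \<open>Standard frames are multiplicative in the divisor. So the defining condition, applied to
  the standard frames of E and E', fixes the coordinate of the product in the standard frame of E +
  E'.\<close>

lemma norm_tensor2_coord:
  assumes D: "D \<in> Div \<iota>"
  shows "norm_tensor2 \<iota> D E E' (coord D E c) (coord D E' c') = coord D (E + E') (c * c')"
  unfolding norm_tensor2_def
proof (rule the_equality)
  have std: "std_frame (E + E') = (\<lambda>P. std_frame E P * std_frame E' P)"
    by (rule ext) (rule std_frame_add)
  show "coord D (E + E') (c * c') \<in> norm_line \<iota> D (\<O> (E + E')) \<and>
      (\<forall>v\<in>frames \<iota> (\<O> E). \<forall>v'\<in>frames \<iota> (\<O> E'). coord D (E + E') (c * c') (\<lambda>P. v P * v' P) =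
        coord D E c v * coord D E' c' v')"
  proof (intro conjI ballI coord_mem[OF D])
    fix v v' assume v: "v \<in> frames \<iota> (\<O> E)" "v' \<in> frames \<iota> (\<O> E')"
    have "frame_norm D (std_frame (E + E')) (\<lambda>P. v P * v' P) =
        frame_norm D (std_frame E) v * frame_norm D (std_frame E') v'"
      unfolding std by (rule frame_norm_mult[OF D v(1) std_frame v(2) std_frame])
    then show "coord D (E + E') (c * c') (\<lambda>P. v P * v' P) = coord D E c v * coord D E' c' v'"
      using v frames_mult[OF v] by (simp add: coord_def)
  qed
  fix \<psi> assume \<psi>: "\<psi> \<in> norm_line \<iota> D (\<O> (E + E')) \<and>
      (\<forall>v\<in>frames \<iota> (\<O> E). \<forall>v'\<in>frames \<iota> (\<O> E'). \<psi> (\<lambda>P. v P * v' P) =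
        coord D E c v * coord D E' c' v')"
  then have "\<psi> (std_frame (E + E')) = coord D E c (std_frame E) * coord D E' c' (std_frame E')"
    unfolding std using std_frame by blast
  then have "\<psi> (std_frame (E + E')) = coord D (E + E') (c * c') (std_frame (E + E'))"
    by (simp add: coord_std[OF D])
  then show "\<psi> = coord D (E + E') (c * c')"
    by (rule norm_line_eqI[OF D conjunct1[OF \<psi>] coord_mem[OF D]])
qed

lemma triple_mem_pt:
  assumes "(D', E', \<phi>) \<in> pt D E c" "D \<in> Div0 \<iota>" "E \<in> Div0 \<iota>" "c \<noteq> 0"
  obtains c' where "\<phi> = coord D' E' c'" "sim D E c D' E' c'"
  using mem_pt[OF assms(2-4)] assms(1) by (auto simp: trp_def)

lemma tensor1_pt:
  assumes v: "D \<in> Div0 \<iota>" "D' \<in> Div0 \<iota>" "E \<in> Div0 \<iota>" "c \<noteq> 0" "c' \<noteq> 0"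
  shows "tensor1 \<iota> (pt D E c) (pt D' E c') = pt (D + D') E (c * c')"
  unfolding tensor1_def
proof (rule the_equality)
  have "pt (D + D') E (c * c') = point_of \<iota> (D + D', E, norm_tensor1 (coord D E c) (coord D' E c'))"
    using v by (simp add: pt_def trp_def norm_tensor1_coord Div0_Div)
  then show "\<exists>D1 D1' E1 \<phi> \<phi>'. (D1, E1, \<phi>) \<in> pt D E c \<and> (D1', E1, \<phi>') \<in> pt D' E c' \<and>
      pt (D + D') E (c * c') = point_of \<iota> (D1 + D1', E1, norm_tensor1 \<phi> \<phi>')"
    using pt_self[OF v(1,3,4)] pt_self[OF v(2,3,5)] unfolding trp_def by blast
next
  fix \<tau> assume "\<exists>D1 D1' E1 \<phi> \<phi>'. (D1, E1, \<phi>) \<in> pt D E c \<and> (D1', E1, \<phi>') \<in> pt D' E c' \<and>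
      \<tau> = point_of \<iota> (D1 + D1', E1, norm_tensor1 \<phi> \<phi>')"
  then obtain D1 D1' E1 \<phi> \<phi>' where *: "(D1, E1, \<phi>) \<in> pt D E c" "(D1', E1, \<phi>') \<in> pt D' E c'"
    "\<tau> = point_of \<iota> (D1 + D1', E1, norm_tensor1 \<phi> \<phi>')" by blast
  obtain c1 where c1: "\<phi> = coord D1 E1 c1" "sim D E c D1 E1 c1"
    using triple_mem_pt[OF *(1) v(1,3,4)] by blast
  obtain c1' where c1': "\<phi>' = coord D1' E1 c1'" "sim D' E c' D1' E1 c1'"
    using triple_mem_pt[OF *(2) v(2,3,5)] by blast
  have "\<tau> = pt (D1 + D1') E1 (c1 * c1')"
    using *(3) sim_valid(4)[OF c1(2)] sim_valid(4)[OF c1'(2)]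
    by (simp add: c1(1) c1'(1) pt_def trp_def norm_tensor1_coord Div0_Div)
  then show "\<tau> = pt (D + D') E (c * c')"
    using pt_eqI[OF sim_tensor1[OF c1(2) c1'(2)]] by simp
qed

lemma tensor2_pt:
  assumes v: "D \<in> Div0 \<iota>" "E \<in> Div0 \<iota>" "E' \<in> Div0 \<iota>" "c \<noteq> 0" "c' \<noteq> 0"
  shows "tensor2 \<iota> (pt D E c) (pt D E' c') = pt D (E + E') (c * c')"
  unfolding tensor2_def
proof (rule the_equality)
  have "pt D (E + E') (c * c') =
      point_of \<iota> (D, E + E', norm_tensor2 \<iota> D E E' (coord D E c) (coord D E' c'))"
    using v by (simp add: pt_def trp_def norm_tensor2_coord Div0_Div)
  then show "\<exists>D1 E1 E1' \<phi> \<phi>'. (D1, E1, \<phi>) \<in> pt D E c \<and> (D1, E1', \<phi>') \<in> pt D E' c' \<and>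
      pt D (E + E') (c * c') = point_of \<iota> (D1, E1 + E1', norm_tensor2 \<iota> D1 E1 E1' \<phi> \<phi>')"
    using pt_self[OF v(1,2,4)] pt_self[OF v(1,3,5)] unfolding trp_def by blast
next
  fix \<tau> assume "\<exists>D1 E1 E1' \<phi> \<phi>'. (D1, E1, \<phi>) \<in> pt D E c \<and> (D1, E1', \<phi>') \<in> pt D E' c' \<and>
      \<tau> = point_of \<iota> (D1, E1 + E1', norm_tensor2 \<iota> D1 E1 E1' \<phi> \<phi>')"
  then obtain D1 E1 E1' \<phi> \<phi>' where *: "(D1, E1, \<phi>) \<in> pt D E c" "(D1, E1', \<phi>') \<in> pt D E' c'"
    "\<tau> = point_of \<iota> (D1, E1 + E1', norm_tensor2 \<iota> D1 E1 E1' \<phi> \<phi>')" by blast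
  obtain c1 where c1: "\<phi> = coord D1 E1 c1" "sim D E c D1 E1 c1"
    using triple_mem_pt[OF *(1) v(1,2,4)] by blast
  obtain c1' where c1': "\<phi>' = coord D1 E1' c1'" "sim D E' c' D1 E1' c1'"
    using triple_mem_pt[OF *(2) v(1,3,5)] by blast
  have "\<tau> = pt D1 (E1 + E1') (c1 * c1')"
    using *(3) sim_valid(4)[OF c1(2)]
    by (simp add: c1(1) c1'(1) pt_def trp_def norm_tensor2_coord Div0_Div)
  then show "\<tau> = pt D (E + E') (c * c')"
    using pt_eqI[OF sim_tensor2[OF c1(2) c1'(2)]] by simp
qed

section \<open>Divisor classes, the Jacobian and the fibres\<close>

lemma mem_div_class: "B \<in> div_class \<iota> A \<longleftrightarrow> (\<exists>f. f \<noteq> 0 \<and> B = pr f + A)"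
  by (auto simp: div_class_def r_coset_def div_group_def principal_divs_def)

lemma div_class_eq_iff: "div_class \<iota> A = div_class \<iota> B \<longleftrightarrow> (\<exists>f. f \<noteq> 0 \<and> A = B + pr f)"
proof
  assume "div_class \<iota> A = div_class \<iota> B"
  moreover have "A \<in> div_class \<iota> A"
    unfolding mem_div_class by (intro exI[of _ 1]) (simp add: principal_one)
  ultimately show "\<exists>f. f \<noteq> 0 \<and> A = B + pr f" using mem_div_class by (auto simp: add.commute)
next
  assume "\<exists>f. f \<noteq> 0 \<and> A = B + pr f"
  then obtain f where f: "f \<noteq> 0" "A = B + pr f" by blast
  show "div_class \<iota> A = div_class \<iota> B"
  proof (intro Set.set_eqI iffI)
    fix C assume "C \<in> div_class \<iota> A"
    then obtain h where "h \<noteq> 0" "C = pr h + A" unfolding mem_div_class by blast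
    then show "C \<in> div_class \<iota> B" unfolding mem_div_class
      using f by (intro exI[of _ "h * f"]) (simp add: principal_mult ac_simps)
  next
    fix C assume "C \<in> div_class \<iota> B"
    then obtain h where "h \<noteq> 0" "C = pr h + B" unfolding mem_div_class by blast
    then show "C \<in> div_class \<iota> A" unfolding mem_div_class
      using f by (intro exI[of _ "h * inverse f"])
        (simp add: principal_mult principal_inverse ac_simps)
  qed
qed

lemma carrier_Jac: "carrier (Jac \<iota>) = div_class \<iota> ` Div0 \<iota>"
  by (simp add: Jac_def)

lemma mult_Jac: "div_class \<iota> A \<otimes>\<^bsub>Jac \<iota>\<^esub> div_class \<iota> B = div_class \<iota> (A + B)"
proof -
  have "div_class \<iota> A \<otimes>\<^bsub>Jac \<iota>\<^esub> div_class \<iota> B = {a + b | a b. a \<in> div_class \<iota> A \<and> b \<in> div_class \<iota> B}"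
    by (auto simp: Jac_def FactGroup_def set_mult_def div_group_def)
  also have "\<dots> = div_class \<iota> (A + B)"
  proof (intro Set.set_eqI iffI)
    fix C assume "C \<in> {a + b | a b. a \<in> div_class \<iota> A \<and> b \<in> div_class \<iota> B}"
    then obtain f g where "f \<noteq> 0" "g \<noteq> 0" "C = (pr f + A) + (pr g + B)"
      unfolding mem_div_class by blast
    then show "C \<in> div_class \<iota> (A + B)" unfolding mem_div_class
      by (intro exI[of _ "f * g"]) (simp add: principal_mult ac_simps)
  next
    fix C assume "C \<in> div_class \<iota> (A + B)"
    then obtain f where f: "f \<noteq> 0" "C = pr f + (A + B)" unfolding mem_div_class by blast
    have "pr f + A \<in> div_class \<iota> A" "pr 1 + B \<in> div_class \<iota> B"
      unfolding mem_div_class using f(1) one_neq_zero by blast+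
    moreover have "C = (pr f + A) + (pr 1 + B)" using f by (simp add: principal_one ac_simps)
    ultimately show "C \<in> {a + b | a b. a \<in> div_class \<iota> A \<and> b \<in> div_class \<iota> B}" by blast
  qed
  finally show ?thesis .
qed

lemma one_Jac: "\<one>\<^bsub>Jac \<iota>\<^esub> = div_class \<iota> 0"
  by (auto simp: Jac_def FactGroup_def mem_div_class principal_divs_def)

lemma comm_group_Jac: "comm_group (Jac \<iota>)"
proof (rule comm_groupI)
  fix x y z assume "x \<in> carrier (Jac \<iota>)" "y \<in> carrier (Jac \<iota>)" "z \<in> carrier (Jac \<iota>)"
  then show "x \<otimes>\<^bsub>Jac \<iota>\<^esub> y \<otimes>\<^bsub>Jac \<iota>\<^esub> z = x \<otimes>\<^bsub>Jac \<iota>\<^esub> (y \<otimes>\<^bsub>Jac \<iota>\<^esub> z)"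
    by (auto simp: carrier_Jac mult_Jac ac_simps)
next
  fix x assume "x \<in> carrier (Jac \<iota>)"
  then obtain A where A: "A \<in> Div0 \<iota>" "x = div_class \<iota> A" by (auto simp: carrier_Jac)
  show "\<exists>y\<in>carrier (Jac \<iota>). y \<otimes>\<^bsub>Jac \<iota>\<^esub> x = \<one>\<^bsub>Jac \<iota>\<^esub>"
  proof (rule bexI)
    show "div_class \<iota> (- A) \<otimes>\<^bsub>Jac \<iota>\<^esub> x = \<one>\<^bsub>Jac \<iota>\<^esub>"
      by (simp add: A(2) mult_Jac one_Jac)
    show "div_class \<iota> (- A) \<in> carrier (Jac \<iota>)"
      unfolding carrier_Jac by (rule imageI[OF Div0_uminus[OF A(1)]])
  qed
qed (auto simp: carrier_Jac mult_Jac one_Jac Div0_zero Div0_add add.commute)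

lemma inv_Jac: "A \<in> Div0 \<iota> \<Longrightarrow> inv\<^bsub>Jac \<iota>\<^esub> (div_class \<iota> A) = div_class \<iota> (- A)"
  using comm_group_Jac
  by (intro group.inv_equality) (auto simp: comm_group_def carrier_Jac mult_Jac one_Jac Div0_uminus)

lemma fibre_iff:
  "\<pi> \<in> fibre \<iota> x y \<longleftrightarrow> (\<exists>D E c. D \<in> Div0 \<iota> \<and> E \<in> Div0 \<iota> \<and> c \<noteq> 0 \<and> \<pi> = pt D E c \<and>
     div_class \<iota> D = x \<and> div_class \<iota> E = y)" (is "_ \<longleftrightarrow> ?R")
proof
  assume "\<pi> \<in> fibre \<iota> x y"
  then obtain D E \<phi> where *: "\<pi> = point_of \<iota> (D, E, \<phi>)" "(D, E, \<phi>) \<in> triples \<iota>"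
    "div_class \<iota> D = x" "div_class \<iota> E = y" unfolding fibre_def by blast
  from *(2) obtain c where "\<phi> = coord D E c" "D \<in> Div0 \<iota>" "E \<in> Div0 \<iota>" "c \<noteq> 0"
    unfolding triples_iff by (auto simp: trp_def)
  with * show ?R unfolding pt_def trp_def by blast
next
  assume ?R
  then obtain D E c where *: "D \<in> Div0 \<iota>" "E \<in> Div0 \<iota>" "c \<noteq> 0" "\<pi> = pt D E c"
    "div_class \<iota> D = x" "div_class \<iota> E = y" by blast
  then have "trp D E c \<in> triples \<iota>" unfolding triples_iff by blast
  with *(4-6) show "\<pi> \<in> fibre \<iota> x y" unfolding fibre_def pt_def trp_def by blast
qed

lemma pt_fibre: "D \<in> Div0 \<iota> \<Longrightarrow> E \<in> Div0 \<iota> \<Longrightarrow> c \<noteq> 0 \<Longrightarrow> pt D E c \<in> fibre \<iota> (div_class \<iota> D) (div_class \<iota> E)"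
  unfolding fibre_iff by blast

text \<open>Equivalent triples have linearly equivalent divisors, so a point lies in one fibre only.
  This allows classes in the Jacobian to be read off from equalities of points.\<close>

lemma pt_fibreD:
  assumes "pt D E c \<in> fibre \<iota> x y" "D \<in> Div0 \<iota>" "E \<in> Div0 \<iota>" "c \<noteq> 0"
  shows "div_class \<iota> D = x" "div_class \<iota> E = y"
proof -
  obtain D' E' c' where *: "D' \<in> Div0 \<iota>" "E' \<in> Div0 \<iota>" "c' \<noteq> 0" "pt D E c = pt D' E' c'"
    "div_class \<iota> D' = x" "div_class \<iota> E' = y" using assms(1) unfolding fibre_iff by blast
  from pt_eqD[OF *(4) assms(2-4) *(1-3)] obtain g f where
    "g \<noteq> 0" "f \<noteq> 0" "D = D' + pr g" "E = E' + pr f" unfolding sim_def by blast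
  then have "div_class \<iota> D = div_class \<iota> D'" "div_class \<iota> E = div_class \<iota> E'"
    unfolding div_class_eq_iff by blast+
  with *(5,6) show "div_class \<iota> D = x" "div_class \<iota> E = y" by simp_all
qed

text \<open>A change of E within its class only multiplies the coordinate. Hence a single E can
  represent every point of \<open>group1\<close>, which leaves D and a scalar as
  coordinates.\<close>

lemma fibre_change_E:
  assumes "\<pi> \<in> fibre \<iota> x (div_class \<iota> E)" "E \<in> Div0 \<iota>"
  obtains D c where "D \<in> Div0 \<iota>" "c \<noteq> 0" "\<pi> = pt D E c" "div_class \<iota> D = x"
proof -
  obtain D E' c where *: "D \<in> Div0 \<iota>" "E' \<in> Div0 \<iota>" "c \<noteq> 0" "\<pi> = pt D E' c"
    "div_class \<iota> D = x" "div_class \<iota> E' = div_class \<iota> E" using assms(1) unfolding fibre_iff by blast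
  then obtain f where f: "f \<noteq> 0" "E' = E + pr f" unfolding div_class_eq_iff by blast
  have "\<pi> = pt D E (c * pair f D)"
    unfolding *(4) f(2) by (rule pt_eqI[OF sim_change_E[OF *(1) assms(2) f(1) *(3)]])
  moreover have "c * pair f D \<noteq> 0" using * f by (simp add: pair_nonzero Div0_Div)
  ultimately show thesis using that * by blast
qed

lemma fibre_change_D:
  assumes "\<pi> \<in> fibre \<iota> (div_class \<iota> D) y" "D \<in> Div0 \<iota>"
  obtains E c where "E \<in> Div0 \<iota>" "c \<noteq> 0" "\<pi> = pt D E c" "div_class \<iota> E = y"
proof -
  obtain D' E c where *: "D' \<in> Div0 \<iota>" "E \<in> Div0 \<iota>" "c \<noteq> 0" "\<pi> = pt D' E c"
    "div_class \<iota> D' = div_class \<iota> D" "div_class \<iota> E = y" using assms(1) unfolding fibre_iff by blast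
  then obtain g where g: "g \<noteq> 0" "D' = D + pr g" unfolding div_class_eq_iff by blast
  obtain s where s: "compensates g E s" using ex_compensates[OF g(1)] by blast
  have "\<pi> = pt D E (c * pair g E * weil g s)"
    unfolding *(4) g(2) by (rule pt_eqI[OF sim_change_D[OF assms(2) *(2) g(1) *(3) s]])
  moreover have "c * pair g E * weil g s \<noteq> 0"
    using * g s by (simp add: pair_nonzero weil_nonzero Div0_Div compensates_def)
  ultimately show thesis using that * by blast
qed

lemma carrier_group1:
  assumes "E \<in> Div0 \<iota>"
  shows "carrier (group1 \<iota> (div_class \<iota> E)) = {pt D E c | D c. D \<in> Div0 \<iota> \<and> c \<noteq> 0}"
proof (intro equalityI subsetI)
  fix \<pi> assume "\<pi> \<in> carrier (group1 \<iota> (div_class \<iota> E))"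
  then obtain x where "\<pi> \<in> fibre \<iota> x (div_class \<iota> E)" by (auto simp: group1_def)
  then show "\<pi> \<in> {pt D E c | D c. D \<in> Div0 \<iota> \<and> c \<noteq> 0}"
    using fibre_change_E[OF _ assms] by blast
next
  fix \<pi> assume "\<pi> \<in> {pt D E c | D c. D \<in> Div0 \<iota> \<and> c \<noteq> 0}"
  then show "\<pi> \<in> carrier (group1 \<iota> (div_class \<iota> E))"
    using pt_fibre assms by (auto simp: group1_def carrier_Jac)
qed

lemma carrier_group2:
  assumes "D \<in> Div0 \<iota>"
  shows "carrier (group2 \<iota> (div_class \<iota> D)) = {pt D E c | E c. E \<in> Div0 \<iota> \<and> c \<noteq> 0}"
proof (intro equalityI subsetI)
  fix \<pi> assume "\<pi> \<in> carrier (group2 \<iota> (div_class \<iota> D))"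
  then obtain y where "\<pi> \<in> fibre \<iota> (div_class \<iota> D) y" by (auto simp: group2_def)
  then show "\<pi> \<in> {pt D E c | E c. E \<in> Div0 \<iota> \<and> c \<noteq> 0}"
    using fibre_change_D[OF _ assms] by blast
next
  fix \<pi> assume "\<pi> \<in> {pt D E c | E c. E \<in> Div0 \<iota> \<and> c \<noteq> 0}"
  then show "\<pi> \<in> carrier (group2 \<iota> (div_class \<iota> D))"
    using pt_fibre assms by (auto simp: group2_def carrier_Jac)
qed

lemma mult_group1 [simp]: "monoid.mult (group1 \<iota> y) = tensor1 \<iota>"
  and mult_group2 [simp]: "monoid.mult (group2 \<iota> x) = tensor2 \<iota>"
  by (simp_all add: group1_def group2_def)

text \<open>All representatives of the class give the same unit, because every function has value 1
  on the divisor 0.\<close>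

lemma one_group1:
  assumes E: "E \<in> Div0 \<iota>"
  shows "\<one>\<^bsub>group1 \<iota> (div_class \<iota> E)\<^esub> = pt 0 E 1"
proof -
  have pt0: "point_of \<iota> (0, E', \<lambda>v. if v \<in> frames \<iota> (\<O> E') then 1 else 0) = pt 0 E' 1" for E'
    unfolding pt_def trp_def coord_def frame_norm_def by (simp add: Supp_zero cong: if_cong)
  show ?thesis
    unfolding group1_def monoid.simps pt0
  proof (rule the_equality)
    fix \<tau> assume "\<exists>E'\<in>Div0 \<iota>. div_class \<iota> E' = div_class \<iota> E \<and> \<tau> = pt 0 E' 1"
    then obtain f where f: "f \<noteq> 0" "\<tau> = pt 0 (E + pr f) 1" unfolding div_class_eq_iff by blast
    then show "\<tau> = pt 0 E 1"
      using pt_eqI[OF sim_change_E[OF Div0_zero E f(1), of 1]] by simp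
  qed (use E in blast)
qed

text \<open>All representatives of the class give the same unit, because every twist over the
  divisor 0 is congruent to 1.\<close>

lemma one_group2:
  assumes D: "D \<in> Div0 \<iota>"
  shows "\<one>\<^bsub>group2 \<iota> (div_class \<iota> D)\<^esub> = pt D 0 1"
proof -
  have pt0: "point_of \<iota> (D', 0, norm_section \<iota> D' (\<O> 0) 1) = pt D' 0 1" if "D' \<in> Div0 \<iota>" for D'
  proof -
    have Dv: "D' \<in> Div \<iota>" using that by (rule Div0_Div)
    have "norm_section \<iota> D' (\<O> 0) 1 = coord D' 0 (pair 1 D')"
      by (rule norm_section_coord[OF Dv])
         (use Supp_closed[OF Dv] closed_pt.ord_one[OF point_val] in auto)
    then show ?thesis using Dv by (simp add: pt_def trp_def)
  qed
  show ?thesis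
    unfolding group2_def monoid.simps
  proof (rule the_equality)
    show "\<exists>D'\<in>Div0 \<iota>. div_class \<iota> D' = div_class \<iota> D \<and>
        pt D 0 1 = point_of \<iota> (D', 0, norm_section \<iota> D' (\<O> 0) 1)"
      using D pt0 by metis
    fix \<tau> assume "\<exists>D'\<in>Div0 \<iota>. div_class \<iota> D' = div_class \<iota> D \<and>
        \<tau> = point_of \<iota> (D', 0, norm_section \<iota> D' (\<O> 0) 1)"
    then obtain g where g: "g \<noteq> 0" "D + pr g \<in> Div0 \<iota>" "\<tau> = pt (D + pr g) 0 1"
      unfolding div_class_eq_iff using pt0 by blast
    have "1 * pair 1 (D + pr g) * 1 \<approx> 1 * pair 1 (D + pr g) * twist g 0"
      by (intro wcong_mult wcong_refl wcong_sym[OF twist_zero] g)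
    then have "sim (D + pr g) (0 + pr 1) 1 D 0 1"
      using g by (intro simI D Div0_zero) (simp_all add: Div0_Div)
    then show "\<tau> = pt D 0 1" using pt_eqI g(3) by (simp add: principal_one)
  qed
qed

end

text \<open>With one divisor fixed, both laws have the same form: the other divisor is added and the
  scalar is multiplied. The group axioms descend along \<open>p\<close> from pairs of a divisor of
  degree zero and a nonzero scalar.\<close>

locale partial_law = degree_zero_curve \<iota> for \<iota> :: "'k::field \<Rightarrow> 'f::field" +
  fixes G :: "('k, 'f) triple set monoid" (structure)
    and p :: "'f divisor \<Rightarrow> 'k \<Rightarrow> ('k, 'f) triple set"
  assumes carrier: "carrier G = {p A c | A c. A \<in> Div0 \<iota> \<and> c \<noteq> 0}"
    and mult: "A \<in> Div0 \<iota> \<Longrightarrow> B \<in> Div0 \<iota> \<Longrightarrow> c \<noteq> 0 \<Longrightarrow> d \<noteq> 0 \<Longrightarrow>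
      p A c \<otimes> p B d = p (A + B) (c * d)"
    and one: "\<one> = p 0 1"
    and scale: "A \<in> Div0 \<iota> \<Longrightarrow> c \<noteq> 0 \<Longrightarrow> k \<noteq> 0 \<Longrightarrow> scale_point k (p A c) = p A (k * c)"
begin

lemma mem_carrier: "A \<in> Div0 \<iota> \<Longrightarrow> c \<noteq> 0 \<Longrightarrow> p A c \<in> carrier G"
  unfolding carrier by blast

lemma carrierE:
  assumes "a \<in> carrier G"
  obtains A c where "a = p A c" "A \<in> Div0 \<iota>" "c \<noteq> 0"
  using assms unfolding carrier by blast

lemma left_inverse:
  "A \<in> Div0 \<iota> \<Longrightarrow> c \<noteq> 0 \<Longrightarrow> p (- A) (inverse c) \<otimes> p A c = \<one>"
  by (simp add: mult one Div0_uminus)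

lemma comm_group: "comm_group G"
proof (rule comm_groupI)
  show "\<one> \<in> carrier G" unfolding one by (simp add: mem_carrier Div0_zero)
next
  fix a assume "a \<in> carrier G"
  then obtain A c where a: "a = p A c" "A \<in> Div0 \<iota>" "c \<noteq> 0" by (rule carrierE)
  then show "\<one> \<otimes> a = a" by (simp add: one mult Div0_zero)
  show "\<exists>b\<in>carrier G. b \<otimes> a = \<one>"
    using a by (intro bexI[of _ "p (- A) (inverse c)"])
      (simp_all add: left_inverse mem_carrier Div0_uminus)
next
  fix a b assume "a \<in> carrier G" "b \<in> carrier G"
  then obtain A c B d where ab: "a = p A c" "A \<in> Div0 \<iota>" "c \<noteq> 0" "b = p B d" "B \<in> Div0 \<iota>" "d \<noteq> 0"
    by (elim carrierE)
  then show "a \<otimes> b \<in> carrier G" by (simp add: mult mem_carrier Div0_add)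
  from ab show "a \<otimes> b = b \<otimes> a" by (simp add: mult ac_simps)
next
  fix a b e assume "a \<in> carrier G" "b \<in> carrier G" "e \<in> carrier G"
  then obtain A c B d C k where "a = p A c" "A \<in> Div0 \<iota>" "c \<noteq> 0" "b = p B d" "B \<in> Div0 \<iota>" "d \<noteq> 0"
    "e = p C k" "C \<in> Div0 \<iota>" "k \<noteq> 0" by (elim carrierE)
  then show "a \<otimes> b \<otimes> e = a \<otimes> (b \<otimes> e)" by (simp add: mult Div0_add ac_simps)
qed

lemma scaled: "scaled_comm_group G scale_point"
proof -
  interpret comm_group G by (rule comm_group)
  show ?thesis
  proof
    fix a :: "('k, 'f) triple set" and k :: 'k
    assume "a \<in> carrier G" "k \<noteq> 0"
    then show "scale_point k a \<in> carrier G" by (elim carrierE) (simp add: scale mem_carrier)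
  next
    fix a b :: "('k, 'f) triple set" and k l :: 'k
    assume "a \<in> carrier G" "b \<in> carrier G" "k \<noteq> 0" "l \<noteq> 0"
    then show "scale_point k a \<otimes> scale_point l b = scale_point (k * l) (a \<otimes> b)"
      by (elim carrierE) (simp add: scale mult Div0_add mult_ac)
  next
    fix a assume "a \<in> carrier G"
    then show "scale_point 1 a = a" by (elim carrierE) (simp add: scale)
  qed
qed

lemma fibre_relation:
  "group_relation G (Jac \<iota>) (\<lambda>\<pi> x. \<exists>A c. A \<in> Div0 \<iota> \<and> c \<noteq> 0 \<and> \<pi> = p A c \<and> div_class \<iota> A = x)"
  (is "group_relation _ _ ?R")
proof -
  interpret comm_group G by (rule comm_group)
  interpret J: comm_group "Jac \<iota>" by (rule comm_group_Jac)
  have R: "?R (p A c) (div_class \<iota> A)" if "A \<in> Div0 \<iota>" "c \<noteq> 0" for A c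
    using that by blast
  show ?thesis
  proof
    fix \<pi> x assume "?R \<pi> x"
    then show "\<pi> \<in> carrier G \<and> x \<in> carrier (Jac \<iota>)" unfolding carrier carrier_Jac by blast
  next
    show "?R \<one> \<one>\<^bsub>Jac \<iota>\<^esub>" unfolding one one_Jac by (rule R) (simp_all add: Div0_zero)
  next
    fix \<pi> x \<pi>' x' assume "?R \<pi> x" "?R \<pi>' x'"
    then obtain A c B d where *: "A \<in> Div0 \<iota>" "c \<noteq> 0" "\<pi> = p A c" "div_class \<iota> A = x"
      "B \<in> Div0 \<iota>" "d \<noteq> 0" "\<pi>' = p B d" "div_class \<iota> B = x'" by blast
    then have "\<pi> \<otimes> \<pi>' = p (A + B) (c * d)" "x \<otimes>\<^bsub>Jac \<iota>\<^esub> x' = div_class \<iota> (A + B)"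
      by (auto simp: mult mult_Jac)
    then show "?R (\<pi> \<otimes> \<pi>') (x \<otimes>\<^bsub>Jac \<iota>\<^esub> x')"
      using R[of "A + B" "c * d"] * by (simp add: Div0_add)
  next
    fix \<pi> x assume "?R \<pi> x"
    then obtain A c where *: "A \<in> Div0 \<iota>" "c \<noteq> 0" "\<pi> = p A c" "div_class \<iota> A = x" by blast
    have "inv \<pi> = p (- A) (inverse c)"
      using * by (intro inv_equality) (simp_all add: left_inverse mem_carrier Div0_uminus)
    moreover have "inv\<^bsub>Jac \<iota>\<^esub> x = div_class \<iota> (- A)" using inv_Jac[OF *(1)] *(4) by simp
    ultimately show "?R (inv \<pi>) (inv\<^bsub>Jac \<iota>\<^esub> x)"
      using R[of "- A" "inverse c"] * by (simp add: Div0_uminus)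
  qed
qed

end

context degree_zero_curve
begin

lemma partial_law1:
  assumes E: "E \<in> Div0 \<iota>"
  shows "partial_law \<iota> (group1 \<iota> (div_class \<iota> E)) (\<lambda>D. pt D E)"
  by unfold_locales
    (use E in \<open>simp_all add: carrier_group1 one_group1 tensor1_pt scale_point_pt\<close>)

lemma partial_law2:
  assumes D: "D \<in> Div0 \<iota>"
  shows "partial_law \<iota> (group2 \<iota> (div_class \<iota> D)) (pt D)"
  by unfold_locales
    (use D in \<open>simp_all add: carrier_group2 one_group2 tensor2_pt scale_point_pt\<close>)

lemma fibre_relation1:
  assumes E: "E \<in> Div0 \<iota>"
  shows "group_relation (group1 \<iota> (div_class \<iota> E)) (Jac \<iota>) (\<lambda>\<pi> x. \<pi> \<in> fibre \<iota> x (div_class \<iota> E))"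
proof -
  have "\<pi> \<in> fibre \<iota> x (div_class \<iota> E) \<longleftrightarrow>
      (\<exists>D c. D \<in> Div0 \<iota> \<and> c \<noteq> 0 \<and> \<pi> = pt D E c \<and> div_class \<iota> D = x)" for \<pi> x
    using fibre_change_E[OF _ E, of \<pi> x] pt_fibre[OF _ E] by blast
  then show ?thesis using partial_law.fibre_relation[OF partial_law1[OF E]] by simp
qed

lemma fibre_relation2:
  assumes D: "D \<in> Div0 \<iota>"
  shows "group_relation (group2 \<iota> (div_class \<iota> D)) (Jac \<iota>) (\<lambda>\<pi> y. \<pi> \<in> fibre \<iota> (div_class \<iota> D) y)"
proof -
  have "\<pi> \<in> fibre \<iota> (div_class \<iota> D) y \<longleftrightarrow>
      (\<exists>E c. E \<in> Div0 \<iota> \<and> c \<noteq> 0 \<and> \<pi> = pt D E c \<and> div_class \<iota> E = y)" for \<pi> y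
    using fibre_change_D[OF _ D, of \<pi> y] pt_fibre[OF D] by blast
  then show ?thesis using partial_law.fibre_relation[OF partial_law2[OF D]] by simp
qed

text \<open>On the support of D the multiplicity of E is 0, which is the order of the section 1, so
  its norm has the coordinate \<open>pair 1 D\<close>, that is 1.\<close>

lemma div_point_pt:
  assumes "D \<in> Div0 \<iota>" "disjoint_div D E"
  shows "div_point \<iota> D E = pt D E 1"
proof -
  have Dv: "D \<in> Div \<iota>" using assms(1) by (rule Div0_Div)
  have "norm_section \<iota> D (\<O> E) 1 = coord D E (pair 1 D)"
  proof (rule norm_section_coord[OF Dv])
    fix P assume "P \<in> Supp D"
    then have "closed_point \<iota> P" "E P = 0"
      using Supp_closed[OF Dv] assms(2) disjoint_div_sym[of D] by (auto simp: disjoint_div_iff)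
    then show "ord_at P 1 = - E P" by (simp add: closed_pt.ord_one[OF point_val])
  qed simp
  then show ?thesis using Dv by (simp add: div_point_def pt_def trp_def)
qed

end

section \<open>Divisors of sections of a line bundle\<close>

lemma ratio_smul:
  assumes L: "is_line_bundle \<iota> L" and v: "v \<noteq> 0"
  shows "w = smul L (ratio L w v) v" "ratio L (smul L f w) v = f * ratio L w v"
proof -
  interpret vector_space "smul L" using L by (simp add: is_line_bundle_def)
  obtain b where b: "\<And>w. \<exists>c. w = smul L c b" using L unfolding is_line_bundle_def by blast
  obtain c0 where c0: "v = smul L c0 b" using b by blast
  then have nz: "c0 \<noteq> 0" using v by auto
  have ex: "\<exists>c. w = smul L c v" for w
  proof -
    obtain c where "w = smul L c b" using b by blast
    then have "w = smul L (c / c0) v" using nz by (simp add: c0)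
    then show ?thesis ..
  qed
  have ratio_eq: "ratio L w v = c" if "w = smul L c v" for w c
    unfolding ratio_def
  proof (rule the_equality)
    show "w = smul L c v" by (rule that)
  next
    fix d assume "w = smul L d v"
    from trans[OF this[symmetric] that] v show "d = c" by (simp only: scale_cancel_right simp_thms)
  qed
  show r: "w = smul L (ratio L w v) v"
  proof -
    obtain c where c: "w = smul L c v" using ex by blast
    show ?thesis unfolding ratio_eq[OF c] by (rule c)
  qed
  have "smul L f w = smul L f (smul L (ratio L w v) v)" by (rule arg_cong[OF r])
  also have "\<dots> = smul L (f * ratio L w v) v" by (rule scale_scale)
  finally show "ratio L (smul L f w) v = f * ratio L w v" by (rule ratio_eq)
qed

lemma section_div_smul:
  assumes hom: "field_hom \<iota>" and L: "is_line_bundle \<iota> L" and f: "f \<noteq> 0" and s: "s \<noteq> 0"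
  shows "section_div \<iota> L (smul L f s) = section_div \<iota> L s + principal \<iota> f"
proof
  fix P
  show "section_div \<iota> L (smul L f s) P = (section_div \<iota> L s + principal \<iota> f) P"
  proof (cases "closed_point \<iota> P")
    case True
    interpret field_hom \<iota> by (rule hom)
    interpret closed_pt \<iota> P using True by unfold_locales
    interpret vector_space "smul L" using L by (simp add: is_line_bundle_def)
    define g where "g = (SOME g. generator L P g)"
    have "\<exists>g. generator L P g" using L True by (simp add: is_line_bundle_def)
    then have "generator L P g" unfolding g_def by (rule someI_ex)
    then have g: "g \<noteq> 0" by (simp add: generator_def)
    have "ratio L s g \<noteq> 0"
    proof
      assume "ratio L s g = 0"
      with ratio_smul(1)[OF L g, of s] s show False by simp
    qed
    then show ?thesis
      using True f
      by (simp add: section_div_def principal_def ratio_smul(2)[OF L g] ord_mult flip: g_def)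
  qed (simp add: section_div_def principal_def)
qed

text \<open>A sum over an infinite set is 0, so a positive degree forces the support to be
  finite.\<close>

lemma section_div_Div:
  assumes "has_degree \<iota> L (int d)" "d \<ge> 1" "s \<noteq> 0"
  shows "section_div \<iota> L s \<in> Div \<iota>" "degree_div \<iota> (section_div \<iota> L s) = int d"
proof -
  show deg: "degree_div \<iota> (section_div \<iota> L s) = int d" using assms by (simp add: has_degree_def)
  have "finite (Supp (section_div \<iota> L s))"
  proof (rule ccontr)
    assume "infinite (Supp (section_div \<iota> L s))"
    then show False using deg assms(2) by (simp add: degree_div_def)
  qed
  then show "section_div \<iota> L s \<in> Div \<iota>"
    by (auto simp: Div_def Supp_def section_div_def split: if_splits)
qed

text \<open>A principal divisor (f) is the difference of the divisors of the sections
  \<open>smul L f s\<close> and \<open>s\<close>, which have the same degree.\<close>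

lemma degree_zero_curveI:
  fixes \<iota> :: "'k::field \<Rightarrow> 'f::field" and L :: "('f, 'v::ab_group_add) line_bundle" and s :: 'v
  assumes C: "curve \<iota>" "has_rational_point \<iota>"
    and L: "is_line_bundle \<iota> L" "has_degree \<iota> L (int d)" "d \<ge> 1" and s: "s \<noteq> 0"
  shows "degree_zero_curve \<iota>"
proof -
  have ff: "function_field \<iota>" using C by (simp add: curve_def)
  then have hom: "field_hom \<iota>" by (simp add: function_field_def)
  interpret field_hom \<iota> by (rule hom)
  interpret vector_space "smul L" using L by (simp add: is_line_bundle_def)
  show ?thesis
  proof
    show "function_field \<iota>" by (rule ff)
    show "has_rational_point \<iota>" by (rule C)
    fix f :: 'f assume f: "f \<noteq> 0"
    have fs: "smul L f s \<noteq> 0" using f s by simp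
    have eq: "principal \<iota> f = section_div \<iota> L (smul L f s) - section_div \<iota> L s"
      using section_div_smul[OF hom L(1) f s] by simp
    show "principal \<iota> f \<in> Div0 \<iota>"
      unfolding eq Div0_def
      using section_div_Div[OF L(2,3) fs] section_div_Div[OF L(2,3) s]
      by (simp add: Div_diff degree_div_diff)
  qed
qed

section \<open>Bilinear combinations\<close>

text \<open>By (a), for fixed i all \<open>\<pi> i j\<close> are multiples of points over the single
  divisor \<open>D' i\<close>. So the scalars come out of the combination in \<open>group2\<close>,
  and (b) and (c) reduce it to a multiple of \<open>br (D' i) E''\<close>. All rows now share
  \<open>E''\<close>, so the scalars also come out in \<open>group1\<close>, and (d) applies. For
  this the classes that index the groups must be recognized as those of the representing
  divisors.\<close>

theorem mainTheorem10:
  fixes \<iota> :: "'k::field \<Rightarrow> 'f::field"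
    and L :: "('f, 'v::ab_group_add) line_bundle" and d\<^sub>0 e\<^sub>0 :: 'v and \<delta> :: nat
    and D\<^sub>0 E\<^sub>0 D'' E'' :: "'f divisor"
    and D E :: "nat \<Rightarrow> nat \<Rightarrow> 'f divisor" and D' E' :: "nat \<Rightarrow> 'f divisor"
    and r s :: nat and m n :: "nat \<Rightarrow> int"
    and x y :: "nat \<Rightarrow> 'f divisor set"
    and \<pi> :: "nat \<Rightarrow> nat \<Rightarrow> ('k, 'f) triple set"
    and l \<mu> :: "nat \<Rightarrow> nat \<Rightarrow> 'k" and \<nu> \<nu>' \<rho> :: "nat \<Rightarrow> 'k" and \<sigma> :: 'k
    and br :: "'f divisor \<Rightarrow> 'f divisor \<Rightarrow> ('k, 'f) triple set"
  assumes C: "curve \<iota>" "has_rational_point \<iota>"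
    and L: "is_line_bundle \<iota> L" "has_degree \<iota> L (int \<delta>)" "\<delta> \<ge> 2 * genus \<iota> + 1"
    and d\<^sub>0: "d\<^sub>0 \<in> global_sections \<iota> L" "d\<^sub>0 \<noteq> 0" "D\<^sub>0 = section_div \<iota> L d\<^sub>0"
    and e\<^sub>0: "e\<^sub>0 \<in> global_sections \<iota> L" "e\<^sub>0 \<noteq> 0" "E\<^sub>0 = section_div \<iota> L e\<^sub>0"
    and br: "\<And>A B. br A B = div_point \<iota> (A - D\<^sub>0) (B - E\<^sub>0)"
    and rs: "r \<ge> 1" "s \<ge> 1"
    and x: "\<And>i. i \<in> {1..r} \<Longrightarrow> x i \<in> carrier (Jac \<iota>)"
    and y: "\<And>j. j \<in> {1..s} \<Longrightarrow> y j \<in> carrier (Jac \<iota>)"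
    and eff: "\<And>i j. i \<in> {1..r} \<Longrightarrow> j \<in> {1..s} \<Longrightarrow>
                effective_of_degree \<iota> \<delta> (D i j) \<and> effective_of_degree \<iota> \<delta> (E i j)"
      "\<And>i. i \<in> {1..r} \<Longrightarrow> effective_of_degree \<iota> \<delta> (D' i) \<and> effective_of_degree \<iota> \<delta> (E' i)"
      "effective_of_degree \<iota> \<delta> D''" "effective_of_degree \<iota> \<delta> E''"
    and disj: "\<And>A B.
        A \<in> {D\<^sub>0, D''} \<union> D' ` {1..r} \<union> {D i j | i j. i \<in> {1..r} \<and> j \<in> {1..s}} \<Longrightarrow>
        B \<in> {E\<^sub>0, E''} \<union> E' ` {1..r} \<union> {E i j | i j. i \<in> {1..r} \<and> j \<in> {1..s}} \<Longrightarrow>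
        disjoint_div A B"
    and nz: "\<And>i j. i \<in> {1..r} \<Longrightarrow> j \<in> {1..s} \<Longrightarrow> l i j \<noteq> 0 \<and> \<mu> i j \<noteq> 0"
      "\<And>i. i \<in> {1..r} \<Longrightarrow> \<nu> i \<noteq> 0 \<and> \<rho> i \<noteq> 0" "\<sigma> \<noteq> 0"
    and \<pi>: "\<And>i j. i \<in> {1..r} \<Longrightarrow> j \<in> {1..s} \<Longrightarrow>
               \<pi> i j \<in> fibre \<iota> (x i) (y j) \<and> \<pi> i j = scale_point (l i j) (br (D i j) (E i j))"
    and a: "\<And>i j. i \<in> {1..r} \<Longrightarrow> j \<in> {1..s} \<Longrightarrow>
               lin_equiv \<iota> (D' i) (D i j) \<and>
               br (D i j) (E i j) = scale_point (\<mu> i j) (br (D' i) (E i j))"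
    and b: "\<And>i. i \<in> {1..r} \<Longrightarrow>
               finprod (group2 \<iota> (x i)) (\<lambda>j. br (D' i) (E i j) [^]\<^bsub>group2 \<iota> (x i)\<^esub> n j) {1..s}
               = scale_point (\<nu> i) (br (D' i) (E' i))"
    and c: "\<And>i. i \<in> {1..r} \<Longrightarrow>
               lin_equiv \<iota> E'' (E' i) \<and>
               br (D' i) (E' i) = scale_point (\<rho> i) (br (D' i) E'')"
    and d: "finprod (group1 \<iota> (div_class \<iota> (E'' - E\<^sub>0)))
               (\<lambda>i. br (D' i) E'' [^]\<^bsub>group1 \<iota> (div_class \<iota> (E'' - E\<^sub>0))\<^esub> m i) {1..r}
            = scale_point \<sigma> (br D'' E'')"
    and \<nu>': "\<And>i. \<nu>' i = \<nu> i * (\<Prod>j\<in>{1..s}. (l i j * \<mu> i j) powi n j)"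
  shows "let x\<^sub>m = finprod (Jac \<iota>) (\<lambda>i. x i [^]\<^bsub>Jac \<iota>\<^esub> m i) {1..r};
             y\<^sub>n = finprod (Jac \<iota>) (\<lambda>j. y j [^]\<^bsub>Jac \<iota>\<^esub> n j) {1..s};
             \<beta> = finprod (group1 \<iota> y\<^sub>n)
                   (\<lambda>i. finprod (group2 \<iota> (x i)) (\<lambda>j. \<pi> i j [^]\<^bsub>group2 \<iota> (x i)\<^esub> n j) {1..s}
                        [^]\<^bsub>group1 \<iota> y\<^sub>n\<^esub> m i) {1..r}
         in \<beta> = scale_point (\<sigma> * (\<Prod>i\<in>{1..r}. (\<nu>' i * \<rho> i) powi m i)) (br D'' E'')
            \<and> \<beta> \<in> fibre \<iota> x\<^sub>m y\<^sub>n"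
proof -
  have \<delta>: "\<delta> \<ge> 1" using L(3) by simp
  interpret degree_zero_curve \<iota> by (rule degree_zero_curveI[OF C L(1,2) \<delta> d\<^sub>0(2)])
  note D0 = section_div_Div[OF L(2) \<delta> d\<^sub>0(2), folded d\<^sub>0(3)]
  note E0 = section_div_Div[OF L(2) \<delta> e\<^sub>0(2), folded e\<^sub>0(3)]
  have Div0D: "A - D\<^sub>0 \<in> Div0 \<iota>" and Div0E: "A - E\<^sub>0 \<in> Div0 \<iota>"
    if "effective_of_degree \<iota> \<delta> A" for A
    using that D0 E0 by (auto simp: effective_of_degree_def Div0_def Div_diff degree_div_diff)
  have disjoint: "disjoint_div (A - D\<^sub>0) (B - E\<^sub>0)"
    if "disjoint_div A B" "disjoint_div A E\<^sub>0" "disjoint_div D\<^sub>0 B" "disjoint_div D\<^sub>0 E\<^sub>0" for A B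
    using that Supp_diff[of A D\<^sub>0] Supp_diff[of B E\<^sub>0]
    unfolding disjoint_div_def disjnt_def by blast
  define \<D> where "\<D> = {D\<^sub>0, D''} \<union> D' ` {1..r} \<union> {D i j | i j. i \<in> {1..r} \<and> j \<in> {1..s}}"
  define \<E> where "\<E> = {E\<^sub>0, E''} \<union> E' ` {1..r} \<union> {E i j | i j. i \<in> {1..r} \<and> j \<in> {1..s}}"
  have br_pt: "br A B = pt (A - D\<^sub>0) (B - E\<^sub>0) 1"
    if "A \<in> \<D>" "B \<in> \<E>" "effective_of_degree \<iota> \<delta> A" for A B
  proof -
    have "D\<^sub>0 \<in> \<D>" "E\<^sub>0 \<in> \<E>" by (simp_all add: \<D>_def \<E>_def)
    with disj[folded \<D>_def \<E>_def] that have "disjoint_div (A - D\<^sub>0) (B - E\<^sub>0)"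
      by (intro disjoint) blast+
    then show ?thesis unfolding br by (rule div_point_pt[OF Div0D[OF that(3)]])
  qed
  have in\<D>: "D'' \<in> \<D>" "\<And>i. i \<in> {1..r} \<Longrightarrow> D' i \<in> \<D>"
      "\<And>i j. i \<in> {1..r} \<Longrightarrow> j \<in> {1..s} \<Longrightarrow> D i j \<in> \<D>"
    and in\<E>: "E'' \<in> \<E>" "\<And>i. i \<in> {1..r} \<Longrightarrow> E' i \<in> \<E>"
      "\<And>i j. i \<in> {1..r} \<Longrightarrow> j \<in> {1..s} \<Longrightarrow> E i j \<in> \<E>"
    unfolding \<D>_def \<E>_def by blast+
  have effD: "effective_of_degree \<iota> \<delta> (D i j)" and effE: "effective_of_degree \<iota> \<delta> (E i j)"
    if "i \<in> {1..r}" "j \<in> {1..s}" for i j using eff(1)[OF that] by auto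
  have effD': "effective_of_degree \<iota> \<delta> (D' i)" and effE': "effective_of_degree \<iota> \<delta> (E' i)"
    if "i \<in> {1..r}" for i using eff(2)[OF that] by auto
  note Div0s = Div0D[OF effD] Div0E[OF effE] Div0D[OF effD'] Div0E[OF effE']
    Div0D[OF eff(3)] Div0E[OF eff(4)]
  have class_shift: "div_class \<iota> (A - Z) = div_class \<iota> (B - Z)" if "lin_equiv \<iota> A B" for A B Z
  proof -
    from that obtain f where "f \<noteq> 0" "A = B + pr f" unfolding lin_equiv_def by blast
    then show ?thesis unfolding div_class_eq_iff by (intro exI[of _ f]) simp
  qed
  \<comment> \<open>A point lies in one fibre only, so \<open>x i\<close> and \<open>y j\<close> are
    the classes of the divisors that represent \<open>\<pi> i j\<close>.\<close>
  have classes: "x i = div_class \<iota> (D i j - D\<^sub>0)" "y j = div_class \<iota> (E i j - E\<^sub>0)"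
    if i: "i \<in> {1..r}" and j: "j \<in> {1..s}" for i j
  proof -
    have "\<pi> i j = pt (D i j - D\<^sub>0) (E i j - E\<^sub>0) (l i j)"
      using \<pi>[OF i j] nz(1)[OF i j] br_pt[OF in\<D>(3)[OF i j] in\<E>(3)[OF i j] effD[OF i j]]
        Div0s(1,2)[OF i j] by (simp add: scale_point_pt)
    moreover have "\<pi> i j \<in> fibre \<iota> (x i) (y j)" using \<pi>[OF i j] by blast
    ultimately have "pt (D i j - D\<^sub>0) (E i j - E\<^sub>0) (l i j) \<in> fibre \<iota> (x i) (y j)"
      by (simp only:)
    from pt_fibreD[OF this Div0s(1,2)[OF i j]] nz(1)[OF i j]
    show "x i = div_class \<iota> (D i j - D\<^sub>0)" "y j = div_class \<iota> (E i j - E\<^sub>0)" by auto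
  qed
  \<comment> \<open>As r and s are positive, index 1 is available on both sides. It links
    \<open>x i\<close>, and later \<open>y\<^sub>n\<close>, to the divisors of one
    representative.\<close>
  have s1: "1 \<in> {1..s}" and r1: "1 \<in> {1..r}" using rs by auto
  have x_eq: "x i = div_class \<iota> (D' i - D\<^sub>0)" if i: "i \<in> {1..r}" for i
    using classes(1)[OF i s1] class_shift[of "D' i" "D i 1"] a[OF i s1] by simp
  define G2 where "G2 = (\<lambda>i. group2 \<iota> (x i))"
  define b' where "b' = (\<lambda>i j. br (D' i) (E i j))"
  define x\<^sub>m where "x\<^sub>m = finprod (Jac \<iota>) (\<lambda>i. x i [^]\<^bsub>Jac \<iota>\<^esub> m i) {1..r}"
  define y\<^sub>n where "y\<^sub>n = finprod (Jac \<iota>) (\<lambda>j. y j [^]\<^bsub>Jac \<iota>\<^esub> n j) {1..s}"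
  \<comment> \<open>The scalar that will stand in front of \<open>br (D' i) E''\<close> after the
    inner combination of row i.\<close>
  define \<kappa> where "\<kappa> = (\<lambda>i. \<nu>' i * \<rho> i)"
  have \<kappa>_nz: "\<kappa> i \<noteq> 0" if "i \<in> {1..r}" for i
    using nz(1)[OF that] nz(2)[OF that] by (simp add: \<kappa>_def \<nu>')
  have b'_pt: "b' i j = pt (D' i - D\<^sub>0) (E i j - E\<^sub>0) 1" if i: "i \<in> {1..r}" and j: "j \<in> {1..s}" for i j
    unfolding b'_def by (rule br_pt[OF in\<D>(2)[OF i] in\<E>(3)[OF i j] effD'[OF i]])
  have inner: "finprod (G2 i) (\<lambda>j. \<pi> i j [^]\<^bsub>G2 i\<^esub> n j) {1..s} = scale_point (\<kappa> i) (br (D' i) E'')"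
    and inner_class: "y\<^sub>n = div_class \<iota> (E' i - E\<^sub>0)"
    if i: "i \<in> {1..r}" for i
  proof -
    note D'0 = Div0s(3)[OF i]
    interpret scaled_comm_group "G2 i" scale_point
      unfolding G2_def x_eq[OF i] by (rule partial_law.scaled[OF partial_law2[OF D'0]])
    interpret R: group_relation "G2 i" "Jac \<iota>" "\<lambda>\<pi> y. \<pi> \<in> fibre \<iota> (div_class \<iota> (D' i - D\<^sub>0)) y"
      unfolding G2_def x_eq[OF i] by (rule fibre_relation2[OF D'0])
    have fib: "b' i j \<in> fibre \<iota> (div_class \<iota> (D' i - D\<^sub>0)) (y j)" if j: "j \<in> {1..s}" for j
      unfolding b'_pt[OF i j] classes(2)[OF i j] using D'0 Div0s(2)[OF i j] by (intro pt_fibre) auto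
    have b'_carrier: "b' i j \<in> carrier (G2 i)" if "j \<in> {1..s}" for j
      using R.rel_carrier[OF fib[OF that]] by blast
    define B where "B = finprod (G2 i) (\<lambda>j. b' i j [^]\<^bsub>G2 i\<^esub> n j) {1..s}"
    have B: "B = scale_point (\<nu> i) (br (D' i) (E' i))"
      using b[OF i] by (simp add: B_def b'_def G2_def)
    have E'_pt: "br (D' i) (E' i) = pt (D' i - D\<^sub>0) (E' i - E\<^sub>0) 1"
      and E''_pt: "br (D' i) E'' = pt (D' i - D\<^sub>0) (E'' - E\<^sub>0) 1"
      using br_pt[OF in\<D>(2)[OF i] _ effD'[OF i]] in\<E>(1) in\<E>(2)[OF i] by blast+
    \<comment> \<open>The inner combination lies over \<open>y\<^sub>n\<close>, as fibres follow the
      group law of the Jacobian, and over the class of \<open>E' i - E\<^sub>0\<close> by (b). So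
      the two classes coincide.\<close>
    have "B \<in> fibre \<iota> (div_class \<iota> (D' i - D\<^sub>0)) y\<^sub>n"
      unfolding B_def y\<^sub>n_def by (intro R.rel_finprod R.rel_int_pow fib) auto
    moreover have "B = pt (D' i - D\<^sub>0) (E' i - E\<^sub>0) (\<nu> i)"
      unfolding B E'_pt using nz(2)[OF i] D'0 Div0s(4)[OF i] by (simp add: scale_point_pt)
    ultimately show "y\<^sub>n = div_class \<iota> (E' i - E\<^sub>0)"
      using pt_fibreD(2)[OF _ D'0 Div0s(4)[OF i]] nz(2)[OF i] by metis
    have \<pi>_eq: "\<pi> i j = scale_point (l i j * \<mu> i j) (b' i j)" if j: "j \<in> {1..s}" for j
    proof -
      have "\<pi> i j = scale_point (l i j) (scale_point (\<mu> i j) (b' i j))"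
        using \<pi>[OF i j] a[OF i j] by (simp add: b'_def)
      then show ?thesis
        using nz(1)[OF i j] D'0 Div0s(2)[OF i j] by (simp add: b'_pt[OF i j] scale_point_pt)
    qed
    have k: "(l i j * \<mu> i j) powi n j \<noteq> 0" if "j \<in> {1..s}" for j using nz(1)[OF i that] by simp
    have "finprod (G2 i) (\<lambda>j. \<pi> i j [^]\<^bsub>G2 i\<^esub> n j) {1..s} =
        finprod (G2 i) (\<lambda>j. scale_point ((l i j * \<mu> i j) powi n j) (b' i j [^]\<^bsub>G2 i\<^esub> n j)) {1..s}"
    proof (rule finprod_cong'[OF refl])
      show "(\<lambda>j. scale_point ((l i j * \<mu> i j) powi n j) (b' i j [^]\<^bsub>G2 i\<^esub> n j)) \<in> {1..s} \<rightarrow> carrier (G2 i)"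
        using b'_carrier k by (intro Pi_I sc_closed int_pow_closed) auto
      show "\<pi> i j [^]\<^bsub>G2 i\<^esub> n j = scale_point ((l i j * \<mu> i j) powi n j) (b' i j [^]\<^bsub>G2 i\<^esub> n j)"
        if j: "j \<in> {1..s}" for j
        unfolding \<pi>_eq[OF j] using nz(1)[OF i j] by (intro sc_int_pow b'_carrier j) simp
    qed
    also have "\<dots> = scale_point (\<Prod>j\<in>{1..s}. (l i j * \<mu> i j) powi n j) B"
      unfolding B_def using b'_carrier k by (intro sc_finprod int_pow_closed) auto
    also have "\<dots> = scale_point (\<Prod>j\<in>{1..s}. (l i j * \<mu> i j) powi n j)
        (scale_point (\<nu> i) (scale_point (\<rho> i) (br (D' i) E'')))"
      unfolding B using c[OF i] by simp
    also have "\<dots> = scale_point (\<kappa> i) (br (D' i) E'')"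
      unfolding E''_pt using nz(2)[OF i] k D'0 Div0s(6)
      by (simp add: scale_point_pt \<kappa>_def \<nu>' mult_ac)
    finally show "finprod (G2 i) (\<lambda>j. \<pi> i j [^]\<^bsub>G2 i\<^esub> n j) {1..s} = scale_point (\<kappa> i) (br (D' i) E'')" .
  qed
  \<comment> \<open>\<open>y\<^sub>n\<close> is the same for all rows, so row 1 suffices, where (c)
    replaces \<open>E' 1\<close> by \<open>E''\<close>.\<close>
  have y\<^sub>n_eq: "y\<^sub>n = div_class \<iota> (E'' - E\<^sub>0)"
    using inner_class[OF r1] class_shift[of E'' "E' 1"] c[OF r1] by simp
  define G1 where "G1 = group1 \<iota> y\<^sub>n"
  interpret scaled_comm_group G1 scale_point
    unfolding G1_def y\<^sub>n_eq by (rule partial_law.scaled[OF partial_law1[OF Div0s(6)]])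
  interpret R: group_relation G1 "Jac \<iota>" "\<lambda>\<pi> x. \<pi> \<in> fibre \<iota> x (div_class \<iota> (E'' - E\<^sub>0))"
    unfolding G1_def y\<^sub>n_eq by (rule fibre_relation1[OF Div0s(6)])
  have fib: "br (D' i) E'' \<in> fibre \<iota> (x i) (div_class \<iota> (E'' - E\<^sub>0))" if i: "i \<in> {1..r}" for i
    unfolding x_eq[OF i] br_pt[OF in\<D>(2)[OF i] in\<E>(1) effD'[OF i]]
    using Div0s(3)[OF i] Div0s(6) by (intro pt_fibre) auto
  have carr: "br (D' i) E'' \<in> carrier G1" if "i \<in> {1..r}" for i
    using R.rel_carrier[OF fib[OF that]] by blast
  define A where "A = finprod G1 (\<lambda>i. br (D' i) E'' [^]\<^bsub>G1\<^esub> m i) {1..r}"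
  have A: "A = scale_point \<sigma> (br D'' E'')"
    using d by (simp add: A_def G1_def y\<^sub>n_eq)
  \<comment> \<open>The same comparison of fibres, now with (d), identifies
    \<open>x\<^sub>m\<close>.\<close>
  have "A \<in> fibre \<iota> x\<^sub>m (div_class \<iota> (E'' - E\<^sub>0))"
    unfolding A_def x\<^sub>m_def by (intro R.rel_finprod R.rel_int_pow fib) auto
  moreover have D''_pt: "br D'' E'' = pt (D'' - D\<^sub>0) (E'' - E\<^sub>0) 1"
    by (rule br_pt[OF in\<D>(1) in\<E>(1) eff(3)])
  moreover have "A = pt (D'' - D\<^sub>0) (E'' - E\<^sub>0) \<sigma>"
    unfolding A D''_pt using nz(3) Div0s(5,6) by (simp add: scale_point_pt)
  ultimately have x\<^sub>m_eq: "x\<^sub>m = div_class \<iota> (D'' - D\<^sub>0)"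
    using pt_fibreD(1)[OF _ Div0s(5,6) nz(3)] by metis
  define K where "K = (\<Prod>i\<in>{1..r}. \<kappa> i powi m i)"
  have K: "K \<noteq> 0" using \<kappa>_nz by (simp add: K_def)
  have k: "\<kappa> i powi m i \<noteq> 0" if "i \<in> {1..r}" for i using \<kappa>_nz[OF that] by simp
  define \<beta> where "\<beta> = finprod G1 (\<lambda>i. finprod (G2 i) (\<lambda>j. \<pi> i j [^]\<^bsub>G2 i\<^esub> n j) {1..s} [^]\<^bsub>G1\<^esub> m i) {1..r}"
  have "\<beta> = finprod G1 (\<lambda>i. scale_point (\<kappa> i powi m i) (br (D' i) E'' [^]\<^bsub>G1\<^esub> m i)) {1..r}"
    unfolding \<beta>_def
  proof (rule finprod_cong'[OF refl])
    show "(\<lambda>i. scale_point (\<kappa> i powi m i) (br (D' i) E'' [^]\<^bsub>G1\<^esub> m i)) \<in> {1..r} \<rightarrow> carrier G1"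
      using carr k by (intro Pi_I sc_closed int_pow_closed) auto
    show "finprod (G2 i) (\<lambda>j. \<pi> i j [^]\<^bsub>G2 i\<^esub> n j) {1..s} [^]\<^bsub>G1\<^esub> m i =
        scale_point (\<kappa> i powi m i) (br (D' i) E'' [^]\<^bsub>G1\<^esub> m i)" if i: "i \<in> {1..r}" for i
      unfolding inner[OF i] by (rule sc_int_pow[OF carr[OF i] \<kappa>_nz[OF i]])
  qed
  also have "\<dots> = scale_point K A"
    unfolding A_def K_def using carr k by (intro sc_finprod int_pow_closed) auto
  also have "\<dots> = pt (D'' - D\<^sub>0) (E'' - E\<^sub>0) (\<sigma> * K)"
    unfolding A D''_pt using K nz(3) Div0s(5,6) by (simp add: scale_point_pt mult.commute)
  finally have \<beta>: "\<beta> = pt (D'' - D\<^sub>0) (E'' - E\<^sub>0) (\<sigma> * K)" .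
  have \<sigma>K: "\<sigma> * K \<noteq> 0" using K nz(3) by simp
  have 1: "\<beta> = scale_point (\<sigma> * K) (br D'' E'')"
    unfolding \<beta> D''_pt using \<sigma>K Div0s(5,6) by (simp add: scale_point_pt)
  have 2: "\<beta> \<in> fibre \<iota> x\<^sub>m y\<^sub>n"
    unfolding \<beta> x\<^sub>m_eq y\<^sub>n_eq by (rule pt_fibre[OF Div0s(5,6) \<sigma>K])
  from 1 2 show ?thesis
    unfolding Let_def \<beta>_def G1_def G2_def K_def \<kappa>_def x\<^sub>m_def y\<^sub>n_def by (rule conjI)
qed

end
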